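(* Let $W$ be a finite real reflection group acting on $\mathbb{R}^n$ with simple system spanning $\mathbb{R}^n$, let $k$ be an integer with $3\le k\le n+1$, let $\mathscr{W}_{n,k}$ be the $k$-parabolic arrangement of $W$ and $\mathcal{M}(\mathscr{W}_{n,k})=\mathbb{R}^n\setminus\bigcup_{X\in\mathscr{W}_{n,k}}X$ its complement. Then $$\pi_1(\mathcal{M}(\mathscr{W}_{n,k}))\cong A_1^{n-k+1}(\mathscr{C}(W)).$$
   Context: Setup: $W$ is a finite real reflection group on $\mathbb{R}^n$ with root system $\Phi$, simple system $\Pi\subseteq\Phi$ spanning $\mathbb{R}^n$, and $S$ the set of simple reflections (so $|S|=n$); $W_I=\langle I\rangle$ for $I\subseteq S$. A subgroup $G\subseteq W$ is parabolic if $G=\langle wTw^{-1}\rangle$ for some $T\subseteq S$, $w\in W$; its rank is $|T|$; it is irreducible if the Coxeter system $(G,wTw^{-1})$ is irreducible. $Fix(G)=\{x\in\mathbb{R}^n: gx=x\ \forall g\in G\}$. The $k$-parabolic arrangement is $\mathscr{W}_{n,k}=\{Fix(G): G \text{ an irreducible parabolic subgroup of } W \text{ of rank } k-1\}$. Coxeter complex $\mathscr{C}(W)$: the abstract simplicial complex with vertex set the cosets $wW_{S\setminus\{s\}}$ ($w\in W$, $s\in S$), whose faces are the sets $\{wW_{S\setminus\{s\}}: s\in J\}$ for $w\in W$, $J\subseteq S$ (equivalently, faces correspond to cosets $wW_I$, ordered by reverse inclusion; geometrically it is the simplicial decomposition of the unit sphere cut out by the reflecting hyperplanes of $W$). It has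 dimension $n-1$; its maximal simplices correspond bijectively to elements of $W$. Discrete homotopy: for a simplicial complex $\Delta$ of dimension $d$ and $0\le q\le d$, two simplices are $q$-near if they share at least $q+1$ vertices. A $q$-chain is a sequence of simplices with consecutive terms $q$-near; for a maximal simplex $\sigma_0$ of dimension $\ge q$, a $q$-loop based at $\sigma_0$ is a $q$-chain beginning and ending at $\sigma_0$. Let $\simeq_q$ be the equivalence relation on $q$-loops based at $\sigma_0$ generated by (i) stretching: $(\sigma_0,\dots,\sigma_i,\sigma_{i+1},\dots,\sigma_0)\simeq(\sigma_0,\dots,\sigma_i,\sigma_i,\sigma_{i+1},\dots,\sigma_0)$; (ii) two $q$-loops $(\sigma),(\tau)$ of the same length are equivalent if there is a homotopy grid: a finite sequence of $q$-loops based at $\sigma_0$, all of that length, the first being $(\sigma)$ and the last $(\tau)$, such that for consecutive loops in the sequence the entries in each position are $q$-near. $A_1^q(\Delta,\sigma_0)$ is the set of equivalence classes with the group operation induced by concatenation. For $\mathscr{C}(W)$ this does not depend on the choice of base maximal simplex, and is denoted $A_1^q(\mathscr{C}(W))$. *)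

theory Defs
  imports "HOL-Analysis.Analysis" "HOL-Algebra.Multiplicative_Group" "HOL-Algebra.Generated_Groups"
begin

definition orthogonal_group :: "('a::euclidean_space \<Rightarrow> 'a) monoid" where
  "orthogonal_group = \<lparr>carrier = {f. orthogonal_transformation f}, mult = (\<circ>), one = id\<rparr>"

definition reflection :: "'a::euclidean_space \<Rightarrow> 'a \<Rightarrow> 'a" where
  "reflection \<alpha> x = x - (2 * (x \<bullet> \<alpha>) / (\<alpha> \<bullet> \<alpha>)) *\<^sub>R \<alpha>"

text \<open>\<^const>\<open>group.ord\<close> and the inverses used below are meaningful because of the following fact.\<close>

lemma group_orthogonal_group: "group (orthogonal_group :: ('a::euclidean_space \<Rightarrow> 'a) monoid)"
proof (rule groupI)
  fix f :: "'a \<Rightarrow> 'a" assume "f \<in> carrier orthogonal_group"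
  then have f: "orthogonal_transformation f" by (simp add: orthogonal_group_def)
  then have "orthogonal_transformation (inv_into UNIV f)" "inv_into UNIV f \<circ> f = id"
    by (auto simp: orthogonal_transformation_inv orthogonal_transformation_inj)
  then show "\<exists>g\<in>carrier orthogonal_group. g \<otimes>\<^bsub>orthogonal_group\<^esub> f = \<one>\<^bsub>orthogonal_group\<^esub>"
    by (auto simp: orthogonal_group_def)
qed (auto simp: orthogonal_group_def orthogonal_transformation_compose o_assoc id_def)

lemma reflection_in_orthogonal_group: "reflection \<alpha> \<in> carrier orthogonal_group"
proof -
  have "linear (reflection \<alpha>)"
    by (rule linearI) (auto simp: reflection_def algebra_simps inner_left_distrib add_divide_distrib)
  moreover have "reflection \<alpha> v \<bullet> reflection \<alpha> w = v \<bullet> w" for v w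
    by (cases "\<alpha> = 0") (auto simp: reflection_def inner_diff_left inner_diff_right inner_commute field_simps)
  ultimately show ?thesis
    by (simp add: orthogonal_group_def orthogonal_transformation_def)
qed

text \<open>Root systems need not be crystallographic.\<close>

definition root_system :: "'a::euclidean_space set \<Rightarrow> bool" where
  "root_system \<Phi> \<longleftrightarrow> finite \<Phi> \<and> 0 \<notin> \<Phi> \<and>
     (\<forall>\<alpha>\<in>\<Phi>. \<Phi> \<inter> range (\<lambda>c. c *\<^sub>R \<alpha>) = {\<alpha>, - \<alpha>}) \<and>
     (\<forall>\<alpha>\<in>\<Phi>. reflection \<alpha> ` \<Phi> = \<Phi>)"

definition simple_system :: "'a::euclidean_space set \<Rightarrow> 'a set \<Rightarrow> bool" where
  "simple_system \<Phi> B \<longleftrightarrow> B \<subseteq> \<Phi> \<and> independent B \<and> span B = span \<Phi> \<and>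
     (\<forall>\<beta>\<in>\<Phi>. \<exists>c. \<beta> = (\<Sum>\<alpha>\<in>B. c \<alpha> *\<^sub>R \<alpha>) \<and>
        ((\<forall>\<alpha>\<in>B. 0 \<le> c \<alpha>) \<or> (\<forall>\<alpha>\<in>B. c \<alpha> \<le> 0)))"

definition reflection_group :: "'a::euclidean_space set \<Rightarrow> ('a \<Rightarrow> 'a) set" where
  "reflection_group \<Phi> = generate orthogonal_group (reflection ` \<Phi>)"

text \<open>Adjacency in the Coxeter graph: \<open>m(s,t) \<ge> 3\<close>, where \<open>m(s,t)\<close> is the order of \<open>st\<close>.
  Infinite order is encoded by \<^const>\<open>group.ord\<close> as \<open>0\<close> and would also give an edge, hence
  the formulation by \<open>\<noteq> 2\<close>.\<close>

definition coxeter_edge :: "('g, 'm) monoid_scheme \<Rightarrow> 'g \<Rightarrow> 'g \<Rightarrow> bool" where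
  "coxeter_edge G s t \<longleftrightarrow> s \<noteq> t \<and> group.ord G (s \<otimes>\<^bsub>G\<^esub> t) \<noteq> 2"

text \<open>Irreducibility of the Coxeter system generated by \<open>T\<close>: its Coxeter graph is connected.\<close>

definition irreducible_system :: "('g, 'm) monoid_scheme \<Rightarrow> 'g set \<Rightarrow> bool" where
  "irreducible_system G T \<longleftrightarrow> T \<noteq> {} \<and>
     (\<forall>s\<in>T. \<forall>t\<in>T. (s, t) \<in> {(a, b). a \<in> T \<and> b \<in> T \<and> coxeter_edge G a b}\<^sup>*)"

definition conjugate_set :: "('g, 'm) monoid_scheme \<Rightarrow> 'g \<Rightarrow> 'g set \<Rightarrow> 'g set" where
  "conjugate_set G w T = (\<lambda>t. w \<otimes>\<^bsub>G\<^esub> t \<otimes>\<^bsub>G\<^esub> inv\<^bsub>G\<^esub> w) ` T"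

definition irreducible_parabolic ::
    "('a::euclidean_space \<Rightarrow> 'a) set \<Rightarrow> ('a \<Rightarrow> 'a) set \<Rightarrow> nat \<Rightarrow> ('a \<Rightarrow> 'a) set \<Rightarrow> bool" where
  "irreducible_parabolic W S r G \<longleftrightarrow>
     (\<exists>T w. T \<subseteq> S \<and> w \<in> W \<and> G = generate orthogonal_group (conjugate_set orthogonal_group w T) \<and>
        card T = r \<and> irreducible_system orthogonal_group (conjugate_set orthogonal_group w T))"

definition Fix :: "('a \<Rightarrow> 'a) set \<Rightarrow> 'a set" where
  "Fix G = {x. \<forall>g\<in>G. g x = x}"

definition parabolic_arrangement ::
    "('a::euclidean_space \<Rightarrow> 'a) set \<Rightarrow> ('a \<Rightarrow> 'a) set \<Rightarrow> nat \<Rightarrow> 'a set set" where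
  "parabolic_arrangement W S k = {Fix G | G. irreducible_parabolic W S (k - 1) G}"

text \<open>A complex is the set of its faces. The empty face (\<open>J = {}\<close>) is included; it is
  not \<open>q\<close>-near to any simplex, so it plays no role below.\<close>

definition coxeter_complex ::
    "('a::euclidean_space \<Rightarrow> 'a) set \<Rightarrow> ('a \<Rightarrow> 'a) set \<Rightarrow> ('a \<Rightarrow> 'a) set set set" where
  "coxeter_complex W S =
     {(\<lambda>s. w <#\<^bsub>orthogonal_group\<^esub> generate orthogonal_group (S - {s})) ` J | w J. w \<in> W \<and> J \<subseteq> S}"

definition maximal_simplex :: "'v set set \<Rightarrow> 'v set \<Rightarrow> bool" where
  "maximal_simplex \<Delta> \<sigma> \<longleftrightarrow> \<sigma> \<in> \<Delta> \<and> (\<forall>\<tau>\<in>\<Delta>. \<sigma> \<subseteq> \<tau> \<longrightarrow> \<tau> = \<sigma>)"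

definition q_near :: "nat \<Rightarrow> 'v set \<Rightarrow> 'v set \<Rightarrow> bool" where
  "q_near q \<sigma> \<tau> \<longleftrightarrow> q + 1 \<le> card (\<sigma> \<inter> \<tau>)"

definition q_loops :: "nat \<Rightarrow> 'v set set \<Rightarrow> 'v set \<Rightarrow> 'v set list set" where
  "q_loops q \<Delta> \<sigma>\<^sub>0 = {l. l \<noteq> [] \<and> set l \<subseteq> \<Delta> \<and> successively (q_near q) l \<and>
     hd l = \<sigma>\<^sub>0 \<and> last l = \<sigma>\<^sub>0}"

definition stretching :: "'v list \<Rightarrow> 'v list \<Rightarrow> bool" where
  "stretching l l' \<longleftrightarrow> (\<exists>xs a ys. l = xs @ [a] @ ys \<and> l' = xs @ [a, a] @ ys)"

definition homotopy_grid :: "nat \<Rightarrow> 'v set set \<Rightarrow> 'v set \<Rightarrow> 'v set list \<Rightarrow> 'v set list \<Rightarrow> bool" where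
  "homotopy_grid q \<Delta> \<sigma>\<^sub>0 l l' \<longleftrightarrow>
     (\<exists>rows. rows \<noteq> [] \<and> hd rows = l \<and> last rows = l' \<and> set rows \<subseteq> q_loops q \<Delta> \<sigma>\<^sub>0 \<and>
        (\<forall>r\<in>set rows. length r = length l) \<and> successively (list_all2 (q_near q)) rows)"

definition discrete_homotopy_rel ::
    "nat \<Rightarrow> 'v set set \<Rightarrow> 'v set \<Rightarrow> ('v set list \<times> 'v set list) set" where
  "discrete_homotopy_rel q \<Delta> \<sigma>\<^sub>0 =
     {(l, l'). l \<in> q_loops q \<Delta> \<sigma>\<^sub>0 \<and> l' \<in> q_loops q \<Delta> \<sigma>\<^sub>0 \<and>
        equivclp (\<lambda>a b. a \<in> q_loops q \<Delta> \<sigma>\<^sub>0 \<and> b \<in> q_loops q \<Delta> \<sigma>\<^sub>0 \<and>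
          (stretching a b \<or> homotopy_grid q \<Delta> \<sigma>\<^sub>0 a b)) l l'}"

text \<open>Lists are concatenated with the base simplex repeated in the middle; dropping one of the
  two copies changes the product only by a stretching.\<close>

definition discrete_homotopy_group ::
    "nat \<Rightarrow> 'v set set \<Rightarrow> 'v set \<Rightarrow> 'v set list set monoid" where
  "discrete_homotopy_group q \<Delta> \<sigma>\<^sub>0 =
     \<lparr>carrier = q_loops q \<Delta> \<sigma>\<^sub>0 // discrete_homotopy_rel q \<Delta> \<sigma>\<^sub>0,
      mult = (\<lambda>A B. \<Union>a\<in>A. \<Union>b\<in>B. discrete_homotopy_rel q \<Delta> \<sigma>\<^sub>0 `` {a @ b}),
      one = discrete_homotopy_rel q \<Delta> \<sigma>\<^sub>0 `` {[\<sigma>\<^sub>0]}\<rparr>"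

definition loops_at :: "'a::topological_space set \<Rightarrow> 'a \<Rightarrow> (real \<Rightarrow> 'a) set" where
  "loops_at M x = {p. path p \<and> path_image p \<subseteq> M \<and> pathstart p = x \<and> pathfinish p = x}"

definition loop_homotopy_rel ::
    "'a::topological_space set \<Rightarrow> 'a \<Rightarrow> ((real \<Rightarrow> 'a) \<times> (real \<Rightarrow> 'a)) set" where
  "loop_homotopy_rel M x = {(p, q). p \<in> loops_at M x \<and> q \<in> loops_at M x \<and> homotopic_paths M p q}"

definition fundamental_group :: "'a::topological_space set \<Rightarrow> 'a \<Rightarrow> (real \<Rightarrow> 'a) set monoid" where
  "fundamental_group M x =
     \<lparr>carrier = loops_at M x // loop_homotopy_rel M x,
      mult = (\<lambda>A B. \<Union>p\<in>A. \<Union>q\<in>B. loop_homotopy_rel M x `` {p +++ q}),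
      one = loop_homotopy_rel M x `` {\<lambda>_. x}\<rparr>"

end

theory Submission
  imports Defs
begin

text \<open>
  Cover a union of open faces of the reflection arrangement that is closed under passing to larger
  faces by the open stars of its points. These stars are convex, so a path is determined up to
  homotopy by the chambers it visits, and its homotopy class becomes a word in the simple
  reflections, modulo identifying words with equal product that are supported on the type of a
  retained face. For \<open>k = 3\<close> the retained types are the sets of pairwise orthogonal simple
  roots, so the relations say that each simple reflection is an involution and that orthogonal ones
  commute. Those are also the relations imposed by discrete homotopy on loops in the Cayley graph,
  whose squares come exactly from commuting pairs. For \<open>k > 3\<close> both groups are trivial: a
  polygonal loop avoiding finitely many subspaces of codimension at least three is contracted by
  coning it off from a generic point, and the same statement, applied to the union of the faces of
  codimension at most two, kills every discrete loop.
\<close>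

section \<open>Reflections and words\<close>

text \<open>Neither group is compared with the other directly. Each is identified with the words in
  \<open>B\<close> of trivial product modulo one congruence: a loop in the complement has the word
  given by the holonomy of a word-valued cocycle on the cover, and a discrete loop has the word
  spelled by chosen chambers containing its simplices. The index q = n - k + 1 enters through types:
  two chambers share q + 1 vertices exactly when they differ by an element of a standard parabolic
  subgroup of rank at most n - (q + 1) = k - 2. Hence k = 3 gives the Cayley graph, and k > 3 makes
  all rank-two residues cliques. For k = 3 the discrete obstacle is that a cell of a homotopy grid
  is an arbitrary, possibly degenerate, 4-cycle. Linear independence of the simple roots decides it:
  a product of distinct simple reflections remembers its set of letters. The obstacle in the
  complement is that the arrangement contains translates by all of W, so roots other than the walls
  at a point may vanish there; such roots are shown to lie in the span of these walls.\<close>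

lemma orthogonal_reflection: "orthogonal_transformation (reflection \<alpha>)"
  using reflection_in_orthogonal_group[of \<alpha>] by (simp add: orthogonal_group_def)

lemma linear_reflection: "linear (reflection \<alpha>)"
  using orthogonal_reflection orthogonal_transformation_linear by blast

lemma reflection_involution [simp]: "reflection \<alpha> (reflection \<alpha> x) = x"
proof (cases "\<alpha> = 0")
  case False
  then have "\<alpha> \<bullet> \<alpha> \<noteq> 0" by simp
  then show ?thesis
    by (simp add: reflection_def inner_diff_left diff_divide_distrib flip: scaleR_add_left)
qed (simp add: reflection_def)

lemma reflection_self [simp]: "reflection \<alpha> \<alpha> = - \<alpha>"
  by (cases "\<alpha> = 0") (simp_all add: reflection_def scaleR_2)

lemma reflection_uminus [simp]: "reflection (- \<alpha>) = reflection \<alpha>"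
  by (rule ext) (simp add: reflection_def)

lemma reflection_fixes_iff: "\<alpha> \<noteq> 0 \<Longrightarrow> reflection \<alpha> x = x \<longleftrightarrow> x \<bullet> \<alpha> = 0"
  by (simp add: reflection_def)

lemma reflection_conjugate:
  assumes "orthogonal_transformation w"
  shows "reflection (w \<alpha>) (w x) = w (reflection \<alpha> x)"
  using assms
  by (simp add: reflection_def orthogonal_transformation_def linear_diff linear_scale)

text \<open>Words are lists of roots rather than of group elements, so that their supports can be
  used in linear algebra. The last letter acts first.\<close>

fun wprod :: "'a::euclidean_space list \<Rightarrow> 'a \<Rightarrow> 'a" where
  "wprod [] = id"
| "wprod (\<alpha> # u) = reflection \<alpha> \<circ> wprod u"

lemma wprod_append: "wprod (u @ v) = wprod u \<circ> wprod v"
  by (induction u) (auto simp: o_assoc)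

lemma orthogonal_wprod: "orthogonal_transformation (wprod u)"
  by (induction u) (auto simp: orthogonal_transformation_compose orthogonal_reflection id_def
      simp del: o_apply)

lemma linear_wprod: "linear (wprod u)"
  using orthogonal_wprod orthogonal_transformation_linear by blast

lemma wprod_inner: "wprod u x \<bullet> wprod u y = x \<bullet> y"
  using orthogonal_wprod by (auto simp: orthogonal_transformation_def)

lemma wprod_rev: "wprod (rev u) \<circ> wprod u = id"
  by (induction u) (auto simp: wprod_append fun_eq_iff)

lemma wprod_rev_apply [simp]: "wprod (rev u) (wprod u x) = x"
  using wprod_rev[of u] by (simp add: fun_eq_iff)

lemma wprod_rev_apply' [simp]: "wprod u (wprod (rev u) x) = x"
  using wprod_rev_apply[of "rev u"] by simp

lemma wprod_fixes:
  assumes "\<And>\<alpha>. \<alpha> \<in> set u \<Longrightarrow> x \<bullet> \<alpha> = 0"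
  shows "wprod u x = x"
  using assms by (induction u) (auto simp: reflection_def)

text \<open>A common reflection sends \<alpha> to -\<alpha>, so \<alpha> is a multiple of \<beta>.
  This lets subsets of \<open>B\<close> stand for subsets of the set of simple reflections.\<close>

lemma reflection_inj_on_independent:
  assumes "independent B" shows "inj_on reflection B"
proof (rule inj_onI)
  fix \<alpha> \<beta> assume ab: "\<alpha> \<in> B" "\<beta> \<in> B" "reflection \<alpha> = reflection \<beta>"
  show "\<alpha> = \<beta>"
  proof (rule ccontr)
    assume ne: "\<alpha> \<noteq> \<beta>"
    have "\<alpha> \<noteq> 0" using assms ab dependent_zero by auto
    have "- \<alpha> = \<alpha> - (2 * (\<alpha> \<bullet> \<beta>) / (\<beta> \<bullet> \<beta>)) *\<^sub>R \<beta>"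
      using ab(3) reflection_self[of \<alpha>] unfolding reflection_def[of \<beta>] by simp
    then have "2 *\<^sub>R \<alpha> = (2 * (\<alpha> \<bullet> \<beta>) / (\<beta> \<bullet> \<beta>)) *\<^sub>R \<beta>"
      by (simp add: scaleR_2 algebra_simps)
    then have "(1/2) *\<^sub>R 2 *\<^sub>R \<alpha> = (1/2) *\<^sub>R (2 * (\<alpha> \<bullet> \<beta>) / (\<beta> \<bullet> \<beta>)) *\<^sub>R \<beta>"
      by (rule arg_cong)
    then have "\<alpha> = (1/2) *\<^sub>R (2 * (\<alpha> \<bullet> \<beta>) / (\<beta> \<bullet> \<beta>)) *\<^sub>R \<beta>"
      by simp
    moreover have "\<beta> \<in> span (B - {\<alpha>})"
      using ab ne by (auto intro: span_base)
    ultimately have "\<alpha> \<in> span (B - {\<alpha>})"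
      using span_scale by metis
    then show False using assms ab dependent_def by blast
  qed
qed

text \<open>Reflections are their own inverses, so positive words suffice. The set \<open>I\<close>
  is arbitrary because the lemma is applied to all roots, to \<open>B\<close> with one root removed
  and to conjugates of subsets of \<open>B\<close>.\<close>

lemma generate_reflections:
  "generate orthogonal_group (reflection ` I) = {wprod u | u. set u \<subseteq> I}"
proof (intro equalityI subsetI)
  interpret group "orthogonal_group :: ('a \<Rightarrow> 'a) monoid" by (rule group_orthogonal_group)
  have refl_inv: "inv\<^bsub>orthogonal_group\<^esub> (reflection \<alpha>) = reflection \<alpha>" for \<alpha> :: 'a
    by (rule inv_equality[OF _ reflection_in_orthogonal_group reflection_in_orthogonal_group])
       (auto simp: orthogonal_group_def fun_eq_iff)
  fix f assume "f \<in> generate orthogonal_group (reflection ` I)"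
  then show "f \<in> {wprod u | u. set u \<subseteq> I}"
  proof (induction rule: generate.induct)
    case one
    have "wprod [] = \<one>\<^bsub>orthogonal_group\<^esub>" by (simp add: orthogonal_group_def)
    then show ?case by (metis (mono_tags, lifting) empty_set empty_subsetI mem_Collect_eq)
  next
    case (incl h)
    then obtain \<alpha> where "\<alpha> \<in> I" "h = reflection \<alpha>" by auto
    then show ?case by (auto intro!: exI[of _ "[\<alpha>]"])
  next
    case (inv h)
    then obtain \<alpha> where "\<alpha> \<in> I" "h = reflection \<alpha>" by auto
    then show ?case by (auto simp: refl_inv intro!: exI[of _ "[\<alpha>]"])
  next
    case (eng h1 h2)
    then obtain u v where "set u \<subseteq> I" "set v \<subseteq> I" "h1 = wprod u" "h2 = wprod v" by auto
    then show ?case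
      by (auto simp: orthogonal_group_def wprod_append intro!: exI[of _ "u @ v"])
  qed
next
  fix f assume "f \<in> {wprod u | u. set u \<subseteq> I}"
  then obtain u where "f = wprod u" "set u \<subseteq> I" by auto
  then show "f \<in> generate orthogonal_group (reflection ` I)"
  proof (induction u arbitrary: f)
    case Nil
    then show ?case using generate.one[of orthogonal_group] by (auto simp: orthogonal_group_def id_def)
  next
    case (Cons \<alpha> u)
    then show ?case
      using generate.eng[OF generate.incl[of "reflection \<alpha>" "reflection ` I" orthogonal_group], of "wprod u"]
      by (auto simp: orthogonal_group_def comp_def)
  qed
qed

lemma wprod_displacement: "wprod u x - x \<in> span (set u)"
proof (induction u)
  case (Cons \<alpha> u)
  have "wprod (\<alpha> # u) x - x = (wprod u x - x) - (2 * (wprod u x \<bullet> \<alpha>) / (\<alpha> \<bullet> \<alpha>)) *\<^sub>R \<alpha>"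
    by (simp add: reflection_def)
  moreover have "wprod u x - x \<in> span (set (\<alpha> # u))"
    using Cons span_mono[of "set u" "set (\<alpha> # u)"] by auto
  ultimately show ?case
    by (metis list.set_intros(1) span_base span_diff span_scale)
qed (simp add: span_zero)

text \<open>Linear independence makes the two displacements \<open>reflection \<alpha> x - x\<close> and \<open>wprod u x - x\<close>
  independent, so they can only cancel when both vanish.\<close>

lemma wprod_distinct_fixes_iff:
  assumes "independent B" "distinct u" "set u \<subseteq> B"
  shows "wprod u x = x \<longleftrightarrow> (\<forall>\<alpha>\<in>set u. x \<bullet> \<alpha> = 0)"
  using assms(2,3)
proof (induction u)
  case (Cons \<alpha> u)
  have \<alpha>0: "\<alpha> \<noteq> 0" using assms(1) Cons.prems dependent_zero by auto
  show ?case
  proof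
    assume "wprod (\<alpha> # u) x = x"
    then have "reflection \<alpha> (reflection \<alpha> (wprod u x)) = reflection \<alpha> x" by simp
    then have eq: "wprod u x = reflection \<alpha> x" by simp
    let ?c = "2 * (x \<bullet> \<alpha>) / (\<alpha> \<bullet> \<alpha>)"
    have "- ?c *\<^sub>R \<alpha> \<in> span (set u)"
      using wprod_displacement[of u x] unfolding eq by (simp add: reflection_def)
    moreover have "set u \<subseteq> B - {\<alpha>}" using Cons.prems by auto
    ultimately have c: "- ?c *\<^sub>R \<alpha> \<in> span (B - {\<alpha>})" using span_mono by blast
    have "?c = 0"
    proof (rule ccontr)
      assume "?c \<noteq> 0"
      then have "\<alpha> = (- 1 / ?c) *\<^sub>R (- ?c *\<^sub>R \<alpha>)" by simp
      then have "\<alpha> \<in> span (B - {\<alpha>})" using c by (metis span_scale)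
      then show False using assms(1) Cons.prems dependent_def by auto
    qed
    then have xa: "x \<bullet> \<alpha> = 0" using \<alpha>0 by simp
    then have "wprod u x = x" using eq by (simp add: reflection_def)
    then show "\<forall>\<beta>\<in>set (\<alpha> # u). x \<bullet> \<beta> = 0" using Cons xa by auto
  qed (rule wprod_fixes, auto)
qed simp

text \<open>An orthogonal complement determines the span, and in an independent set a subset
  contains every element of \<open>B\<close> lying in its span.\<close>

lemma independent_subsets_eq_of_orthogonal_complements:
  fixes B :: "'a::euclidean_space set"
  assumes "independent B" "I \<subseteq> B" "J \<subseteq> B"
    and "\<And>x. (\<forall>\<alpha>\<in>I. x \<bullet> \<alpha> = 0) \<longleftrightarrow> (\<forall>\<alpha>\<in>J. x \<bullet> \<alpha> = 0)"
  shows "I = J"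
proof -
  have sub: "I \<subseteq> J" if "I \<subseteq> B" "J \<subseteq> B" "\<And>x. (\<forall>\<alpha>\<in>J. x \<bullet> \<alpha> = 0) \<Longrightarrow> (\<forall>\<alpha>\<in>I. x \<bullet> \<alpha> = 0)" for I J
  proof
    fix \<alpha> assume \<alpha>: "\<alpha> \<in> I"
    \<comment> \<open>The component of \<alpha> orthogonal to \<open>J\<close> is killed by
      \<open>J\<close>, hence by \<alpha>, hence it is orthogonal to itself.\<close>
    obtain y z where yz: "y \<in> span J" "\<And>w. w \<in> span J \<Longrightarrow> orthogonal z w" "\<alpha> = y + z"
      using orthogonal_subspace_decomp_exists[of J \<alpha>] by auto
    have "\<forall>\<beta>\<in>J. z \<bullet> \<beta> = 0" using yz(2) span_base by (auto simp: orthogonal_def)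
    then have "z \<bullet> \<alpha> = 0" using that \<alpha> by blast
    moreover have "z \<bullet> y = 0" using yz by (auto simp: orthogonal_def)
    ultimately have "z = 0" using yz(3) by (simp add: inner_right_distrib)
    then have "\<alpha> \<in> span J" using yz by simp
    show "\<alpha> \<in> J"
    proof (rule ccontr)
      assume "\<alpha> \<notin> J"
      then have "\<alpha> \<in> span (B - {\<alpha>})"
        using \<open>\<alpha> \<in> span J\<close> \<open>J \<subseteq> B\<close> span_mono[of J "B - {\<alpha>}"] by blast
      then show False using assms(1) \<alpha> \<open>I \<subseteq> B\<close> dependent_def by blast
    qed
  qed
  show ?thesis using sub[of I J] sub[of J I] assms by blast
qed

text \<open>The product determines its fixed space, which is the orthogonal complement of the
  letters. This is the rigidity behind both the normal forms of orthogonal words and the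
  classification of squares in the Cayley graph.\<close>

lemma distinct_words_same_product_same_support:
  assumes "independent B" "distinct u" "set u \<subseteq> B" "distinct v" "set v \<subseteq> B" "wprod u = wprod v"
  shows "set u = set v"
proof (rule independent_subsets_eq_of_orthogonal_complements[OF assms(1,3,5)])
  show "(\<forall>\<alpha>\<in>set u. x \<bullet> \<alpha> = 0) \<longleftrightarrow> (\<forall>\<alpha>\<in>set v. x \<bullet> \<alpha> = 0)" for x
    using wprod_distinct_fixes_iff[OF assms(1,2,3), of x]
      wprod_distinct_fixes_iff[OF assms(1,4,5), of x] assms(6) by simp
qed

section \<open>The closed fundamental chamber is a strict fundamental domain\<close>

locale simple_roots =
  fixes \<Phi> B :: "'a::euclidean_space set"
  assumes root_system: "root_system \<Phi>" and simple_system: "simple_system \<Phi> B"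
    and span_B: "span B = UNIV"
begin

section \<open>Dual basis, heights and positive roots\<close>

lemma B_subset: "B \<subseteq> \<Phi>" and independent_B: "independent B"
  using simple_system by (auto simp: simple_system_def)

lemma finite_roots: "finite \<Phi>"
  using root_system by (simp add: root_system_def)

lemma finite_B: "finite B"
  using B_subset finite_roots finite_subset by blast

lemma card_B: "card B = DIM('a)"
  using independent_B span_B basis_card_eq_dim[of B UNIV] by simp

lemma root_nonzero: "\<beta> \<in> \<Phi> \<Longrightarrow> \<beta> \<noteq> 0"
  using root_system by (auto simp: root_system_def)

lemma root_multiple: "\<beta> \<in> \<Phi> \<Longrightarrow> c *\<^sub>R \<beta> \<in> \<Phi> \<Longrightarrow> c *\<^sub>R \<beta> = \<beta> \<or> c *\<^sub>R \<beta> = - \<beta>"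
  using root_system unfolding root_system_def by blast

lemma root_uminus: "\<beta> \<in> \<Phi> \<Longrightarrow> - \<beta> \<in> \<Phi>"
  using root_system unfolding root_system_def by blast

lemma root_reflection: "\<alpha> \<in> \<Phi> \<Longrightarrow> \<beta> \<in> \<Phi> \<Longrightarrow> reflection \<alpha> \<beta> \<in> \<Phi>"
  using root_system unfolding root_system_def by blast

lemma root_wprod: "set u \<subseteq> \<Phi> \<Longrightarrow> \<beta> \<in> \<Phi> \<Longrightarrow> wprod u \<beta> \<in> \<Phi>"
  by (induction u) (auto simp: root_reflection)

text \<open>The basis dual to \<open>B\<close>: pairing with it reads off coefficients in simple
  roots. Its members span the extremal rays of the fundamental chamber, so they also represent the
  vertices of the Coxeter complex.\<close>

definition coweight :: "'a \<Rightarrow> 'a" where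
  "coweight \<alpha> = (SOME y. \<forall>\<beta>\<in>B. y \<bullet> \<beta> = (if \<beta> = \<alpha> then 1 else 0))"

lemma coweight_inner:
  assumes "\<beta> \<in> B" shows "coweight \<alpha> \<bullet> \<beta> = (if \<beta> = \<alpha> then 1 else 0)"
proof -
  obtain f :: "'a \<Rightarrow> real" where f: "linear f" "\<And>\<beta>. \<beta> \<in> B \<Longrightarrow> f \<beta> = (if \<beta> = \<alpha> then 1 else 0)"
    using linear_independent_extend[OF independent_B, of "\<lambda>\<beta>. if \<beta> = \<alpha> then 1 else 0"] by auto
  have "f x = adjoint f 1 \<bullet> x" for x
    using adjoint_works[OF f(1), of x 1] by (simp add: inner_commute)
  then have "\<exists>y. \<forall>\<beta>\<in>B. y \<bullet> \<beta> = (if \<beta> = \<alpha> then 1 else 0)"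
    using f(2) by metis
  from someI_ex[OF this] show ?thesis using assms unfolding coweight_def by blast
qed

text \<open>A point of the open fundamental chamber. Pairing with it gives the height (the sum of
  the coefficients), so \<open>0 < rho \<bullet> \<beta>\<close> is the positivity of a root \<beta>
  throughout.\<close>

definition rho :: 'a where "rho = (\<Sum>\<alpha>\<in>B. coweight \<alpha>)"

lemma sum_coweight_inner:
  assumes "J \<subseteq> B" "\<beta> \<in> B"
  shows "(\<Sum>\<alpha>\<in>J. coweight \<alpha>) \<bullet> \<beta> = (if \<beta> \<in> J then 1 else 0)"
  using assms finite_subset[OF assms(1) finite_B]
  by (simp add: inner_sum_left coweight_inner)

lemma rho_inner: "\<beta> \<in> B \<Longrightarrow> rho \<bullet> \<beta> = 1"
  by (simp add: rho_def sum_coweight_inner)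

lemma coweight_expansion: "x = (\<Sum>\<alpha>\<in>B. (coweight \<alpha> \<bullet> x) *\<^sub>R \<alpha>)"
proof -
  have "x \<in> span B" using span_B by simp
  then obtain c where c: "x = (\<Sum>\<alpha>\<in>B. c \<alpha> *\<^sub>R \<alpha>)"
    using span_finite[OF finite_B] by auto
  have "coweight \<alpha> \<bullet> x = c \<alpha>" if "\<alpha> \<in> B" for \<alpha>
    unfolding c using that finite_B
    by (simp add: inner_sum_right coweight_inner if_distrib[of "\<lambda>x. _ * x"] cong: if_cong)
  then show ?thesis using c by simp
qed

lemma inner_expansion: "y \<bullet> x = (\<Sum>\<alpha>\<in>B. (coweight \<alpha> \<bullet> x) * (y \<bullet> \<alpha>))"
proof -
  have "y \<bullet> x = y \<bullet> (\<Sum>\<alpha>\<in>B. (coweight \<alpha> \<bullet> x) *\<^sub>R \<alpha>)" using coweight_expansion by metis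
  then show ?thesis by (simp add: inner_sum_right)
qed

lemma rho_inner_eq: "rho \<bullet> x = (\<Sum>\<alpha>\<in>B. coweight \<alpha> \<bullet> x)"
  by (simp add: rho_def inner_sum_left)

lemma root_signs:
  assumes "\<beta> \<in> \<Phi>"
  shows "(\<forall>\<alpha>\<in>B. 0 \<le> coweight \<alpha> \<bullet> \<beta>) \<or> (\<forall>\<alpha>\<in>B. coweight \<alpha> \<bullet> \<beta> \<le> 0)"
proof -
  obtain c where c: "\<beta> = (\<Sum>\<alpha>\<in>B. c \<alpha> *\<^sub>R \<alpha>)" "(\<forall>\<alpha>\<in>B. 0 \<le> c \<alpha>) \<or> (\<forall>\<alpha>\<in>B. c \<alpha> \<le> 0)"
    using simple_system assms unfolding simple_system_def by blast
  have "coweight \<alpha> \<bullet> \<beta> = c \<alpha>" if "\<alpha> \<in> B" for \<alpha>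
    unfolding c(1) using that finite_B
    by (simp add: inner_sum_right coweight_inner if_distrib[of "\<lambda>x. _ * x"] cong: if_cong)
  then show ?thesis using c(2) by simp
qed

text \<open>Coefficients of one sign with sum zero all vanish, so every root is either positive or
  negative.\<close>

lemma root_rho_nonzero: assumes "\<beta> \<in> \<Phi>" shows "rho \<bullet> \<beta> \<noteq> 0"
proof
  assume 0: "rho \<bullet> \<beta> = 0"
  have "\<forall>\<alpha>\<in>B. coweight \<alpha> \<bullet> \<beta> = 0"
    using root_signs[OF assms]
  proof
    assume "\<forall>\<alpha>\<in>B. 0 \<le> coweight \<alpha> \<bullet> \<beta>"
    then show ?thesis using 0 finite_B by (simp add: rho_inner_eq sum_nonneg_eq_0_iff)
  next
    assume "\<forall>\<alpha>\<in>B. coweight \<alpha> \<bullet> \<beta> \<le> 0"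
    then show ?thesis
      using 0 finite_B sum_nonneg_eq_0_iff[of B "\<lambda>\<alpha>. - (coweight \<alpha> \<bullet> \<beta>)"]
      by (simp add: rho_inner_eq sum_negf)
  qed
  then have "\<beta> = 0" using coweight_expansion[of \<beta>] by simp
  then show False using root_nonzero assms by blast
qed

lemma positive_root_coweight:
  assumes "\<beta> \<in> \<Phi>" "0 < rho \<bullet> \<beta>" "\<alpha> \<in> B"
  shows "0 \<le> coweight \<alpha> \<bullet> \<beta>"
proof -
  have "\<not> (\<forall>\<alpha>\<in>B. coweight \<alpha> \<bullet> \<beta> \<le> 0)"
    using assms(2) sum_nonpos[of B "\<lambda>\<alpha>. coweight \<alpha> \<bullet> \<beta>"] by (auto simp: rho_inner_eq)
  then show ?thesis using root_signs assms by blast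
qed

definition dominant :: "'a \<Rightarrow> bool" where
  "dominant x \<longleftrightarrow> (\<forall>\<alpha>\<in>B. 0 \<le> x \<bullet> \<alpha>)"

lemma dominant_positive_root:
  assumes "dominant x" "\<beta> \<in> \<Phi>" "0 < rho \<bullet> \<beta>"
  shows "0 \<le> x \<bullet> \<beta>"
  unfolding inner_expansion[of x \<beta>]
  using assms positive_root_coweight by (intro sum_nonneg) (auto simp: dominant_def)

text \<open>For a positive root the expansion of \<open>x \<bullet> \<beta>\<close> has nonnegative
  terms, so each one is zero and only simple roots orthogonal to \<open>x\<close> occur in \<beta>.
  A negative root is replaced by its opposite.\<close>

lemma root_vanishing_in_span:
  assumes "dominant x" "\<beta> \<in> \<Phi>" "x \<bullet> \<beta> = 0"
  shows "\<beta> \<in> span {\<alpha>\<in>B. x \<bullet> \<alpha> = 0}"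
proof -
  have main: "\<beta> \<in> span {\<alpha>\<in>B. x \<bullet> \<alpha> = 0}"
    if "\<beta> \<in> \<Phi>" "x \<bullet> \<beta> = 0" "0 < rho \<bullet> \<beta>" for \<beta>
  proof -
    have nn: "0 \<le> (coweight \<alpha> \<bullet> \<beta>) * (x \<bullet> \<alpha>)" if "\<alpha> \<in> B" for \<alpha>
      using positive_root_coweight assms(1) \<open>\<beta> \<in> \<Phi>\<close> \<open>0 < rho \<bullet> \<beta>\<close> that by (auto simp: dominant_def)
    have z: "(coweight \<alpha> \<bullet> \<beta>) * (x \<bullet> \<alpha>) = 0" if "\<alpha> \<in> B" for \<alpha>
      using that inner_expansion[of x \<beta>] \<open>x \<bullet> \<beta> = 0\<close> nn finite_B
        sum_nonneg_eq_0_iff[of B "\<lambda>\<alpha>. (coweight \<alpha> \<bullet> \<beta>) * (x \<bullet> \<alpha>)"] by auto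
    have "(coweight \<alpha> \<bullet> \<beta>) *\<^sub>R \<alpha> \<in> span {\<alpha>\<in>B. x \<bullet> \<alpha> = 0}" if "\<alpha> \<in> B" for \<alpha>
    proof (cases "x \<bullet> \<alpha> = 0")
      case True
      then show ?thesis using that by (auto intro: span_scale span_base)
    next
      case False
      then show ?thesis using z[OF that] by (simp add: span_zero)
    qed
    then show ?thesis by (subst coweight_expansion[of \<beta>]) (rule span_sum)
  qed
  show ?thesis
  proof (cases "0 < rho \<bullet> \<beta>")
    case False
    then have "0 < rho \<bullet> (- \<beta>)" using root_rho_nonzero[OF assms(2)] by auto
    then have "- \<beta> \<in> span {\<alpha>\<in>B. x \<bullet> \<alpha> = 0}"
      using main[of "- \<beta>"] assms root_uminus by auto
    then show ?thesis using span_neg by fastforce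
  next
    case True
    then show ?thesis using main[OF assms(2,3)] by blast
  qed
qed

text \<open>The reflection changes only the coefficient at \<alpha>. If the sign of the root flips,
  all other coefficients are zero, which leaves a multiple of \<alpha>.\<close>

lemma simple_reflection_positive:
  assumes "\<alpha> \<in> B" "\<beta> \<in> \<Phi>" "0 < rho \<bullet> \<beta>" "\<beta> \<noteq> \<alpha>"
  shows "0 < rho \<bullet> reflection \<alpha> \<beta>"
proof (rule ccontr)
  assume "\<not> 0 < rho \<bullet> reflection \<alpha> \<beta>"
  moreover have refl: "reflection \<alpha> \<beta> \<in> \<Phi>" using assms B_subset root_reflection by blast
  ultimately have neg: "0 < rho \<bullet> (- reflection \<alpha> \<beta>)" using root_rho_nonzero[of "reflection \<alpha> \<beta>"] by auto
  have "coweight \<gamma> \<bullet> \<beta> = 0" if \<gamma>: "\<gamma> \<in> B" "\<gamma> \<noteq> \<alpha>" for \<gamma>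
  proof -
    have "coweight \<gamma> \<bullet> reflection \<alpha> \<beta> = coweight \<gamma> \<bullet> \<beta>"
      using \<gamma> assms(1) by (simp add: reflection_def inner_diff_right coweight_inner)
    moreover have "0 \<le> coweight \<gamma> \<bullet> (- reflection \<alpha> \<beta>)"
      using positive_root_coweight[OF root_uminus[OF refl] neg \<gamma>(1)] .
    ultimately show ?thesis using positive_root_coweight[OF assms(2,3) \<gamma>(1)] by simp
  qed
  then have "\<beta> = (\<Sum>\<gamma>\<in>B. if \<gamma> = \<alpha> then (coweight \<alpha> \<bullet> \<beta>) *\<^sub>R \<alpha> else 0)"
    by (subst coweight_expansion[of \<beta>]) (auto intro!: sum.cong)
  also have "\<dots> = (coweight \<alpha> \<bullet> \<beta>) *\<^sub>R \<alpha>" using assms(1) finite_B by simp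
  finally have \<beta>: "\<beta> = (coweight \<alpha> \<bullet> \<beta>) *\<^sub>R \<alpha>" .
  then have "\<beta> = \<alpha> \<or> \<beta> = - \<alpha>"
    using root_multiple[of \<alpha> "coweight \<alpha> \<bullet> \<beta>"] assms(1,2) B_subset by auto
  then have "\<beta> = - \<alpha>" using assms(4) by simp
  then show False using assms(1,3) rho_inner by simp
qed

text \<open>Letters are applied to \<beta> from the right until the sign first changes; a simple
  reflection can change the sign only of its own root, so the image just before that letter is the
  letter itself.\<close>

lemma exchange:
  assumes "set u \<subseteq> B" "\<beta> \<in> \<Phi>" "0 < rho \<bullet> \<beta>" "rho \<bullet> wprod u \<beta> < 0"
  shows "\<exists>x \<gamma> y. u = x @ \<gamma> # y \<and> wprod y \<beta> = \<gamma>"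
  using assms(1,4)
proof (induction u)
  case Nil
  then show ?case using assms(3) by simp
next
  case (Cons \<gamma> y)
  have r: "wprod y \<beta> \<in> \<Phi>" using Cons.prems assms(2) B_subset by (intro root_wprod) auto
  show ?case
  proof (cases "rho \<bullet> wprod y \<beta> < 0")
    case True
    then obtain x \<delta> z where "y = x @ \<delta> # z" "wprod z \<beta> = \<delta>" using Cons by auto
    then show ?thesis by (intro exI[of _ "\<gamma> # x"] exI[of _ \<delta>] exI[of _ z]) auto
  next
    case False
    then have "0 < rho \<bullet> wprod y \<beta>" using root_rho_nonzero[OF r] by auto
    then have "wprod y \<beta> = \<gamma>"
      using simple_reflection_positive[of \<gamma> "wprod y \<beta>"] Cons.prems r by fastforce
    then show ?thesis by (intro exI[of _ "[]"]) auto
  qed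
qed

text \<open>Strictness of the fundamental domain, by induction on the length of the word: either the
  last letter fixes \<open>x\<close> and is split off, or the word can be shortened by two letters
  without changing its product.\<close>

lemma dominant_stabilizer_word:
  assumes "set u \<subseteq> B" "dominant x" "dominant (wprod u x)"
  shows "\<exists>v. set v \<subseteq> {\<alpha>\<in>B. x \<bullet> \<alpha> = 0} \<and> wprod v = wprod u"
  using assms
proof (induction "length u" arbitrary: u rule: less_induct)
  case less
  show ?case
  proof (cases u rule: rev_cases)
    case Nil
    then show ?thesis by (intro exI[of _ "[]"]) auto
  next
    case (snoc u' \<alpha>)
    have \<alpha>: "\<alpha> \<in> B" "set u' \<subseteq> B" "\<alpha> \<in> \<Phi>" "set u \<subseteq> \<Phi>" using snoc less.prems B_subset by auto
    show ?thesis
    proof (cases "rho \<bullet> wprod u \<alpha> < 0")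
      case True
      \<comment> \<open>A positive root is nonnegative on the dominant point
        \<open>wprod u x\<close>; applied to the opposite of the image of \<alpha> this gives
        \<open>x \<bullet> \<alpha> \<le> 0\<close>, the reverse of dominance of
        \<open>x\<close>.\<close>
      have "- wprod u \<alpha> \<in> \<Phi>" using \<alpha> root_wprod root_uminus by blast
      then have "0 \<le> wprod u x \<bullet> - wprod u \<alpha>"
        using dominant_positive_root[OF less.prems(3), of "- wprod u \<alpha>"] True by simp
      then have "x \<bullet> \<alpha> \<le> 0" by (simp add: wprod_inner)
      then have xa: "x \<bullet> \<alpha> = 0" using less.prems(2) \<alpha> by (force simp: dominant_def)
      then have "wprod u x = wprod u' x" using snoc by (simp add: wprod_append reflection_def)
      then obtain v where v: "set v \<subseteq> {\<alpha>\<in>B. x \<bullet> \<alpha> = 0}" "wprod v = wprod u'"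
        using less.hyps[of u'] less.prems snoc \<alpha> by auto
      then show ?thesis
        using snoc xa \<alpha> by (intro exI[of _ "v @ [\<alpha>]"]) (auto simp: wprod_append)
    next
      case False
      have "wprod u \<alpha> = - wprod u' \<alpha>"
        using snoc linear_neg[OF linear_wprod] by (simp add: wprod_append)
      moreover have "rho \<bullet> wprod u \<alpha> \<noteq> 0" using \<alpha> root_wprod root_rho_nonzero by blast
      ultimately have "rho \<bullet> wprod u' \<alpha> < 0" using False by auto
      then obtain a \<gamma> b where ab: "u' = a @ \<gamma> # b" "wprod b \<alpha> = \<gamma>"
        using exchange[OF \<alpha>(2,3)] rho_inner \<alpha> by auto
      \<comment> \<open>The last letter \<alpha>, moved to the left across \<open>b\<close>, becomes
        the reflection in \<gamma> and cancels the letter \<gamma> there.\<close>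
      have "reflection \<gamma> (wprod b (reflection \<alpha> y)) = wprod b y" for y
        using reflection_conjugate[OF orthogonal_wprod, of b \<alpha> "reflection \<alpha> y"] ab by simp
      then have eq: "wprod u = wprod (a @ b)"
        using snoc ab by (auto simp: wprod_append fun_eq_iff)
      then show ?thesis using less.hyps[of "a @ b"] less.prems snoc ab by auto
    qed
  qed
qed

section \<open>The group generated by simple reflections\<close>

definition weyl :: "('a \<Rightarrow> 'a) set" where
  "weyl = {wprod u | u. set u \<subseteq> B}"

text \<open>A positive root of least height in the orbit is simple: it has positive inner product
  with some simple root \<alpha>, and reflecting in \<alpha> would otherwise give a positive root of
  smaller height. Conjugation then puts every root reflection into \<open>weyl\<close>.\<close>

lemma positive_root_in_simple_orbit:
  assumes "\<beta> \<in> \<Phi>" "0 < rho \<bullet> \<beta>"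
  shows "\<exists>u \<gamma>. set u \<subseteq> B \<and> \<gamma> \<in> B \<and> wprod u \<beta> = \<gamma>"
proof -
  define P where "P = {\<gamma>\<in>\<Phi>. 0 < rho \<bullet> \<gamma> \<and> (\<exists>u. set u \<subseteq> B \<and> wprod u \<beta> = \<gamma>)}"
  have "finite P" "P \<noteq> {}"
    using finite_roots assms by (auto simp: P_def intro!: exI[of _ \<beta>] exI[of _ "[]"])
  then obtain \<gamma> where \<gamma>: "\<gamma> \<in> P" and min: "\<And>\<delta>. \<delta> \<in> P \<Longrightarrow> rho \<bullet> \<gamma> \<le> rho \<bullet> \<delta>"
    using arg_min_if_finite[of P "\<lambda>\<gamma>. rho \<bullet> \<gamma>"] by (metis not_le)
  from \<gamma> obtain u where u: "\<gamma> \<in> \<Phi>" "0 < rho \<bullet> \<gamma>" "set u \<subseteq> B" "wprod u \<beta> = \<gamma>"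
    by (auto simp: P_def)
  \<comment> \<open>Otherwise expanding \<gamma> in simple roots with nonnegative coefficients makes
    its square norm nonpositive.\<close>
  have "\<exists>\<alpha>\<in>B. 0 < \<gamma> \<bullet> \<alpha>"
  proof (rule ccontr)
    assume "\<not> ?thesis"
    then have "\<gamma> \<bullet> \<gamma> \<le> 0"
      unfolding inner_expansion[of \<gamma> \<gamma>]
      using positive_root_coweight[OF u(1,2)]
        by (intro sum_nonpos) (auto intro!: mult_nonneg_nonpos simp: not_less)
    then show False using root_nonzero u(1) by (metis inner_gt_zero_iff not_le)
  qed
  then obtain \<alpha> where \<alpha>: "\<alpha> \<in> B" "0 < \<gamma> \<bullet> \<alpha>" by auto
  have "\<gamma> = \<alpha>"
  proof (rule ccontr)
    assume "\<gamma> \<noteq> \<alpha>"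
    then have "0 < rho \<bullet> reflection \<alpha> \<gamma>" using simple_reflection_positive \<alpha> u by blast
    moreover have "reflection \<alpha> \<gamma> \<in> \<Phi>" using \<alpha> u B_subset root_reflection by blast
    ultimately have "reflection \<alpha> \<gamma> \<in> P"
      using u \<alpha> by (auto simp: P_def intro!: exI[of _ "\<alpha> # u"])
    then have "rho \<bullet> \<gamma> \<le> rho \<bullet> reflection \<alpha> \<gamma>" by (rule min)
    moreover have "0 < \<alpha> \<bullet> \<alpha>" using root_nonzero \<alpha> B_subset by auto
    ultimately show False
      using \<alpha> rho_inner[OF \<alpha>(1)]
        by (simp add: reflection_def inner_diff_right mult_pos_pos divide_le_0_iff not_le)
  qed
  then show ?thesis using u \<alpha> by auto
qed

lemma reflection_in_weyl:
  assumes "\<beta> \<in> \<Phi>" shows "reflection \<beta> \<in> weyl"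
proof -
  have main: "reflection \<beta> \<in> weyl" if pos: "\<beta> \<in> \<Phi>" "0 < rho \<bullet> \<beta>" for \<beta>
  proof -
    obtain u \<gamma> where u: "set u \<subseteq> B" "\<gamma> \<in> B" "wprod u \<beta> = \<gamma>"
      using positive_root_in_simple_orbit[OF pos] by blast
    have "reflection \<beta> x = wprod (rev u @ [\<gamma>] @ u) x" for x
      using reflection_conjugate[OF orthogonal_wprod, of u \<beta> x] u by (simp add: wprod_append)
    then have "reflection \<beta> = wprod (rev u @ [\<gamma>] @ u)" by (simp add: fun_eq_iff)
    moreover have "set (rev u @ [\<gamma>] @ u) \<subseteq> B" using u by auto
    ultimately show ?thesis unfolding weyl_def by blast
  qed
  show ?thesis
  proof (cases "0 < rho \<bullet> \<beta>")
    case False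
    then have "0 < rho \<bullet> (- \<beta>)" using root_rho_nonzero[OF assms] by auto
    then show ?thesis using main[of "- \<beta>"] assms root_uminus by auto
  next
    case True
    then show ?thesis using main[OF assms] by blast
  qed
qed

lemma weyl_comp: "v \<in> weyl \<Longrightarrow> w \<in> weyl \<Longrightarrow> v \<circ> w \<in> weyl"
proof -
  assume "v \<in> weyl" "w \<in> weyl"
  then obtain a b where "set a \<subseteq> B" "v = wprod a" "set b \<subseteq> B" "w = wprod b" by (auto simp: weyl_def)
  then have "v \<circ> w = wprod (a @ b)" "set (a @ b) \<subseteq> B" by (auto simp: wprod_append)
  then show ?thesis unfolding weyl_def by blast
qed

lemma weyl_id: "id \<in> weyl"
  unfolding weyl_def by (auto intro!: exI[of _ "[]"])

lemma wprod_in_weyl: "set u \<subseteq> B \<Longrightarrow> wprod u \<in> weyl"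
  by (auto simp: weyl_def)

lemma reflection_group_eq_weyl: "reflection_group \<Phi> = weyl"
proof -
  have "wprod u \<in> weyl" if "set u \<subseteq> \<Phi>" for u
    using that
      by (induction u) (auto simp: weyl_id reflection_in_weyl intro!: weyl_comp simp flip: id_def simp del: o_apply)
  then show ?thesis
    unfolding reflection_group_def generate_reflections weyl_def using B_subset by blast
qed

lemma orthogonal_weyl: "w \<in> weyl \<Longrightarrow> orthogonal_transformation w"
  by (auto simp: weyl_def orthogonal_wprod)

lemma linear_weyl: "w \<in> weyl \<Longrightarrow> linear w"
  using orthogonal_weyl orthogonal_transformation_linear by blast

lemma weyl_inner: "w \<in> weyl \<Longrightarrow> w x \<bullet> w y = x \<bullet> y"
  by (auto simp: weyl_def wprod_inner)

lemma weyl_root: "w \<in> weyl \<Longrightarrow> \<beta> \<in> \<Phi> \<Longrightarrow> w \<beta> \<in> \<Phi>"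
  using root_wprod B_subset by (auto simp: weyl_def)

lemma weyl_inverse:
  assumes "w \<in> weyl"
  obtains w' where "w' \<in> weyl" "w' \<circ> w = id" "w \<circ> w' = id" "\<And>x y. w x \<bullet> y = x \<bullet> w' y"
proof -
  obtain u where u: "set u \<subseteq> B" "w = wprod u" using assms by (auto simp: weyl_def)
  have "w x \<bullet> y = x \<bullet> wprod (rev u) y" for x y
    using wprod_inner[of u x "wprod (rev u) y"] u by simp
  then show ?thesis
    using that[of "wprod (rev u)"] u wprod_rev[of u] wprod_rev[of "rev u"] wprod_in_weyl[of "rev u"]
    by simp
qed

text \<open>Agreement on coweights says that the adjoint inverses have the same simple-root
  coefficients at every vector.\<close>

lemma weyl_eqI:
  assumes "v \<in> weyl" "w \<in> weyl" "\<And>\<alpha>. \<alpha> \<in> B \<Longrightarrow> v (coweight \<alpha>) = w (coweight \<alpha>)"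
  shows "v = w"
proof
  fix x
  obtain v' where v': "v' \<circ> v = id" "v \<circ> v' = id" "\<And>x y. v x \<bullet> y = x \<bullet> v' y"
    using weyl_inverse[OF assms(1)] by metis
  obtain w' where w': "w' \<circ> w = id" "w \<circ> w' = id" "\<And>x y. w x \<bullet> y = x \<bullet> w' y"
    using weyl_inverse[OF assms(2)] by metis
  have "v' y = w' y" for y
  proof -
    have "coweight \<alpha> \<bullet> v' y = coweight \<alpha> \<bullet> w' y" if "\<alpha> \<in> B" for \<alpha>
      using assms(3)[OF that] by (simp flip: v'(3) w'(3))
    then have "(\<Sum>\<alpha>\<in>B. (coweight \<alpha> \<bullet> v' y) *\<^sub>R \<alpha>) = (\<Sum>\<alpha>\<in>B. (coweight \<alpha> \<bullet> w' y) *\<^sub>R \<alpha>)"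
      by simp
    then show ?thesis by (simp flip: coweight_expansion)
  qed
  then have "v x \<bullet> y = w x \<bullet> y" for y by (simp add: v'(3) w'(3))
  then show "v x = w x" by (metis vector_eq_rdot)
qed

text \<open>\<open>in_chamber w x\<close> says that \<open>x\<close> lies in the closed chamber \<open>w C\<close>, with \<open>C\<close> the closed
  fundamental chamber, and \<open>walls w x\<close> is the type of the face of \<open>w C\<close> containing \<open>x\<close>.\<close>

definition in_chamber :: "('a \<Rightarrow> 'a) \<Rightarrow> 'a \<Rightarrow> bool" where
  "in_chamber w x \<longleftrightarrow> (\<forall>\<alpha>\<in>B. 0 \<le> x \<bullet> w \<alpha>)"

definition walls :: "('a \<Rightarrow> 'a) \<Rightarrow> 'a \<Rightarrow> 'a set" where
  "walls w x = {\<alpha>\<in>B. x \<bullet> w \<alpha> = 0}"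

lemma walls_subset: "walls w x \<subseteq> B"
  by (auto simp: walls_def)

text \<open>The first chamber is moved to the fundamental one. Then \<open>v' \<circ> w\<close> maps
  one dominant point to another and so is a word in the walls at that point.\<close>

lemma chambers_through_point:
  assumes "w \<in> weyl" "v \<in> weyl" "in_chamber w x" "in_chamber v x"
  shows "\<exists>u. set u \<subseteq> walls w x \<and> v = w \<circ> wprod u"
proof -
  obtain w' where w': "w' \<in> weyl" "w' \<circ> w = id" "w \<circ> w' = id" "\<And>x y. w x \<bullet> y = x \<bullet> w' y"
    using weyl_inverse[OF assms(1)] by blast
  obtain v' where v': "v' \<in> weyl" "v' \<circ> v = id" "v \<circ> v' = id" "\<And>x y. v x \<bullet> y = x \<bullet> v' y"
    using weyl_inverse[OF assms(2)] by blast
  have "v' \<circ> w \<in> weyl" using v' assms weyl_comp by blast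
  then obtain u where u: "set u \<subseteq> B" "v' \<circ> w = wprod u" by (auto simp: weyl_def)
  have dw: "dominant (w' x)" using assms(3) w'(4)
    by (simp add: dominant_def in_chamber_def inner_commute)
  have eq: "wprod u (w' x) = v' x"
    using w'(3) by (simp flip: u(2) add: fun_eq_iff)
  have "dominant (wprod u (w' x))"
    unfolding eq using assms(4) v'(4) by (simp add: dominant_def in_chamber_def inner_commute)
  then obtain z where z: "set z \<subseteq> {\<alpha>\<in>B. w' x \<bullet> \<alpha> = 0}" "wprod z = wprod u"
    using dominant_stabilizer_word[OF u(1) dw] by blast
  \<comment> \<open>The word \<open>z\<close> spells \<open>v' \<circ> w\<close>, the inverse of the
    required element, and is therefore reversed.\<close>
  have "set (rev z) \<subseteq> walls w x"
    using z(1) w'(4) by (auto simp: walls_def inner_commute)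
  moreover have "v = w \<circ> wprod (rev z)"
  proof -
    have "v \<circ> wprod u = w" using v'(3) u(2) by (metis comp_assoc comp_id fun.map_id id_comp)
    then have "v \<circ> wprod z \<circ> wprod (rev z) = w \<circ> wprod (rev z)" using z by simp
    then show ?thesis using wprod_rev[of "rev z"] by (simp add: comp_assoc)
  qed
  ultimately show ?thesis by blast
qed

text \<open>Converse to \<open>chambers_through_point\<close>. A word in the walls at
  \<open>x\<close> fixes the pullback of \<open>x\<close>, hence also preserves the type of its
  face.\<close>

lemma in_chamber_through_face:
  assumes "w \<in> weyl" "in_chamber w x" "set u \<subseteq> walls w x"
  shows "in_chamber (w \<circ> wprod u) x" "walls (w \<circ> wprod u) x = walls w x"
proof -
  obtain w' where w': "w' \<in> weyl" "w' \<circ> w = id" "w \<circ> w' = id" "\<And>x y. w x \<bullet> y = x \<bullet> w' y"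
    using weyl_inverse[OF assms(1)] by blast
  have "wprod (rev u) (w' x) = w' x"
    by (rule wprod_fixes) (use assms(3) w'(4) in \<open>auto simp: walls_def inner_commute\<close>)
  then have "x \<bullet> w (wprod u \<alpha>) = x \<bullet> w \<alpha>" for \<alpha>
    using w'(4)[of _ x] wprod_inner[of "rev u" "w' x" "wprod u \<alpha>"] by (simp add: inner_commute)
  then show "in_chamber (w \<circ> wprod u) x" "walls (w \<circ> wprod u) x = walls w x"
    using assms(2) by (auto simp: in_chamber_def walls_def)
qed

lemma chamber_rho: assumes "w \<in> weyl" shows "in_chamber w (w rho)" "walls w (w rho) = {}"
  using weyl_inner[OF assms] rho_inner by (auto simp: in_chamber_def walls_def)

text \<open>The coweights indexed by the complement of \<open>I\<close> span a face on which
  precisely the simple roots in \<open>I\<close> vanish.\<close>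

lemma face_point:
  assumes "w \<in> weyl" "I \<subseteq> B"
  obtains f where "in_chamber w f" "walls w f = I"
proof -
  let ?y = "\<Sum>\<alpha>\<in>B - I. coweight \<alpha>"
  have "in_chamber w (w ?y)" "walls w (w ?y) = I"
    using weyl_inner[OF assms(1)] sum_coweight_inner[of "B - I"] assms(2)
    by (auto simp: in_chamber_def walls_def split: if_splits)
  then show ?thesis using that by blast
qed

end

locale finite_simple_roots = simple_roots +
  assumes finite_weyl: "finite weyl"
begin

text \<open>Among the finitely many chamber centres, one with the largest inner product with
  \<open>x\<close> belongs to a chamber containing \<open>x\<close>.\<close>

lemma ex_chamber: "\<exists>w\<in>weyl. in_chamber w x"
proof -
  have "finite weyl" "weyl \<noteq> {}" using finite_weyl weyl_id by auto
  then obtain w where w: "w \<in> weyl" and max: "\<And>v. v \<in> weyl \<Longrightarrow> x \<bullet> v rho \<le> x \<bullet> w rho"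
    using arg_min_if_finite[of weyl "\<lambda>w. - (x \<bullet> w rho)"] by (metis neg_le_iff_le not_le)
  have "0 \<le> x \<bullet> w \<alpha>" if "\<alpha> \<in> B" for \<alpha>
  proof -
    \<comment> \<open>Comparison with the neighbour across the wall \<alpha>: its centre differs by
      a positive multiple of \<open>w \<alpha>\<close>, because
      \<open>rho \<bullet> \<alpha> = 1\<close>.\<close>
    have "w \<circ> wprod [\<alpha>] \<in> weyl" using w that weyl_comp wprod_in_weyl[of "[\<alpha>]"] by auto
    from max[OF this] have "x \<bullet> w (rho - (2 / (\<alpha> \<bullet> \<alpha>)) *\<^sub>R \<alpha>) \<le> x \<bullet> w rho"
      using rho_inner[OF that] by (simp add: reflection_def)
    then have "0 \<le> (2 / (\<alpha> \<bullet> \<alpha>)) * (x \<bullet> w \<alpha>)"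
      using linear_weyl[OF w] by (simp add: linear_diff linear_scale inner_diff_right)
    moreover have "0 < \<alpha> \<bullet> \<alpha>" using root_nonzero that B_subset by auto
    ultimately show ?thesis by (simp add: zero_le_divide_iff zero_le_mult_iff)
  qed
  then show ?thesis using w by (auto simp: in_chamber_def)
qed

end

section \<open>Paths subordinate to an open cover\<close>

lemma convex_homotopic_paths:
  fixes U :: "'a::real_normed_vector set"
  assumes "convex U" "U \<subseteq> M" "path p" "path_image p \<subseteq> U" "path q" "path_image q \<subseteq> U"
    and "pathstart p = pathstart q" "pathfinish p = pathfinish q"
  shows "homotopic_paths M p q"
proof -
  have "homotopic_paths U p q"
    using convex_imp_simply_connected[OF assms(1)] assms(3-)
    unfolding simply_connected_eq_homotopic_paths by simp
  then show ?thesis using assms(2) by (rule homotopic_paths_subset)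
qed

text \<open>A Lebesgue number of the compact image, pulled back by uniform continuity. It serves
  both the unit interval and the unit square.\<close>

lemma compact_image_cover_uniform:
  fixes h :: "'a::metric_space \<Rightarrow> 'b::metric_space"
  assumes "compact K" "continuous_on K h" "h ` K \<subseteq> \<Union>\<U>" "\<And>U. U \<in> \<U> \<Longrightarrow> open U"
  obtains e where "e > 0" "\<And>x. x \<in> K \<Longrightarrow> \<exists>U\<in>\<U>. \<forall>y\<in>K. dist y x < e \<longrightarrow> h y \<in> U"
proof -
  have "compact (h ` K)" using assms compact_continuous_image by blast
  then obtain d where d: "d > 0" "\<And>x. x \<in> h ` K \<Longrightarrow> \<exists>U\<in>\<U>. ball x d \<subseteq> U"
    using Heine_Borel_lemma[of "h ` K" \<U>] assms by metis
  have "uniformly_continuous_on K h" using assms compact_uniformly_continuous by blast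
  then obtain e where e: "e > 0" "\<And>x y. x \<in> K \<Longrightarrow> y \<in> K \<Longrightarrow> dist y x < e \<Longrightarrow> dist (h y) (h x) < d"
    using d(1) unfolding uniformly_continuous_on_def by metis
  have "\<exists>U\<in>\<U>. \<forall>y\<in>K. dist y x < e \<longrightarrow> h y \<in> U" if "x \<in> K" for x
  proof -
    obtain U where "U \<in> \<U>" "ball (h x) d \<subseteq> U" using d(2) \<open>x \<in> K\<close> by blast
    then show ?thesis using e(2)[OF \<open>x \<in> K\<close>] by (intro bexI[of _ U]) (auto simp: subset_iff dist_commute)
  qed
  then show ?thesis using that e(1) by blast
qed

text \<open>Only equal subdivisions are used, so a common refinement of two of them is obtained by
  multiplying their lengths.\<close>

definition subordinate :: "'a set set \<Rightarrow> (real \<Rightarrow> 'a) \<Rightarrow> nat \<Rightarrow> bool" where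
  "subordinate \<U> p N \<longleftrightarrow> 0 < N \<and>
     (\<forall>i<N. \<exists>U\<in>\<U>. p ` {real i / real N..real (Suc i) / real N} \<subseteq> U)"

lemma grid_in_unit: "i \<le> N \<Longrightarrow> real i / real N \<in> {0..1}"
  by (cases "N = 0") (auto simp: field_simps)

lemma grid_interval_subset:
  assumes "i < N" shows "{real i / real N..real (Suc i) / real N} \<subseteq> {0..1}"
  using grid_in_unit[of i N] grid_in_unit[of "Suc i" N] assms by auto

lemma grid_cancel: "0 < k \<Longrightarrow> real (i * k) / real (N * k) = real i / real N"
  by simp

lemma ex_subordinate:
  fixes p :: "real \<Rightarrow> 'a::metric_space"
  assumes "path p" "path_image p \<subseteq> \<Union>\<U>" "\<And>U. U \<in> \<U> \<Longrightarrow> open U"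
  shows "\<exists>N. subordinate \<U> p N"
proof -
  obtain e where e: "e > 0" "\<And>x. x \<in> {0..1} \<Longrightarrow> \<exists>U\<in>\<U>. \<forall>y\<in>{0..1}. dist y x < e \<longrightarrow> p y \<in> U"
    using compact_image_cover_uniform[of "{0..1}" p \<U>] assms
    unfolding path_def path_image_def by (metis compact_Icc)
  obtain N :: nat where N: "N > 0" "1 / real N < e"
    using e(1) real_arch_inverse by (metis inverse_eq_divide neq0_conv)
  have "\<exists>U\<in>\<U>. p ` {real i / real N..real (Suc i) / real N} \<subseteq> U" if "i < N" for i
  proof -
    obtain U where U: "U \<in> \<U>" "\<And>y. y \<in> {0..1} \<Longrightarrow> dist y (real i / real N) < e \<Longrightarrow> p y \<in> U"
      using e(2) grid_in_unit[of i N] \<open>i < N\<close> by (meson less_imp_le_nat)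
    have "p y \<in> U" if y: "y \<in> {real i / real N..real (Suc i) / real N}" for y
    proof (rule U(2))
      show "y \<in> {0..1}" using y grid_interval_subset[OF \<open>i < N\<close>] by blast
      show "dist y (real i / real N) < e"
        using y N by (auto simp: dist_real_def add_divide_distrib)
    qed
    then show ?thesis using U(1) by blast
  qed
  then show ?thesis using N unfolding subordinate_def by blast
qed

lemma subordinate_mult:
  assumes "subordinate \<U> p N" "0 < k"
  shows "subordinate \<U> p (N * k)"
proof -
  have "\<exists>U\<in>\<U>. p ` {real j / real (N * k)..real (Suc j) / real (N * k)} \<subseteq> U" if "j < N * k" for j
  proof -
    define i where "i = j div k"
    have iN: "i < N" using that assms(2) by (simp add: i_def less_mult_imp_div_less)
    have "i * k \<le> j" "Suc j \<le> Suc i * k"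
      using assms(2) dividend_less_div_times[of k j] by (auto simp: i_def)
    then have "real (i * k) / real (N * k) \<le> real j / real (N * k)"
        "real (Suc j) / real (N * k) \<le> real (Suc i * k) / real (N * k)"
      by (intro divide_right_mono; linarith)+
    then have "real i / real N \<le> real j / real (N * k)"
        "real (Suc j) / real (N * k) \<le> real (Suc i) / real N"
      unfolding grid_cancel[OF assms(2)] by auto
    then have "{real j / real (N * k)..real (Suc j) / real (N * k)}
      \<subseteq> {real i / real N..real (Suc i) / real N}"
      by auto
    then show ?thesis using assms(1) iN unfolding subordinate_def by (meson image_mono order_trans)
  qed
  then show ?thesis using assms by (simp add: subordinate_def)
qed

lemma subordinate_subpath:
  assumes "path p" "i < N" "p ` {real i / real N..real (Suc i) / real N} \<subseteq> U"
  shows "path (subpath (real i / real N) (real (Suc i) / real N) p)"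
    "path_image (subpath (real i / real N) (real (Suc i) / real N) p) \<subseteq> U"
  using assms grid_in_unit[of i N] grid_in_unit[of "Suc i" N]
  by (auto simp: path_image_subpath_gen closed_segment_eq_real_ivl path_subpath divide_right_mono)

text \<open>The initial segments of a sufficiently fine subdivision are treated in turn. Closure
  under homotopy absorbs the reparametrization between two joined subpaths and one longer
  subpath.\<close>

lemma path_induct_cover [consumes 3, case_names local join homotopic]:
  fixes p :: "real \<Rightarrow> 'a::real_normed_vector"
  assumes "path p" "path_image p \<subseteq> \<Union>\<U>" "\<forall>U\<in>\<U>. open U"
    and loc: "\<And>p U. U \<in> \<U> \<Longrightarrow> path p \<Longrightarrow> path_image p \<subseteq> U \<Longrightarrow> Q p"
    and join: "\<And>p q. path p \<Longrightarrow> path_image p \<subseteq> \<Union>\<U> \<Longrightarrow> path q \<Longrightarrow> path_image q \<subseteq> \<Union>\<U> \<Longrightarrow>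
      pathfinish p = pathstart q \<Longrightarrow> Q p \<Longrightarrow> Q q \<Longrightarrow> Q (p +++ q)"
    and hom: "\<And>p q. Q p \<Longrightarrow> homotopic_paths (\<Union>\<U>) p q \<Longrightarrow> Q q"
  shows "Q p"
proof -
  obtain N where N: "subordinate \<U> p N" using ex_subordinate[OF assms(1,2)] assms(3) by blast
  then have "0 < N" by (simp add: subordinate_def)
  have image: "path_image (subpath 0 (real i / real N) p) \<subseteq> \<Union>\<U>" "path (subpath 0 (real i / real N) p)"
    if "i \<le> N" for i
    using path_image_subpath_subset[of 0 "real i / real N" p] grid_in_unit[OF that] assms by auto
  have "Q (subpath 0 (real i / real N) p)" if "i \<le> N" for i
    using that
  proof (induction i)
    case 0
    have "p 0 \<in> \<Union>\<U>" using assms(2) pathstart_in_path_image[of p] by (auto simp: pathstart_def)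
    then obtain U where "U \<in> \<U>" "p 0 \<in> U" by blast
    then have "path_image (subpath 0 0 p) \<subseteq> U" by (auto simp: path_image_def subpath_def)
    then show ?case using loc[OF \<open>U \<in> \<U>\<close>, of "subpath 0 0 p"] assms(1) by (simp add: path_subpath)
  next
    case (Suc i)
    obtain U where U: "U \<in> \<U>" "p ` {real i / real N..real (Suc i) / real N} \<subseteq> U"
      using N Suc.prems unfolding subordinate_def by (meson Suc_le_lessD)
    let ?s = "subpath (real i / real N) (real (Suc i) / real N) p"
    have s: "path ?s" "path_image ?s \<subseteq> U" using subordinate_subpath[OF assms(1) _ U(2)] Suc.prems by auto
    have "Q (subpath 0 (real i / real N) p +++ ?s)"
    proof (rule join)
      show "Q ?s" using loc U(1) s by blast
      show "path_image ?s \<subseteq> \<Union>\<U>" using U(1) s by blast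
    qed (use image[of i] Suc s in auto)
    moreover have "homotopic_paths (\<Union>\<U>) (subpath 0 (real i / real N) p +++ ?s)
      (subpath 0 (real (Suc i) / real N) p)"
      using assms grid_in_unit[of i N] grid_in_unit[of "Suc i" N] Suc.prems
      by (intro homotopic_join_subpaths) auto
    ultimately show ?case using hom by blast
  qed
  from this[of N] show ?thesis using \<open>0 < N\<close> by simp
qed

section \<open>Holonomy of a discrete cocycle\<close>

lemma concat_map_upt_shift:
  "concat (map a [m..<m + k]) = concat (map (\<lambda>j. a (m + j)) [0..<k])"
  by (induction k) auto

lemma concat_map_upt_mult:
  "concat (map a [0..<N * k]) = concat (map (\<lambda>i. concat (map (\<lambda>j. a (i * k + j)) [0..<k])) [0..<N])"
proof (induction N)
  case (Suc N)
  have "[0..<Suc N * k] = [0..<N * k] @ [N * k..<N * k + k]"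
    using upt_add_eq_append[of 0 "N * k" k] by (simp add: add.commute)
  then show ?case using Suc concat_map_upt_shift[of a "N * k" k] by simp
qed simp

text \<open>A Cech-type 1-cocycle with values in words modulo a congruence \<open>E\<close>. The
  transition word \<open>g x y\<close> is given for all pairs of points but is controlled only when
  both lie in one member of the cover; inverses are replaced by the two-sided comparison of
  words.\<close>

locale discrete_cocycle =
  fixes \<U> :: "'a::metric_space set set" and E :: "'b list \<Rightarrow> 'b list \<Rightarrow> bool"
    and g :: "'a \<Rightarrow> 'a \<Rightarrow> 'b list"
  assumes open_cover: "\<And>U. U \<in> \<U> \<Longrightarrow> open U"
    and E_refl: "E u u" and E_sym: "E u v \<Longrightarrow> E v u" and E_trans [trans]: "E u v \<Longrightarrow> E v w \<Longrightarrow> E u w"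
    and E_append: "E u u' \<Longrightarrow> E v v' \<Longrightarrow> E (u @ v) (u' @ v')"
    and cocycle: "U \<in> \<U> \<Longrightarrow> x \<in> U \<Longrightarrow> y \<in> U \<Longrightarrow> z \<in> U \<Longrightarrow> E (g x y @ g y z) (g x z)"
    and cocycle_refl: "U \<in> \<U> \<Longrightarrow> x \<in> U \<Longrightarrow> E (g x x) []"
begin

definition chain :: "(nat \<Rightarrow> 'a) \<Rightarrow> nat \<Rightarrow> 'b list" where
  "chain y n = concat (map (\<lambda>i. g (y i) (y (Suc i))) [0..<n])"

lemma chain_Suc: "chain y (Suc n) = chain y n @ g (y n) (y (Suc n))"
  by (simp add: chain_def)

text \<open>Inside one member of the cover the transition words telescope.\<close>

lemma chain_collapse:
  assumes "U \<in> \<U>" "\<And>j. j \<le> k \<Longrightarrow> y j \<in> U"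
  shows "E (chain y k) (g (y 0) (y k))"
  using assms(2)
proof (induction k)
  case 0
  then show ?case using cocycle_refl[OF assms(1)] E_sym by (auto simp: chain_def)
next
  case (Suc k)
  then have "E (chain y (Suc k)) (g (y 0) (y k) @ g (y k) (y (Suc k)))"
    unfolding chain_Suc by (intro E_append E_refl) auto
  also have "E (g (y 0) (y k) @ g (y k) (y (Suc k))) (g (y 0) (y (Suc k)))"
    using Suc.prems by (intro cocycle[OF assms(1)]) auto
  finally show ?case .
qed

lemma E_concat:
  assumes "\<And>i. i < n \<Longrightarrow> E (a i) (b i)"
  shows "E (concat (map a [0..<n])) (concat (map b [0..<n]))"
  using assms by (induction n) (auto intro: E_append E_refl)

definition hol_at :: "nat \<Rightarrow> (real \<Rightarrow> 'a) \<Rightarrow> 'b list" where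
  "hol_at N p = chain (\<lambda>i. p (real i / real N)) N"

text \<open>The subdivision is chosen arbitrarily; \<open>hol_eq\<close> shows, through the product
  of two subdivision lengths, that the class modulo \<open>E\<close> is the same for all of
  them.\<close>

definition hol :: "(real \<Rightarrow> 'a) \<Rightarrow> 'b list" where
  "hol p = hol_at (SOME N. subordinate \<U> p N) p"

lemma hol_at_refine:
  assumes "subordinate \<U> p N" "0 < k"
  shows "E (hol_at (N * k) p) (hol_at N p)"
proof -
  have N: "0 < N" using assms by (simp add: subordinate_def)
  let ?y = "\<lambda>j. p (real j / real (N * k))"
  have ik: "?y (i * k) = p (real i / real N)" for i unfolding grid_cancel[OF assms(2)] ..
  have "hol_at (N * k) p = concat (map (\<lambda>i. chain (\<lambda>j. ?y (i * k + j)) k) [0..<N])"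
    unfolding hol_at_def chain_def by (subst concat_map_upt_mult) simp
  also have "E \<dots> (concat (map (\<lambda>i. g (p (real i / real N)) (p (real (Suc i) / real N))) [0..<N]))"
  proof (rule E_concat)
    fix i assume "i < N"
    then obtain U where U: "U \<in> \<U>" "p ` {real i / real N..real (Suc i) / real N} \<subseteq> U"
      using assms(1) unfolding subordinate_def by blast
    have "E (chain (\<lambda>j. ?y (i * k + j)) k) (g (?y (i * k + 0)) (?y (i * k + k)))"
    proof (rule chain_collapse[OF U(1)])
      fix j assume "j \<le> k"
      then have "real (i * k) \<le> real (i * k + j)" "real (i * k + j) \<le> real (Suc i * k)" by auto
      then have "real (i * k + j) / real (N * k)
        \<in> {real (i * k) / real (N * k)..real (Suc i * k) / real (N * k)}"
        using divide_right_mono[of _ _ "real (N * k)"] by (metis atLeastAtMost_iff of_nat_0_le_iff)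
      also have "\<dots> = {real i / real N..real (Suc i) / real N}" unfolding grid_cancel[OF assms(2)] ..
      finally show "?y (i * k + j) \<in> U" using U(2) by blast
    qed
    moreover have "?y (i * k + k) = p (real (Suc i) / real N)" using ik[of "Suc i"]
      by (simp add: add.commute)
    ultimately show "E (chain (\<lambda>j. ?y (i * k + j)) k)
      (g (p (real i / real N)) (p (real (Suc i) / real N)))"
      using ik[of i] by simp
  qed
  also have "concat (map (\<lambda>i. g (p (real i / real N)) (p (real (Suc i) / real N))) [0..<N]) = hol_at N p"
    by (simp add: hol_at_def chain_def)
  finally show ?thesis .
qed

lemma hol_eq:
  assumes "subordinate \<U> p N" shows "E (hol p) (hol_at N p)"
proof -
  let ?K = "SOME N. subordinate \<U> p N"
  have K: "subordinate \<U> p ?K" using assms by (rule someI)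
  have "0 < ?K" "0 < N" using K assms by (auto simp: subordinate_def)
  then have "E (hol_at (?K * N) p) (hol p)" "E (hol_at (N * ?K) p) (hol_at N p)"
    unfolding hol_def using hol_at_refine K assms by blast+
  then show ?thesis using E_sym E_trans by (metis mult.commute)
qed

lemma hol_local:
  assumes "U \<in> \<U>" "path_image p \<subseteq> U"
  shows "E (hol p) (g (pathstart p) (pathfinish p))"
proof -
  have "subordinate \<U> p 1" using assms by (auto simp: subordinate_def path_image_def)
  from hol_eq[OF this] show ?thesis
    by (simp add: hol_at_def chain_def pathstart_def pathfinish_def)
qed

lemma hol_join:
  assumes "path p" "path_image p \<subseteq> \<Union>\<U>" "path q" "path_image q \<subseteq> \<Union>\<U>" "pathfinish p = pathstart q"
  shows "E (hol (p +++ q)) (hol p @ hol q)"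
proof -
  obtain N1 where N1: "subordinate \<U> p N1" using ex_subordinate assms open_cover by blast
  obtain N2 where N2: "subordinate \<U> q N2" using ex_subordinate assms open_cover by blast
  \<comment> \<open>A common length makes the 2N-fold subdivision of the join restrict to the N-fold
    subdivisions of its two halves.\<close>
  define N where "N = N1 * N2"
  have Np: "subordinate \<U> p N" and Nq: "subordinate \<U> q N" and N: "0 < N"
    using subordinate_mult[OF N1, of N2] subordinate_mult[OF N2, of N1] N1 N2
    by (auto simp: subordinate_def N_def mult.commute)
  have left: "(p +++ q) t = p (2 * t)" if "t \<le> 1/2" for t using that by (simp add: joinpaths_def)
  have right: "(p +++ q) t = q (2 * t - 1)" if "1/2 \<le> t" for t
  proof (cases "t = 1/2")
    case True
    show ?thesis unfolding True using assms(5) by (simp add: joinpaths_def pathfinish_def pathstart_def)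
  qed (use that in \<open>simp add: joinpaths_def\<close>)
  have lgrid: "(p +++ q) (real i / real (N + N)) = p (real i / real N)" if "i \<le> N" for i
    using that N by (subst left) (auto simp: field_simps)
  have rgrid: "(p +++ q) (real (N + j) / real (N + N)) = q (real j / real N)" for j
    using N by (subst right) (auto simp: field_simps)
  have sub: "subordinate \<U> (p +++ q) (N + N)"
    unfolding subordinate_def
  proof (intro conjI allI impI)
    fix i assume i: "i < N + N"
    show "\<exists>U\<in>\<U>. (p +++ q) ` {real i / real (N + N)..real (Suc i) / real (N + N)} \<subseteq> U"
    proof (cases "i < N")
      case True
      then obtain U where U: "U \<in> \<U>" "p ` {real i / real N..real (Suc i) / real N} \<subseteq> U"
        using Np unfolding subordinate_def by blast
      have "(p +++ q) t \<in> U" if t: "t \<in> {real i / real (N + N)..real (Suc i) / real (N + N)}" for t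
      proof -
        have "real (Suc i) \<le> real N" using True by linarith
        then have "real (Suc i) / real (N + N) \<le> 1/2" using N by (simp add: field_simps)
        then have "t \<le> 1/2" using t by (metis atLeastAtMost_iff order_trans)
        moreover have "2 * t \<in> {real i / real N..real (Suc i) / real N}"
          using t N by (auto simp: field_simps)
        ultimately show ?thesis using U(2) left by auto
      qed
      then show ?thesis using U(1) by blast
    next
      case False
      then obtain j where j: "i = N + j" "j < N" using i
        by (metis add_less_cancel_left le_add_diff_inverse not_less)
      then obtain U where U: "U \<in> \<U>" "q ` {real j / real N..real (Suc j) / real N} \<subseteq> U"
        using Nq unfolding subordinate_def by blast
      have "(p +++ q) t \<in> U" if t: "t \<in> {real i / real (N + N)..real (Suc i) / real (N + N)}" for t
      proof -
        have "1/2 \<le> real i / real (N + N)" using N j by (simp add: field_simps)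
        then have "1/2 \<le> t" using t by (metis atLeastAtMost_iff order_trans)
        moreover have "2 * t - 1 \<in> {real j / real N..real (Suc j) / real N}"
          using t N j by (auto simp: field_simps)
        ultimately show ?thesis using U(2) right by auto
      qed
      then show ?thesis using U(1) by blast
    qed
  qed (use N in auto)
  have "hol_at (N + N) (p +++ q) = hol_at N p @ hol_at N q"
  proof -
    have "map
      (\<lambda>i. g ((p +++ q) (real i / real (N + N))) ((p +++ q) (real (Suc i) / real (N + N)))) [0..<N]
        = map (\<lambda>i. g (p (real i / real N)) (p (real (Suc i) / real N))) [0..<N]"
      by (rule map_cong[OF refl]) (simp only: lgrid set_upt atLeastLessThan_iff Suc_leI less_imp_le)
    moreover have "concat
      (map (\<lambda>i. g ((p +++ q) (real i / real (N + N))) ((p +++ q) (real (Suc i) / real (N + N)))) [N..<N + N])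
        = concat (map (\<lambda>i. g (q (real i / real N)) (q (real (Suc i) / real N))) [0..<N])"
      unfolding concat_map_upt_shift add_Suc_right[symmetric] rgrid ..
    moreover have "[0..<N + N] = [0..<N] @ [N..<N + N]" by (rule upt_add_eq_append) simp
    ultimately show ?thesis unfolding hol_at_def chain_def by (simp only: map_append concat_append)
  qed
  then have "E (hol (p +++ q)) (hol_at N p @ hol_at N q)" using hol_eq[OF sub] by simp
  also have "E (hol_at N p @ hol_at N q) (hol p @ hol q)"
    using hol_eq[OF Np] hol_eq[OF Nq] by (intro E_append) (auto intro: E_sym)
  finally show ?thesis .
qed

text \<open>The two ways around a strip of cells agree, because each cell lies in one member of the
  cover and both of its boundary routes reduce to the diagonal.\<close>

lemma chain_ladder:
  assumes "\<And>i. i < n \<Longrightarrow> \<exists>U\<in>\<U>. {y i, y (Suc i), z i, z (Suc i)} \<subseteq> U"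
  shows "E (chain y n @ g (y n) (z n)) (g (y 0) (z 0) @ chain z n)"
  using assms
proof (induction n)
  case 0
  then show ?case by (simp add: chain_def E_refl)
next
  case (Suc n)
  obtain U where U: "U \<in> \<U>" "{y n, y (Suc n), z n, z (Suc n)} \<subseteq> U" using Suc.prems by blast
  have sq: "E (g (y n) (y (Suc n)) @ g (y (Suc n)) (z (Suc n))) (g (y n) (z n) @ g (z n) (z (Suc n)))"
    using cocycle[OF U(1), of "y n" "y (Suc n)" "z (Suc n)"] cocycle[OF U(1), of "y n" "z n" "z (Suc n)"]
      U(2) E_trans E_sym by (metis insert_subset)
  have "E (chain y n @ (g (y n) (y (Suc n)) @ g (y (Suc n)) (z (Suc n))))
      (chain y n @ (g (y n) (z n) @ g (z n) (z (Suc n))))"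
    by (intro E_append E_refl sq)
  also have "chain y n @ (g (y n) (z n) @ g (z n) (z (Suc n))) = (chain y n @ g (y n) (z n)) @ g (z n)
    (z (Suc n))"
    by simp
  also have "E \<dots> ((g (y 0) (z 0) @ chain z n) @ g (z n) (z (Suc n)))"
    using Suc by (intro E_append[OF _ E_refl]) auto
  finally show ?case by (simp add: chain_Suc)
qed

text \<open>The homotopy square is cut into boxes lying in single members of the cover. Adjacent
  rows form ladders whose end rungs are trivial, since the homotopy fixes the endpoints.\<close>

lemma hol_homotopic:
  assumes "homotopic_paths (\<Union>\<U>) p q"
  shows "E (hol p) (hol q)"
proof -
  obtain h :: "real \<times> real \<Rightarrow> 'a" where h: "continuous_on ({0..1} \<times> {0..1}) h"
    "h ` ({0..1} \<times> {0..1}) \<subseteq> \<Union>\<U>"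
     "\<And>x. x \<in> {0..1} \<Longrightarrow> h (0, x) = p x" "\<And>x. x \<in> {0..1} \<Longrightarrow> h (1, x) = q x"
     "\<And>t. t \<in> {0..1} \<Longrightarrow> pathstart (h \<circ> Pair t) = pathstart p"
     "\<And>t. t \<in> {0..1} \<Longrightarrow> pathfinish (h \<circ> Pair t) = pathfinish p"
    using assms unfolding homotopic_paths image_subset_iff_funcset by blast
  obtain e where e: "e > 0" "\<And>x. x \<in> {0..1} \<times> {0..1} \<Longrightarrow> \<exists>U\<in>\<U>. \<forall>y\<in>{0..1} \<times> {0..1}. dist y x < e \<longrightarrow> h y \<in> U"
    using compact_image_cover_uniform[OF _ h(1,2) open_cover] by (metis compact_Icc compact_Times)
  \<comment> \<open>Half of \<open>e\<close> for each coordinate, as distance in the square is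
    bounded by the sum of the coordinate distances.\<close>
  obtain N :: nat where N: "N > 0" "1 / real N < e / 2"
    using e(1) real_arch_inverse[of "e / 2"] by (metis half_gt_zero inverse_eq_divide neq0_conv)
  let ?I = "\<lambda>i. {real i / real N..real (Suc i) / real N}"
  have box: "\<exists>U\<in>\<U>. h ` (?I j \<times> ?I i) \<subseteq> U" if ji: "j < N" "i < N" for j i
  proof -
    have "(real j / real N, real i / real N) \<in> {0..1} \<times> {0..1}"
      using grid_in_unit[of j N] grid_in_unit[of i N] ji by auto
    from e(2)[OF this] obtain U where "U \<in> \<U>" and near:
      "\<forall>y\<in>{0..1} \<times> {0..1}. dist y (real j / real N, real i / real N) < e \<longrightarrow> h y \<in> U" by (rule bexE)
    have "h (s, t) \<in> U" if st: "s \<in> ?I j" "t \<in> ?I i" for s t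
    proof (rule near[rule_format])
      show "(s, t) \<in> {0..1} \<times> {0..1}"
        using st grid_interval_subset[OF ji(1)] grid_interval_subset[OF ji(2)] by blast
      have "\<bar>s - real j / real N\<bar> \<le> 1 / real N" "\<bar>t - real i / real N\<bar> \<le> 1 / real N"
        using st by (auto simp: add_divide_distrib)
      then have "dist s (real j / real N) + dist t (real i / real N) < e"
        using N(2) unfolding dist_real_def by linarith
      moreover have "dist (s, t) (real j / real N, real i / real N) \<le> dist s (real j / real N) + dist t
        (real i / real N)"
        by (simp add: dist_Pair_Pair sqrt_sum_squares_le_sum)
      ultimately show "dist (s, t) (real j / real N, real i / real N) < e" by simp
    qed
    then show ?thesis using \<open>U \<in> \<U>\<close> by blast
  qed
  define r where "r j i = h (real j / real N, real i / real N)" for j i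
  have start: "r j 0 = pathstart p" if "j \<le> N" for j
    using h(5)[OF grid_in_unit[OF that]] by (simp add: pathstart_def r_def)
  have finish: "r j N = pathfinish p" if "j \<le> N" for j
    using h(6)[OF grid_in_unit[OF that]] N by (simp add: pathfinish_def r_def)
  have ends: "E (g (pathstart p) (pathstart p)) []" "E (g (pathfinish p) (pathfinish p)) []"
    using cocycle_refl assms homotopic_paths_imp_subset[OF assms] pathstart_in_path_image[of p]
      pathfinish_in_path_image[of p] by (metis UnionE subsetD)+
  have step: "E (chain (r j) N) (chain (r (Suc j)) N)" if "j < N" for j
  proof -
    have "E (chain (r j) N @ g (r j N) (r (Suc j) N)) (g (r j 0) (r (Suc j) 0) @ chain (r (Suc j)) N)"
    proof (rule chain_ladder)
      fix i assume "i < N"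
      then obtain U where U: "U \<in> \<U>" "h ` (?I j \<times> ?I i) \<subseteq> U" using box \<open>j < N\<close> by blast
      have "real k / real N \<in> ?I k \<and> real (Suc k) / real N \<in> ?I k" for k
        by (auto simp: divide_right_mono)
      then have corners: "{r j i, r j (Suc i), r (Suc j) i, r (Suc j) (Suc i)} \<subseteq> h ` (?I j \<times> ?I i)"
        unfolding r_def by blast
      show "\<exists>U\<in>\<U>. {r j i, r j (Suc i), r (Suc j) i, r (Suc j) (Suc i)} \<subseteq> U"
        using order_trans[OF corners U(2)] by (rule bexI[OF _ U(1)])
    qed
    then have "E (chain (r j) N @ g (pathfinish p) (pathfinish p))
      (g (pathstart p) (pathstart p) @ chain (r (Suc j)) N)"
      using start finish \<open>j < N\<close> by simp
    moreover have "E (chain (r j) N @ g (pathfinish p) (pathfinish p)) (chain (r j) N @ [])"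
      "E (g (pathstart p) (pathstart p) @ chain (r (Suc j)) N) ([] @ chain (r (Suc j)) N)"
      by (rule E_append[OF E_refl ends(2)], rule E_append[OF ends(1) E_refl])
    ultimately show ?thesis using E_sym E_trans by (metis append_Nil append_Nil2)
  qed
  have "E (chain (r 0) N) (chain (r j) N)" if "j \<le> N" for j
    using that by (induction j) (auto intro: E_refl E_trans step Suc_le_lessD)
  from this[of N] have rows: "E (chain (r 0) N) (chain (r N) N)" by simp
  \<comment> \<open>The bottom boxes also cover the pieces of \<open>p\<close>, so the first row of
    the grid computes the holonomy of \<open>p\<close>; the top boxes do the same for
    \<open>q\<close>.\<close>
  have sp: "subordinate \<U> p N"
  proof -
    have "p ` ?I i \<subseteq> h ` (?I 0 \<times> ?I i)" if "i < N" for i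
    proof
      fix x assume "x \<in> p ` ?I i"
      then obtain t where "t \<in> ?I i" "x = p t" by blast
      moreover have "t \<in> {0..1}" using \<open>t \<in> ?I i\<close> grid_interval_subset[OF that] by blast
      ultimately have "x = h (0, t)" "(0, t) \<in> ?I 0 \<times> ?I i" using h(3)[of t] by auto
      then show "x \<in> h ` (?I 0 \<times> ?I i)" by blast
    qed
    then show ?thesis unfolding subordinate_def using box[OF N(1)] N(1) by (meson order_trans)
  qed
  have sq: "subordinate \<U> q N"
  proof -
    have "q ` ?I i \<subseteq> h ` (?I (N - 1) \<times> ?I i)" if "i < N" for i
    proof
      fix x assume "x \<in> q ` ?I i"
      then obtain t where "t \<in> ?I i" "x = q t" by blast
      moreover have "t \<in> {0..1}" using \<open>t \<in> ?I i\<close> grid_interval_subset[OF that] by blast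
      \<comment> \<open>Boxes are indexed by their lower corner, so parameter 1 lies in the box of
        index N - 1.\<close>
      moreover have "1 \<in> ?I (N - 1)" using N by (auto simp: field_simps of_nat_diff)
      ultimately have "x = h (1, t)" "(1, t) \<in> ?I (N - 1) \<times> ?I i" using h(4)[of t]
        by (auto simp only: mem_Times_iff fst_conv snd_conv)
      then show "x \<in> h ` (?I (N - 1) \<times> ?I i)" by blast
    qed
    then show ?thesis unfolding subordinate_def using box[of "N - 1"] N(1)
      by (meson order_trans diff_less zero_less_one)
  qed
  have "chain (r 0) N = hol_at N p" "chain (r N) N = hol_at N q"
    unfolding hol_at_def chain_def r_def using h(3,4) grid_in_unit[of _ N] N(1)
    by (auto intro!: arg_cong[of _ _ concat] simp: Suc_leI less_imp_le)
  then show ?thesis using rows hol_eq[OF sp] hol_eq[OF sq] E_sym E_trans by metis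
qed

end

section \<open>Complements of subspaces of codimension three\<close>

text \<open>Two consecutive vertices of the polygon raise the dimension of a subspace by at most
  two, so codimension three leaves room for an apex outside all the resulting spans.\<close>

lemma simply_connected_codim_three_complement:
  fixes p :: "real \<Rightarrow> 'a::euclidean_space"
  assumes "finite \<L>" and sub: "\<And>L. L \<in> \<L> \<Longrightarrow> subspace L" and dim: "\<And>L. L \<in> \<L> \<Longrightarrow> dim L + 3 \<le> DIM('a)"
    and p: "path p" "path_image p \<subseteq> - \<Union>\<L>" "pathfinish p = pathstart p"
  shows "homotopic_paths (- \<Union>\<L>) p (linepath (pathstart p) (pathstart p))"
proof -
  let ?M = "- \<Union>\<L>"
  have "open ?M" using assms(1) sub closed_subspace by (intro open_Compl closed_Union) auto
  define \<U> where "\<U> = {U. open U \<and> convex U \<and> U \<subseteq> ?M}"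
  have "?M \<subseteq> \<Union>\<U>"
  proof
    fix x assume "x \<in> ?M"
    then obtain e where "e > 0" "ball x e \<subseteq> ?M" using \<open>open ?M\<close> open_contains_ball by blast
    then have "ball x e \<in> \<U>" "x \<in> ball x e" by (auto simp: \<U>_def)
    then show "x \<in> \<Union>\<U>" by blast
  qed
  then obtain N where N: "subordinate \<U> p N"
    using ex_subordinate[OF p(1), of \<U>] p(2) unfolding \<U>_def by blast
  then have N0: "0 < N" by (simp add: subordinate_def)
  define x where "x i = p (real i / real N)" for i
  \<comment> \<open>The forbidden apexes: \<open>z\<close> lies in one of these spans whenever a
    triangle over an edge meets a subspace at a point with nonzero weight at
    \<open>z\<close>.\<close>
  define Z where "Z = (\<Union>(i, L)\<in>{..<N} \<times> \<L>. span (insert (x i) (insert (x (Suc i)) L)))"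
  have "negligible (span (insert (x i) (insert (x (Suc i)) L)))" if "L \<in> \<L>" for i L
  proof -
    have "dim (insert (x i) (insert (x (Suc i)) L)) \<le> dim L + 2"
      by (simp add: dim_insert)
    then have "dim (span (insert (x i) (insert (x (Suc i)) L))) < DIM('a)"
      using dim[OF that] by simp
    then show ?thesis by (rule negligible_lowdim)
  qed
  then have "negligible Z"
    unfolding Z_def using assms(1) by (intro negligible_Union) auto
  then obtain z where z: "z \<notin> Z" using non_negligible_UNIV by (metis UNIV_eq_I)
  have cell: "\<exists>U\<in>\<U>. p ` {real i / real N..real (Suc i) / real N} \<subseteq> U" if "i < N" for i
    using N that by (auto simp: subordinate_def)
  have seg: "closed_segment (x i) (x (Suc i)) \<subseteq> ?M" if i: "i < N" for i
  proof -
    obtain U where U: "U \<in> \<U>" "p ` {real i / real N..real (Suc i) / real N} \<subseteq> U" using cell i by blast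
    have "x i \<in> U" "x (Suc i) \<in> U" using U(2) by (auto simp: x_def divide_right_mono)
    then have "closed_segment (x i) (x (Suc i)) \<subseteq> U"
      using U(1) closed_segment_subset[of "x i" U "x (Suc i)"] by (simp add: \<U>_def)
    then show ?thesis using U(1) by (auto simp: \<U>_def)
  qed
  have tri: "convex hull {z, x i, x (Suc i)} \<subseteq> ?M" if i: "i < N" for i
  proof
    fix y assume "y \<in> convex hull {z, x i, x (Suc i)}"
    then obtain a b c where abc: "0 \<le> a" "0 \<le> b" "0 \<le> c" "a + b + c = 1"
        "y = a *\<^sub>R z + b *\<^sub>R x i + c *\<^sub>R x (Suc i)"
      unfolding convex_hull_3 by blast
    show "y \<in> ?M"
    \<comment> \<open>Weight zero at the apex leaves a point of the edge itself, which is safe since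
      the edge lies in a convex part of the complement.\<close>
    proof (cases "a = 0")
      case True
      then have "y \<in> closed_segment (x i) (x (Suc i))"
        using abc unfolding closed_segment_def by (auto intro!: exI[of _ c] simp: eq_diff_eq)
      then show ?thesis using seg[OF i] by blast
    next
      case False
      show ?thesis
      proof (rule ccontr)
        assume "y \<notin> ?M"
        then obtain L where L: "L \<in> \<L>" "y \<in> L" by blast
        let ?S = "span (insert (x i) (insert (x (Suc i)) L))"
        have "a *\<^sub>R z = y - b *\<^sub>R x i - c *\<^sub>R x (Suc i)" using abc by simp
        moreover have "y - b *\<^sub>R x i - c *\<^sub>R x (Suc i) \<in> ?S"
          using L by (intro span_diff span_scale) (auto intro: span_base)
        ultimately have "(1 / a) *\<^sub>R (a *\<^sub>R z) \<in> ?S" by (metis span_scale)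
        then have "z \<in> ?S" using False by simp
        then show False using z L i unfolding Z_def by blast
      qed
    qed
  qed
  have coneM: "closed_segment z (x i) \<subseteq> ?M" "closed_segment (x i) z \<subseteq> ?M" if "i \<le> N" for i
  proof -
    have "\<exists>j<N. {z, x i} \<subseteq> {z, x j, x (Suc j)}"
    proof (cases "i = N")
      case True
      then show ?thesis using N0 by (intro exI[of _ "N - 1"]) auto
    next
      case False
      then show ?thesis using that by (intro exI[of _ i]) auto
    qed
    then obtain j where j: "j < N" "{z, x i} \<subseteq> {z, x j, x (Suc j)}" by blast
    have "closed_segment z (x i) \<subseteq> convex hull {z, x j, x (Suc j)}"
      unfolding segment_convex_hull using j(2) by (rule hull_mono)
    then show "closed_segment z (x i) \<subseteq> ?M" using tri[OF j(1)] by blast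
    then show "closed_segment (x i) z \<subseteq> ?M" by (simp add: closed_segment_commute)
  qed
  \<comment> \<open>Up to homotopy, the initial segment is the detour through the apex. Each new
    triangle replaces the spoke to \<open>x i\<close> by the spoke to \<open>x (Suc i)\<close>, and
    for a closed path the final detour retraces itself.\<close>
  have cone: "homotopic_paths ?M (subpath 0 (real i / real N) p)
    (linepath (x 0) z +++ linepath z (x i))" if "i \<le> N" for i
    using that
  proof (induction i)
    case 0
    have "homotopic_paths ?M (linepath (x 0) z +++ reversepath (linepath (x 0) z))
      (linepath (x 0) (x 0))"
      using homotopic_paths_rinv[of "linepath (x 0) z" ?M] coneM[of 0] by simp
    then have "homotopic_paths ?M (linepath (x 0) (x 0)) (linepath (x 0) z +++ linepath z (x 0))"
      by (simp add: homotopic_paths_sym)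
    moreover have "subpath 0 (real 0 / real N) p = linepath (x 0) (x 0)"
      by (auto simp: fun_eq_iff subpath_def linepath_def x_def algebra_simps)
    ultimately show ?case by metis
  next
    case (Suc i)
    then have i: "i < N" by simp
    obtain U where U: "U \<in> \<U>" "p ` {real i / real N..real (Suc i) / real N} \<subseteq> U" using cell i by blast
    then have cU: "convex U" "U \<subseteq> ?M" by (auto simp: \<U>_def)
    let ?s = "subpath (real i / real N) (real (Suc i) / real N) p"
    have s: "path ?s" "path_image ?s \<subseteq> U" using subordinate_subpath[OF p(1) i U(2)] by auto
    have se: "pathstart ?s = x i" "pathfinish ?s = x (Suc i)" by (auto simp: x_def)
    have xU: "x i \<in> U" "x (Suc i) \<in> U" using U(2) by (auto simp: x_def divide_right_mono)
    have "homotopic_paths ?M ?s (linepath (x i) (x (Suc i)))"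
      using closed_segment_subset[OF xU cU(1)]
      by (intro convex_homotopic_paths[OF cU s]) (auto simp: x_def)
    with Suc i have "homotopic_paths ?M (subpath 0 (real i / real N) p +++ ?s)
        ((linepath (x 0) z +++ linepath z (x i)) +++ linepath (x i) (x (Suc i)))"
      by (intro homotopic_paths_join) auto
    moreover have "homotopic_paths ?M
      (linepath (x 0) z +++ (linepath z (x i) +++ linepath (x i) (x (Suc i))))
        ((linepath (x 0) z +++ linepath z (x i)) +++ linepath (x i) (x (Suc i)))"
      using coneM[of 0] coneM[of i] seg[OF i] i by (intro homotopic_paths_assoc) auto
    moreover have "homotopic_paths ?M
      (linepath (x 0) z +++ (linepath z (x i) +++ linepath (x i) (x (Suc i))))
        (linepath (x 0) z +++ linepath z (x (Suc i)))"
    proof (rule homotopic_paths_join)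
      let ?T = "convex hull {z, x i, x (Suc i)}"
      have "closed_segment a b \<subseteq> ?T" if "{a, b} \<subseteq> {z, x i, x (Suc i)}" for a b
        unfolding segment_convex_hull using that by (rule hull_mono)
      then show "homotopic_paths ?M (linepath z (x i) +++ linepath (x i) (x (Suc i)))
        (linepath z (x (Suc i)))"
        by (intro convex_homotopic_paths[OF convex_convex_hull tri[OF i]]) (auto simp: path_image_join)
    qed (use coneM[of 0] in auto)
    moreover have "homotopic_paths ?M (subpath 0 (real i / real N) p +++ ?s)
      (subpath 0 (real (Suc i) / real N) p)"
      using p grid_in_unit[of i N] grid_in_unit[of "Suc i" N] i
      by (intro homotopic_join_subpaths) auto
    ultimately show ?case by (meson homotopic_paths_sym homotopic_paths_trans)
  qed
  have "x 0 = pathstart p" "x N = pathstart p" using p(3) N0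
    by (auto simp: x_def pathstart_def pathfinish_def)
  then have "homotopic_paths ?M p (linepath (x 0) z +++ reversepath (linepath (x 0) z))"
    using cone[of N] N0 by simp
  moreover have "homotopic_paths ?M (linepath (x 0) z +++ reversepath (linepath (x 0) z))
    (linepath (x 0) (x 0))"
    using homotopic_paths_rinv[of "linepath (x 0) z" ?M] coneM[of 0] by simp
  ultimately show ?thesis using \<open>x 0 = pathstart p\<close> homotopic_paths_trans by metis
qed

section \<open>Fundamental groups of unions of faces\<close>

text \<open>\<open>\<I>\<close> is the set of types of the faces that are retained.\<close>

locale face_types = finite_simple_roots +
  fixes \<I> :: "'a set set"
  assumes type_subset: "I \<in> \<I> \<Longrightarrow> I \<subseteq> B"
    and type_down: "I \<in> \<I> \<Longrightarrow> J \<subseteq> I \<Longrightarrow> J \<in> \<I>"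
    and type_empty: "{} \<in> \<I>"
    and type_singleton: "\<alpha> \<in> B \<Longrightarrow> {\<alpha>} \<in> \<I>"
begin

text \<open>The supports of \<open>a\<close> and \<open>b\<close> may differ: with the empty type
  retained, \<open>[\<alpha>, \<alpha>]\<close> may be replaced by the empty word.\<close>

definition wstep :: "'a list \<Rightarrow> 'a list \<Rightarrow> bool" where
  "wstep u v \<longleftrightarrow> (\<exists>xs a b ys. u = xs @ a @ ys \<and> v = xs @ b @ ys \<and>
     set a \<in> \<I> \<and> set b \<in> \<I> \<and> wprod a = wprod b)"

definition weq :: "'a list \<Rightarrow> 'a list \<Rightarrow> bool" where
  "weq = wstep\<^sup>*\<^sup>*"

lemma wstep_sym: "wstep u v \<Longrightarrow> wstep v u"
  unfolding wstep_def by metis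

lemma weq_refl: "weq u u"
  by (simp add: weq_def)

lemma weq_sym: "weq u v \<Longrightarrow> weq v u"
  unfolding weq_def
  by (induction rule: rtranclp_induct) (auto intro: converse_rtranclp_into_rtranclp wstep_sym)

lemma weq_trans [trans]: "weq u v \<Longrightarrow> weq v w \<Longrightarrow> weq u w"
  unfolding weq_def by simp

lemma wstep_context: "wstep u v \<Longrightarrow> wstep (x @ u @ y) (x @ v @ y)"
  unfolding wstep_def by (metis append.assoc)

lemma weq_context: "weq u v \<Longrightarrow> weq (x @ u @ y) (x @ v @ y)"
  unfolding weq_def
  by (induction rule: rtranclp_induct) (auto intro: rtranclp.rtrancl_into_rtrancl wstep_context)

lemma weq_append: "weq u u' \<Longrightarrow> weq v v' \<Longrightarrow> weq (u @ v) (u' @ v')"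
  using weq_context[of u u' "[]" v] weq_context[of v v' u' "[]"] weq_trans by fastforce

lemma weqI: "set a \<in> \<I> \<Longrightarrow> set b \<in> \<I> \<Longrightarrow> wprod a = wprod b \<Longrightarrow> weq a b"
  unfolding weq_def wstep_def by (rule r_into_rtranclp) (metis append_Nil append_Nil2)

lemma weq_wprod: "weq u v \<Longrightarrow> wprod u = wprod v"
  unfolding weq_def
  by (induction rule: rtranclp_induct) (auto simp: wstep_def wprod_append)

lemma weq_subset: "weq u v \<Longrightarrow> set v \<subseteq> B \<Longrightarrow> set u \<subseteq> B"
  unfolding weq_def
  by (induction rule: rtranclp_induct) (use type_subset in \<open>auto simp: wstep_def\<close>)

section \<open>Faces and their convex open stars\<close>

definition faces_union :: "'a set" where
  "faces_union = {x. \<exists>w\<in>weyl. in_chamber w x \<and> walls w x \<in> \<I>}"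

text \<open>Chambers through a common point differ by words in its walls, which do not change the
  type; so membership can be tested in any chamber containing the point.\<close>

lemma faces_union_walls:
  assumes "x \<in> faces_union" "w \<in> weyl" "in_chamber w x"
  shows "walls w x \<in> \<I>"
proof -
  obtain v where v: "v \<in> weyl" "in_chamber v x" "walls v x \<in> \<I>"
    using assms(1) by (auto simp: faces_union_def)
  obtain u where "set u \<subseteq> walls v x" "w = v \<circ> wprod u"
    using chambers_through_point[OF v(1) assms(2) v(2) assms(3)] by blast
  then show ?thesis using in_chamber_through_face(2)[OF v(1,2)] v(3) by simp
qed

text \<open>The union of the open faces whose closure contains \<open>f\<close>: roots nonzero at
  \<open>f\<close> keep their strict sign, and roots vanishing at \<open>f\<close> are free.
  Negative signs are covered because roots come in opposite pairs.\<close>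

definition star :: "'a \<Rightarrow> 'a set" where
  "star f = {x. \<forall>\<beta>\<in>\<Phi>. 0 < \<beta> \<bullet> f \<longrightarrow> 0 < \<beta> \<bullet> x}"

lemma star_eq: "star f = (\<Inter>\<beta>\<in>{\<beta>\<in>\<Phi>. 0 < \<beta> \<bullet> f}. {x. 0 < \<beta> \<bullet> x})"
  by (auto simp: star_def)

lemma open_star: "open (star f)"
  unfolding star_eq using finite_roots open_halfspace_gt by (intro open_INT) auto

lemma convex_star: "convex (star f)"
  unfolding star_eq using convex_halfspace_gt by (intro convex_INT) auto

lemma center_in_star: "f \<in> star f"
  by (simp add: star_def)

text \<open>A nonzero sign at \<open>f\<close> is shared by \<open>x\<close>, so a chamber
  inequality or a wall equation valid at \<open>x\<close> cannot be violated or become strict in the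
  wrong way at \<open>f\<close>.\<close>

lemma star_chamber:
  assumes "x \<in> star f" "w \<in> weyl" "in_chamber w x"
  shows "in_chamber w f" "walls w x \<subseteq> walls w f"
proof -
  have neg: "x \<bullet> w \<alpha> < 0" if "f \<bullet> w \<alpha> < 0" "\<alpha> \<in> B" for \<alpha>
  proof -
    have "- w \<alpha> \<in> \<Phi>" using that assms(2) weyl_root root_uminus B_subset by blast
    then show ?thesis using assms(1) that unfolding star_def by (force simp: inner_commute)
  qed
  have pos: "0 < x \<bullet> w \<alpha>" if "0 < f \<bullet> w \<alpha>" "\<alpha> \<in> B" for \<alpha>
  proof -
    have "w \<alpha> \<in> \<Phi>" using that assms(2) weyl_root B_subset by blast
    then show ?thesis using assms(1) that unfolding star_def by (force simp: inner_commute)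
  qed
  show "in_chamber w f"
    unfolding in_chamber_def using neg assms(3) by (force simp: in_chamber_def not_less[symmetric])
  show "walls w x \<subseteq> walls w f"
  proof
    fix \<alpha> assume "\<alpha> \<in> walls w x"
    then have "\<alpha> \<in> B" "x \<bullet> w \<alpha> = 0" by (auto simp: walls_def)
    then show "\<alpha> \<in> walls w f" using neg[of \<alpha>] pos[of \<alpha>] by (force simp: walls_def)
  qed
qed

text \<open>Moving from \<open>f\<close> into its star can only drop walls, and the retained types
  are closed under subsets.\<close>

lemma star_subset: assumes "f \<in> faces_union" shows "star f \<subseteq> faces_union"
proof
  fix x assume x: "x \<in> star f"
  obtain w where w: "w \<in> weyl" "in_chamber w x" using ex_chamber by blast
  then have "in_chamber w f" "walls w x \<subseteq> walls w f" using star_chamber[OF x] by auto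
  then have "walls w x \<in> \<I>" using faces_union_walls[OF assms w(1)] type_down by blast
  then show "x \<in> faces_union" using w by (auto simp: faces_union_def)
qed

text \<open>Pulled back to the fundamental chamber, a root positive at a dominant point is a
  positive root, hence has positive height.\<close>

lemma chamber_center_in_star:
  assumes "w \<in> weyl" "in_chamber w f"
  shows "w rho \<in> star f"
  unfolding star_def
proof (intro CollectI ballI impI)
  fix \<beta> assume \<beta>: "\<beta> \<in> \<Phi>" "0 < \<beta> \<bullet> f"
  obtain w' where w': "w' \<in> weyl" "w' \<circ> w = id" "w \<circ> w' = id" "\<And>x y. w x \<bullet> y = x \<bullet> w' y"
    using weyl_inverse[OF assms(1)] by metis
  have dom: "dominant (w' f)" using assms(2) w'(4)
    by (simp add: dominant_def in_chamber_def inner_commute)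
  have r: "w' \<beta> \<in> \<Phi>" using \<beta> w' weyl_root by blast
  have "0 < rho \<bullet> w' \<beta>"
  proof (rule ccontr)
    assume "\<not> 0 < rho \<bullet> w' \<beta>"
    then have "0 < rho \<bullet> (- w' \<beta>)" using root_rho_nonzero[OF r] by auto
    then have "0 \<le> w' f \<bullet> (- w' \<beta>)" using dominant_positive_root[OF dom root_uminus[OF r]] by blast
    then have "w' f \<bullet> w' \<beta> \<le> 0" by simp
    then show False using weyl_inner[OF w'(1), of f \<beta>] \<beta> by (simp add: inner_commute)
  qed
  then show "0 < \<beta> \<bullet> w rho" using w'(4)[of rho \<beta>] by (simp add: inner_commute)
qed

section \<open>The word-valued cocycle of the star cover\<close>

definition star_cover :: "'a set set" where "star_cover = star ` faces_union"

lemma Union_star_cover: "\<Union>star_cover = faces_union"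
  using star_subset center_in_star by (auto simp: star_cover_def)

text \<open>On walls the choice is arbitrary. The resulting ambiguity is a word on the type of the
  face, which \<open>weq\<close> absorbs.\<close>

definition chamber_of :: "'a \<Rightarrow> 'a \<Rightarrow> 'a" where
  "chamber_of x = (SOME w. w \<in> weyl \<and> in_chamber w x)"

lemma chamber_of: "chamber_of x \<in> weyl" "in_chamber (chamber_of x) x"
  using someI_ex[of "\<lambda>w. w \<in> weyl \<and> in_chamber w x"] ex_chamber[of x] unfolding chamber_of_def by blast+

lemma chamber_of_center: assumes "w \<in> weyl" shows "chamber_of (w rho) = w"
  using chambers_through_point[OF assms chamber_of(1) chamber_rho(1)[OF assms] chamber_of(2)]
    chamber_rho(2)[OF assms] by auto

lemma weyl_comp_cancel: assumes "w \<in> weyl" "w \<circ> a = w \<circ> b" shows "a = b"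
proof -
  obtain w' where "w' \<circ> w = id" using weyl_inverse[OF assms(1)] by metis
  then show ?thesis using assms(2) by (metis comp_assoc id_comp)
qed

text \<open>Significant only for chambers with a common retained face. Any two admissible choices
  have equal product and retained supports, so they are one \<open>wstep\<close> apart.\<close>

definition word_between :: "('a \<Rightarrow> 'a) \<Rightarrow> ('a \<Rightarrow> 'a) \<Rightarrow> 'a list" where
  "word_between w v = (SOME u. set u \<in> \<I> \<and> v = w \<circ> wprod u)"

lemma word_between:
  assumes "set u \<in> \<I>" "v = w \<circ> wprod u"
  shows "set (word_between w v) \<in> \<I>" "v = w \<circ> wprod (word_between w v)"
  using someI[of "\<lambda>u. set u \<in> \<I> \<and> v = w \<circ> wprod u" u] assms unfolding word_between_def by blast+

lemma word_between_weq:
  assumes "w \<in> weyl" "set u \<in> \<I>"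
  shows "weq (word_between w (w \<circ> wprod u)) u"
proof -
  note wb = word_between[OF assms(2) refl, of w]
  show ?thesis
    by (rule weqI[OF wb(1) assms(2) weyl_comp_cancel[OF assms(1) wb(2), symmetric]])
qed

lemma word_between_cocycle:
  assumes "w \<in> weyl" "I \<in> \<I>" "set a \<subseteq> I" "set b \<subseteq> I"
  shows "weq (word_between w (w \<circ> wprod a) @ word_between (w \<circ> wprod a) (w \<circ> wprod a \<circ> wprod b))
     (word_between w (w \<circ> wprod a \<circ> wprod b))"
proof -
  have types: "set a \<in> \<I>" "set b \<in> \<I>" "set (a @ b) \<in> \<I>" using type_down[OF assms(2)] assms(3,4) by auto
  have "w \<circ> wprod a \<in> weyl"
    using assms type_subset[OF assms(2)] by (intro weyl_comp wprod_in_weyl) auto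
  then have "weq (word_between w (w \<circ> wprod a) @ word_between (w \<circ> wprod a) (w \<circ> wprod a \<circ> wprod b))
    (a @ b)"
    using types assms(1) by (intro weq_append word_between_weq)
  also have "weq (a @ b) (word_between w (w \<circ> wprod (a @ b)))"
    using word_between_weq[OF assms(1) types(3)] by (rule weq_sym)
  finally show ?thesis by (simp add: wprod_append comp_assoc)
qed

lemma star_words:
  assumes "f \<in> faces_union" "x \<in> star f" "y \<in> star f"
  shows "\<exists>u. set u \<subseteq> walls (chamber_of x) f \<and> chamber_of y = chamber_of x \<circ> wprod u"
  by (rule chambers_through_point) (use star_chamber[OF assms(2)] star_chamber[OF assms(3)] chamber_of in auto)

text \<open>All chambers chosen for points of one star contain its centre. The transition words are
  therefore supported on a single retained type, where equality of products is exactly what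
  \<open>weq\<close> allows.\<close>

sublocale cocycle: discrete_cocycle star_cover weq "\<lambda>x y. word_between (chamber_of x) (chamber_of y)"
proof
  show "open U" if "U \<in> star_cover" for U using that open_star by (auto simp: star_cover_def)
  show "weq u u" for u by (rule weq_refl)
  show "weq v u" if "weq u v" for u v using that by (rule weq_sym)
  show "weq u w" if "weq u v" "weq v w" for u v w using that by (rule weq_trans)
  show "weq (u @ v) (u' @ v')" if "weq u u'" "weq v v'" for u u' v v' using that by (rule weq_append)
  fix U x y z assume "U \<in> star_cover" and x: "x \<in> U"
  then obtain f where f: "f \<in> faces_union" "U = star f" by (auto simp: star_cover_def)
  let ?I = "walls (chamber_of x) f"
  have I: "?I \<in> \<I>"
    using faces_union_walls[OF f(1) chamber_of(1)] star_chamber(1)[of x f] chamber_of x f by auto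
  show "weq (word_between (chamber_of x) (chamber_of x)) []"
    using word_between_weq[OF chamber_of(1), of "[]" x] type_empty by simp
  assume yz: "y \<in> U" "z \<in> U"
  obtain a where a: "set a \<subseteq> ?I" "chamber_of y = chamber_of x \<circ> wprod a"
    using star_words[OF f(1)] x yz f by blast
  obtain b where b: "set b \<subseteq> walls (chamber_of y) f" "chamber_of z = chamber_of y \<circ> wprod b"
    using star_words[OF f(1)] x yz f by blast
  \<comment> \<open>Both words must be supported on one type; the type of the face of
    \<open>f\<close> is the same seen from either chamber.\<close>
  have "walls (chamber_of y) f = ?I"
    using in_chamber_through_face(2)[OF chamber_of(1) _ a(1)] star_chamber(1)[of x f] chamber_of x f a
      by simp
  then show "weq
    (word_between (chamber_of x) (chamber_of y) @ word_between (chamber_of y) (chamber_of z))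
      (word_between (chamber_of x) (chamber_of z))"
    using word_between_cocycle[OF chamber_of(1) I a(1)] b a by simp
qed

text \<open>A polygon through chamber centres. Multiplication on the right by a simple reflection
  crosses the wall of that type of the current chamber, so words record types independently of the
  start.\<close>

fun gallery_path :: "('a \<Rightarrow> 'a) \<Rightarrow> 'a list \<Rightarrow> real \<Rightarrow> 'a" where
  "gallery_path w [] = linepath (w rho) (w rho)"
| "gallery_path w (\<alpha> # u) = linepath (w rho) (w (reflection \<alpha> rho)) +++ gallery_path
  (w \<circ> reflection \<alpha>) u"

lemma gallery_path_ends [simp]:
  "pathstart (gallery_path w u) = w rho" "pathfinish (gallery_path w u) = w (wprod u rho)"
  by (induction u arbitrary: w) auto

lemma path_gallery_path [simp]: "path (gallery_path w u)"
  by (induction u arbitrary: w) auto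

lemma gallery_path_in_star:
  assumes "w \<in> weyl" "in_chamber w f" "set u \<subseteq> walls w f"
  shows "path_image (gallery_path w u) \<subseteq> star f"
  using assms
proof (induction u arbitrary: w)
  case Nil
  then show ?case using chamber_center_in_star by simp
next
  case (Cons \<alpha> u)
  have \<alpha>: "\<alpha> \<in> B" using Cons.prems walls_subset by auto
  have w': "w \<circ> reflection \<alpha> \<in> weyl" using Cons.prems(1) wprod_in_weyl[of "[\<alpha>]"] \<alpha> weyl_comp by auto
  have f: "in_chamber (w \<circ> reflection \<alpha>) f" "walls (w \<circ> reflection \<alpha>) f = walls w f"
    using in_chamber_through_face[OF Cons.prems(1,2), of "[\<alpha>]"] Cons.prems(3) by auto
  have "closed_segment (w rho) (w (reflection \<alpha> rho)) \<subseteq> star f"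
    using chamber_center_in_star[OF Cons.prems(1,2)] chamber_center_in_star[OF w' f(1)] convex_star[of f]
    by (intro closed_segment_subset) auto
  moreover have "path_image (gallery_path (w \<circ> reflection \<alpha>) u) \<subseteq> star f"
  proof (rule Cons.IH[OF w' f(1)])
    show "set u \<subseteq> walls (w \<circ> reflection \<alpha>) f" unfolding f(2) using Cons.prems(3) by simp
  qed
  ultimately show ?case by (simp add: path_image_join)
qed

lemma face_star:
  assumes "w \<in> weyl" "I \<in> \<I>"
  obtains f where "f \<in> faces_union" "in_chamber w f" "walls w f = I"
proof -
  obtain f where "in_chamber w f" "walls w f = I"
    using face_point[OF assms(1) type_subset[OF assms(2)]] by blast
  then show ?thesis using that assms by (auto simp: faces_union_def)
qed

lemma center_in_faces_union: "w \<in> weyl \<Longrightarrow> w rho \<in> faces_union"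
  using chamber_rho[of w] type_empty by (auto simp: faces_union_def)

lemma gallery_path_append:
  assumes "path_image (gallery_path w (u @ v)) \<subseteq> M"
  shows "homotopic_paths M (gallery_path w (u @ v)) (gallery_path w u +++ gallery_path (w \<circ> wprod u) v)"
  using assms
proof (induction u arbitrary: w)
  case Nil
  then show ?case
    using homotopic_paths_lid'[of "gallery_path w v" M "w rho"]
    by (simp add: homotopic_paths_sym del: linepath_trivial)
next
  case (Cons \<alpha> u)
  let ?l = "linepath (w rho) (w (reflection \<alpha> rho))" and ?w = "w \<circ> reflection \<alpha>"
  have im: "path_image ?l \<subseteq> M" "path_image (gallery_path ?w (u @ v)) \<subseteq> M"
    using Cons.prems by (auto simp: path_image_join)
  have IH: "homotopic_paths M (gallery_path ?w (u @ v))
    (gallery_path ?w u +++ gallery_path (?w \<circ> wprod u) v)"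
    using Cons.IH im(2) by blast
  have im2: "path_image (gallery_path ?w u +++ gallery_path (?w \<circ> wprod u) v) \<subseteq> M"
    using homotopic_paths_imp_subset[OF IH] by blast
  then have "homotopic_paths M (?l +++ gallery_path ?w (u @ v))
    (?l +++ (gallery_path ?w u +++ gallery_path (?w \<circ> wprod u) v))"
    using IH im by (intro homotopic_paths_join) auto
  also have "homotopic_paths M (?l +++ (gallery_path ?w u +++ gallery_path (?w \<circ> wprod u) v))
      ((?l +++ gallery_path ?w u) +++ gallery_path (?w \<circ> wprod u) v)"
    using im im2 by (intro homotopic_paths_assoc) (auto simp: path_image_join)
  finally show ?case by (simp only: comp_assoc append_Cons gallery_path.simps wprod.simps)
qed

text \<open>Each segment joins two chambers inside the star of a common panel, whose type is
  retained by \<open>type_singleton\<close>.\<close>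

lemma gallery_path_in_faces_union:
  assumes "w \<in> weyl" "set u \<subseteq> B"
  shows "path_image (gallery_path w u) \<subseteq> faces_union"
  using assms
proof (induction u arbitrary: w)
  case Nil
  then show ?case using center_in_faces_union by auto
next
  case (Cons \<alpha> u)
  then obtain f where f: "f \<in> faces_union" "in_chamber w f" "walls w f = {\<alpha>}"
    using face_star[of w "{\<alpha>}"] type_singleton[of \<alpha>] by auto
  have "path_image (gallery_path w [\<alpha>]) \<subseteq> star f"
    using gallery_path_in_star[OF Cons.prems(1) f(2), of "[\<alpha>]"] f(3) by simp
  then have "closed_segment (w rho) (w (reflection \<alpha> rho)) \<subseteq> faces_union"
    using star_subset[OF f(1)] by (auto simp: path_image_join)
  moreover have "w \<circ> reflection \<alpha> \<in> weyl" using Cons.prems wprod_in_weyl[of "[\<alpha>]"] weyl_comp by auto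
  ultimately show ?case using Cons by (auto simp: path_image_join)
qed

text \<open>The whole gallery lies in one convex star, so its homotopy class depends only on its
  endpoints, hence only on the product of the word. This turns the relations into
  homotopies.\<close>

lemma gallery_path_type:
  assumes "w \<in> weyl" "set u \<in> \<I>"
  shows "homotopic_paths faces_union (gallery_path w u) (linepath (w rho) (w (wprod u rho)))"
proof -
  obtain f where f: "f \<in> faces_union" "in_chamber w f" "walls w f = set u" using face_star[OF assms]
    by blast
  have im: "path_image (gallery_path w u) \<subseteq> star f" using gallery_path_in_star[OF assms(1) f(2)] f(3)
    by simp
  then have "w rho \<in> star f" "w (wprod u rho) \<in> star f"
    using pathstart_in_path_image[of "gallery_path w u"] pathfinish_in_path_image[of "gallery_path w u"] by auto
  then have "closed_segment (w rho) (w (wprod u rho)) \<subseteq> star f"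
    using convex_star by (intro closed_segment_subset)
  then show ?thesis
    using im by (intro convex_homotopic_paths[OF convex_star star_subset[OF f(1)]]) auto
qed

lemma gallery_path_wstep:
  assumes "w \<in> weyl" "set u \<subseteq> B" "wstep u v"
  shows "homotopic_paths faces_union (gallery_path w u) (gallery_path w v)"
proof -
  obtain xs a b ys where d: "u = xs @ a @ ys" "v = xs @ b @ ys" "set a \<in> \<I>" "set b \<in> \<I>"
    "wprod a = wprod b"
    using assms(3) by (auto simp: wstep_def)
  have sets: "set xs \<subseteq> B" "set ys \<subseteq> B" using assms(2) d by auto
  let ?M = faces_union and ?w = "w \<circ> wprod xs"
  have w: "?w \<in> weyl" using assms(1) sets weyl_comp wprod_in_weyl by blast
  \<comment> \<open>The middle word enters the right-hand side only through its product, so the two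
    words of a step yield the same path.\<close>
  have expand: "homotopic_paths ?M (gallery_path w (xs @ c @ ys))
      (gallery_path w xs +++ (linepath (?w rho) (?w (wprod c rho)) +++ gallery_path (?w \<circ> wprod c) ys))"
    if c: "set c \<in> \<I>" for c
  proof -
    have cB: "set c \<subseteq> B" using c type_subset by blast
    have "homotopic_paths ?M (gallery_path w (xs @ (c @ ys)))
      (gallery_path w xs +++ gallery_path ?w (c @ ys))"
      using gallery_path_in_faces_union assms(1) sets cB by (intro gallery_path_append) auto
    also have "homotopic_paths ?M (gallery_path w xs +++ gallery_path ?w (c @ ys))
       (gallery_path w xs +++ (linepath (?w rho) (?w (wprod c rho)) +++ gallery_path (?w \<circ> wprod c) ys))"
    proof (rule homotopic_paths_join)
      show "homotopic_paths ?M (gallery_path w xs) (gallery_path w xs)"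
        using gallery_path_in_faces_union assms(1) sets by simp
      have "homotopic_paths ?M (gallery_path ?w (c @ ys))
        (gallery_path ?w c +++ gallery_path (?w \<circ> wprod c) ys)"
        using gallery_path_in_faces_union w sets cB by (intro gallery_path_append) auto
      also have "homotopic_paths ?M (gallery_path ?w c +++ gallery_path (?w \<circ> wprod c) ys)
         (linepath (?w rho) (?w (wprod c rho)) +++ gallery_path (?w \<circ> wprod c) ys)"
        using gallery_path_type[OF w c] gallery_path_in_faces_union[OF _ sets(2), of "?w \<circ> wprod c"]
          weyl_comp[OF w wprod_in_weyl[OF cB]]
        by (intro homotopic_paths_join) auto
      finally show "homotopic_paths ?M (gallery_path ?w (c @ ys))
        (linepath (?w rho) (?w (wprod c rho)) +++ gallery_path (?w \<circ> wprod c) ys)" .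
    qed auto
    finally show ?thesis .
  qed
  show ?thesis
    using expand[OF d(3)] expand[OF d(4)] unfolding d(1,2,5)
    by (meson homotopic_paths_sym homotopic_paths_trans)
qed

lemma gallery_path_weq:
  assumes "w \<in> weyl" "set u \<subseteq> B" "weq u v"
  shows "homotopic_paths faces_union (gallery_path w u) (gallery_path w v)"
  using assms(3) unfolding weq_def
proof (induction rule: rtranclp_induct)
  case base
  then show ?case using gallery_path_in_faces_union assms by simp
next
  case (step v v')
  have "weq v u" using step(1) weq_sym unfolding weq_def by blast
  then have "set v \<subseteq> B" using weq_subset assms(2) by blast
  then show ?case using gallery_path_wstep[OF assms(1) _ step(2)] step(3) homotopic_paths_trans by blast
qed

text \<open>Each segment joins two chamber centres, where \<open>chamber_of\<close> is unambiguous,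
  so it contributes its own letter.\<close>

lemma hol_gallery_path:
  assumes "w \<in> weyl" "set u \<subseteq> B"
  shows "weq (cocycle.hol (gallery_path w u)) u"
  using assms
proof (induction u arbitrary: w)
  case Nil
  have "star (w rho) \<in> star_cover" "path_image (gallery_path w []) \<subseteq> star (w rho)"
    using center_in_faces_union[OF Nil(1)] center_in_star by (auto simp: star_cover_def)
  from cocycle.hol_local[OF this] have "weq (cocycle.hol (gallery_path w [])) (word_between w w)"
    using chamber_of_center[OF Nil(1)] by simp
  also have "weq (word_between w w) []" using word_between_weq[OF Nil(1), of "[]"] type_empty by simp
  finally show ?case .
next
  case (Cons \<alpha> u)
  let ?l = "linepath (w rho) (w (reflection \<alpha> rho))" and ?w = "w \<circ> reflection \<alpha>"
  have w': "?w \<in> weyl" using Cons.prems wprod_in_weyl[of "[\<alpha>]"] weyl_comp by auto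
  obtain f where f: "f \<in> faces_union" "in_chamber w f" "walls w f = {\<alpha>}"
    using face_star[of w "{\<alpha>}"] type_singleton[of \<alpha>] Cons.prems by auto
  have "path_image (gallery_path w [\<alpha>]) \<subseteq> star f"
    using gallery_path_in_star[OF Cons.prems(1) f(2), of "[\<alpha>]"] f(3) by simp
  then have l: "path_image ?l \<subseteq> star f" by (auto simp: path_image_join)
  have cov: "star f \<in> star_cover" using f by (auto simp: star_cover_def)
  have ce: "chamber_of (w (reflection \<alpha> rho)) = ?w" using chamber_of_center[OF w'] by simp
  have "weq (cocycle.hol ?l) (word_between w ?w)"
    using cocycle.hol_local[OF cov l] chamber_of_center[OF Cons.prems(1)] ce by simp
  also have "weq (word_between w ?w) [\<alpha>]"
    using word_between_weq[OF Cons.prems(1), of "[\<alpha>]"] type_singleton Cons.prems by simp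
  finally have hl: "weq (cocycle.hol ?l) [\<alpha>]" .
  have "weq (cocycle.hol (?l +++ gallery_path ?w u)) (cocycle.hol ?l @ cocycle.hol (gallery_path ?w u))"
  proof (rule cocycle.hol_join)
    show "path_image ?l \<subseteq> \<Union>star_cover" using l cov by blast
    show "path_image (gallery_path ?w u) \<subseteq> \<Union>star_cover"
      using gallery_path_in_faces_union[OF w'] Cons.prems Union_star_cover by simp
  qed auto
  also have "weq (cocycle.hol ?l @ cocycle.hol (gallery_path ?w u)) ([\<alpha>] @ u)"
    using Cons.prems(2) by (intro weq_append hl Cons.IH[OF w']) simp
  finally show ?case by simp
qed

section \<open>Normal forms of paths\<close>

definition normal_path :: "(real \<Rightarrow> 'a) \<Rightarrow> real \<Rightarrow> 'a" where
  "normal_path p = linepath (pathstart p) (chamber_of (pathstart p) rho) +++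
     (gallery_path (chamber_of (pathstart p)) (cocycle.hol p) +++
      linepath (chamber_of (pathfinish p) rho) (pathfinish p))"

lemma to_center_in_star:
  assumes "x \<in> star f"
  shows "closed_segment x (chamber_of x rho) \<subseteq> star f" "closed_segment (chamber_of x rho) x \<subseteq> star f"
proof -
  have "chamber_of x rho \<in> star f"
    using star_chamber(1)[OF assms] chamber_of chamber_center_in_star by blast
  then show "closed_segment x (chamber_of x rho) \<subseteq> star f" "closed_segment (chamber_of x rho) x \<subseteq> star f"
    using assms convex_star by (auto intro: closed_segment_subset[THEN subsetD])
qed

lemma to_center:
  assumes "x \<in> faces_union"
  shows "closed_segment x (chamber_of x rho) \<subseteq> faces_union"
    "closed_segment (chamber_of x rho) x \<subseteq> faces_union"
  using to_center_in_star[OF center_in_star] star_subset[OF assms] by blast+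

lemma open_star_cover: "\<forall>U\<in>star_cover. open U"
  using open_star by (auto simp: star_cover_def)

text \<open>The path is recovered up to homotopy from its endpoints and its word. The first two
  conjuncts are carried through the induction because they make the gallery stay in the union of
  faces and end at the centre belonging to the final point.\<close>

lemma homotopic_normal_path:
  assumes "path p" "path_image p \<subseteq> faces_union"
  shows "set (cocycle.hol p) \<subseteq> B \<and> chamber_of (pathfinish p) = chamber_of (pathstart p) \<circ> wprod
    (cocycle.hol p) \<and>
    homotopic_paths faces_union p (normal_path p)"
  using assms(1) assms(2)[folded Union_star_cover] open_star_cover
proof (induction p rule: path_induct_cover)
  case (local p U)
  then obtain f where f: "f \<in> faces_union" "U = star f" by (auto simp: star_cover_def)
  let ?x = "pathstart p" and ?y = "pathfinish p"
  let ?w = "chamber_of ?x"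
  have xy: "?x \<in> star f" "?y \<in> star f" using local f by auto
  have wf: "in_chamber ?w f" using star_chamber(1)[OF xy(1)] chamber_of by blast
  have I: "walls ?w f \<in> \<I>" using faces_union_walls[OF f(1) chamber_of(1) wf] .
  obtain u where u: "set u \<subseteq> walls ?w f" "chamber_of ?y = ?w \<circ> wprod u" using star_words[OF f(1) xy]
    by blast
  have uI: "set u \<in> \<I>" using type_down[OF I u(1)] .
  have uB: "set u \<subseteq> B" using type_subset uI by blast
  have "weq (cocycle.hol p) (word_between ?w (chamber_of ?y))" using cocycle.hol_local local by blast
  also have "weq (word_between ?w (chamber_of ?y)) u" unfolding u(2)
    by (rule word_between_weq[OF chamber_of(1) uI])
  finally have hu: "weq (cocycle.hol p) u" .
  then have hB: "set (cocycle.hol p) \<subseteq> B" using weq_subset uB by blast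
  have yc: "chamber_of ?y = ?w \<circ> wprod (cocycle.hol p)" using weq_wprod[OF hu] u(2) by simp
  let ?q = "linepath ?x (?w rho) +++ (gallery_path ?w u +++ linepath (chamber_of ?y rho) ?y)"
  have gu: "path_image (gallery_path ?w u) \<subseteq> star f"
    using gallery_path_in_star[OF chamber_of(1) wf u(1)] .
  have "homotopic_paths faces_union p ?q"
    using to_center_in_star[OF xy(1)] to_center_in_star[OF xy(2)] gu local f u(2)
    by (intro convex_homotopic_paths[OF convex_star star_subset[OF f(1)]])
       (auto simp: path_image_join)
  also have "homotopic_paths faces_union ?q (normal_path p)"
  proof -
    have "?x \<in> faces_union" "?y \<in> faces_union" using xy star_subset[OF f(1)] by auto
    note ends = to_center(1)[OF this(1)] to_center(2)[OF this(2)]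
    show ?thesis
      unfolding normal_path_def
      using gallery_path_weq[OF chamber_of(1) uB weq_sym[OF hu], of ?x] ends u(2)
      by (intro homotopic_paths_join) simp_all
  qed
  finally show ?case using hB yc by blast
next
  case (join p q)
  let ?M = faces_union
  let ?x = "pathstart p" and ?y = "pathfinish p" and ?z = "pathfinish q"
  have M: "path_image p \<subseteq> ?M" "path_image q \<subseteq> ?M" using join Union_star_cover by auto
  then have xyz: "?x \<in> ?M" "?y \<in> ?M" "?z \<in> ?M" by auto
  have h: "weq (cocycle.hol (p +++ q)) (cocycle.hol p @ cocycle.hol q)" using cocycle.hol_join join
    by blast
  have yq: "pathstart q = ?y" using join by simp
  have hB: "set (cocycle.hol p @ cocycle.hol q) \<subseteq> B" using join by auto
  have hB': "set (cocycle.hol (p +++ q)) \<subseteq> B" using weq_subset[OF h hB] .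
  have zc: "chamber_of ?z = chamber_of ?x \<circ> wprod (cocycle.hol (p +++ q))"
    unfolding weq_wprod[OF h] using join yq by (auto simp: wprod_append fun_eq_iff)
  let ?a = "linepath ?x (chamber_of ?x rho)" and ?b = "gallery_path (chamber_of ?x) (cocycle.hol p)"
  let ?c = "linepath (chamber_of ?y rho) ?y" and ?d = "gallery_path (chamber_of ?y) (cocycle.hol q)"
  let ?e = "linepath (chamber_of ?z rho) ?z"
  have ims: "path_image ?a \<subseteq> ?M" "path_image ?b \<subseteq> ?M" "path_image ?c \<subseteq> ?M" "path_image ?d \<subseteq> ?M"
    "path_image ?e \<subseteq> ?M"
    "path_image (reversepath ?c) \<subseteq> ?M"
    using to_center[OF xyz(1)] to_center[OF xyz(2)] to_center[OF xyz(3)]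
      gallery_path_in_faces_union[OF chamber_of(1)] hB
    by simp_all
  have ycomp: "chamber_of ?y = chamber_of ?x \<circ> wprod (cocycle.hol p)" using join by blast
  have yc: "chamber_of ?x (wprod (cocycle.hol p) rho) = chamber_of ?y rho"
    and zc': "chamber_of ?y (wprod (cocycle.hol q) rho) = chamber_of ?z rho" using join yq by auto
  \<comment> \<open>The normal form of \<open>q\<close> starts with the reverse of
    \<open>?c\<close>, the last segment of the normal form of \<open>p\<close>. The next homotopies
    reassociate until these two segments are adjacent, cancel them and merge the galleries.\<close>
  have 1: "homotopic_paths ?M (p +++ q) ((?a +++ (?b +++ ?c)) +++ (reversepath ?c +++ (?d +++ ?e)))"
    using join yq unfolding normal_path_def by (intro homotopic_paths_join) auto
  have 2: "homotopic_paths ?M ((?a +++ (?b +++ ?c)) +++ (reversepath ?c +++ (?d +++ ?e)))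
    (?a +++ ((?b +++ ?c) +++ (reversepath ?c +++ (?d +++ ?e))))"
    using ims yc zc'
      by (intro homotopic_paths_sym[OF homotopic_paths_assoc]) (auto simp: path_image_join simp del: reversepath_linepath)
  have 3: "homotopic_paths ?M ((?b +++ ?c) +++ (reversepath ?c +++ (?d +++ ?e)))
    (?b +++ (?c +++ (reversepath ?c +++ (?d +++ ?e))))"
    using ims yc zc'
      by (intro homotopic_paths_sym[OF homotopic_paths_assoc]) (auto simp: path_image_join simp del: reversepath_linepath)
  have 4: "homotopic_paths ?M (?c +++ (reversepath ?c +++ (?d +++ ?e)))
    ((?c +++ reversepath ?c) +++ (?d +++ ?e))"
    using ims yc zc'
      by (intro homotopic_paths_assoc) (auto simp: path_image_join simp del: reversepath_linepath)
  have 5: "homotopic_paths ?M ((?c +++ reversepath ?c) +++ (?d +++ ?e))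
    (linepath (chamber_of ?y rho) (chamber_of ?y rho) +++ (?d +++ ?e))"
    using ims yc zc' homotopic_paths_rinv[of ?c ?M]
    by (intro homotopic_paths_join) (auto simp: path_image_join simp del: reversepath_linepath)
  have 6: "homotopic_paths ?M (linepath (chamber_of ?y rho) (chamber_of ?y rho) +++ (?d +++ ?e))
    (?d +++ ?e)"
    using ims zc' by (intro homotopic_paths_lid') (auto simp: path_image_join)
  have 7: "homotopic_paths ?M (?b +++ (?c +++ (reversepath ?c +++ (?d +++ ?e)))) (?b +++ (?d +++ ?e))"
    by (rule homotopic_paths_join[OF _ homotopic_paths_trans[OF 4 homotopic_paths_trans[OF 5 6]]])
       (use ims yc in simp_all)
  have 8: "homotopic_paths ?M (?b +++ (?d +++ ?e)) ((?b +++ ?d) +++ ?e)"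
    using ims yc zc' by (intro homotopic_paths_assoc) auto
  have 9: "homotopic_paths ?M ((?b +++ ?d) +++ ?e)
    (gallery_path (chamber_of ?x) (cocycle.hol (p +++ q)) +++ ?e)"
  proof (rule homotopic_paths_join)
    have "homotopic_paths ?M (gallery_path (chamber_of ?x) (cocycle.hol p @ cocycle.hol q)) (?b +++ ?d)"
      unfolding ycomp by (rule gallery_path_append[OF gallery_path_in_faces_union[OF chamber_of(1) hB]])
    moreover have "homotopic_paths ?M (gallery_path (chamber_of ?x) (cocycle.hol (p +++ q)))
      (gallery_path (chamber_of ?x) (cocycle.hol p @ cocycle.hol q))"
      using gallery_path_weq[OF chamber_of(1) hB' h] .
    ultimately show "homotopic_paths ?M (?b +++ ?d)
      (gallery_path (chamber_of ?x) (cocycle.hol (p +++ q)))"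
      by (meson homotopic_paths_sym homotopic_paths_trans)
  qed (use ims zc' in auto)
  have 10: "homotopic_paths ?M (?a +++ ((?b +++ ?c) +++ (reversepath ?c +++ (?d +++ ?e))))
    (?a +++ (gallery_path (chamber_of ?x) (cocycle.hol (p +++ q)) +++ ?e))"
    by (rule homotopic_paths_join[OF _ homotopic_paths_trans[OF 3 homotopic_paths_trans[OF 7 homotopic_paths_trans[OF 8 9]]]])
       (use ims yc in simp_all)
  have "normal_path (p +++ q) = ?a +++ (gallery_path (chamber_of ?x) (cocycle.hol (p +++ q)) +++ ?e)"
    by (simp add: normal_path_def)
  then have nf: "homotopic_paths ?M (p +++ q) (normal_path (p +++ q))"
    using homotopic_paths_trans[OF 1 homotopic_paths_trans[OF 2 10]] by simp
  show ?case unfolding pathfinish_join pathstart_join by (intro conjI hB' zc nf)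
next
  case (homotopic p q)
  have ends: "pathstart q = pathstart p" "pathfinish q = pathfinish p"
    using homotopic_paths_imp_pathstart homotopic_paths_imp_pathfinish homotopic by metis+
  have pq: "homotopic_paths faces_union p q" using homotopic Union_star_cover by simp
  have h: "weq (cocycle.hol p) (cocycle.hol q)" using cocycle.hol_homotopic homotopic by blast
  have hB: "set (cocycle.hol q) \<subseteq> B" using weq_subset[OF weq_sym[OF h]] homotopic by blast
  have xy: "pathstart p \<in> faces_union" "pathfinish p \<in> faces_union"
    using homotopic_paths_imp_subset[OF pq] by auto
  have "homotopic_paths faces_union (normal_path p) (normal_path q)"
    unfolding normal_path_def ends
    using gallery_path_weq[OF chamber_of(1) _ h] homotopic to_center[OF xy(1)] to_center[OF xy(2)]
    by (intro homotopic_paths_join) auto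
  moreover have "homotopic_paths faces_union p (normal_path p)"
    "chamber_of (pathfinish p) = chamber_of (pathstart p) \<circ> wprod (cocycle.hol p)"
    using homotopic by blast+
  ultimately show ?case
    unfolding ends using hB weq_wprod[OF h] pq
    by (metis homotopic_paths_sym homotopic_paths_trans)
qed

end

section \<open>Based loops classified by words with trivial product\<close>

context face_types
begin

text \<open>For loops at one point, equivalent words give homotopic galleries and therefore
  homotopic normal forms.\<close>

lemma loops_homotopic_iff:
  assumes "p \<in> loops_at faces_union x" "q \<in> loops_at faces_union x"
  shows "homotopic_paths faces_union p q \<longleftrightarrow> weq (cocycle.hol p) (cocycle.hol q)"
proof
  assume "homotopic_paths faces_union p q"
  then show "weq (cocycle.hol p) (cocycle.hol q)"
    using cocycle.hol_homotopic Union_star_cover by simp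
next
  assume h: "weq (cocycle.hol p) (cocycle.hol q)"
  have p: "path p" "path_image p \<subseteq> faces_union" "pathstart p = x" "pathfinish p = x"
    and q: "path q" "path_image q \<subseteq> faces_union" "pathstart q = x" "pathfinish q = x"
    using assms by (auto simp: loops_at_def)
  have x: "x \<in> faces_union" using p by auto
  have "homotopic_paths faces_union (normal_path p) (normal_path q)"
    unfolding normal_path_def p q
    using gallery_path_weq[OF chamber_of(1) _ h, of x] homotopic_normal_path[OF p(1,2)]
      homotopic_normal_path[OF q(1,2)] weq_wprod[OF h] to_center[OF x] p q
    by (intro homotopic_paths_join) (simp_all add: fun_eq_iff)
  then show "homotopic_paths faces_union p q"
    using homotopic_normal_path[OF p(1,2)] homotopic_normal_path[OF q(1,2)]
    by (meson homotopic_paths_sym homotopic_paths_trans)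
qed

lemma hol_loop:
  assumes "p \<in> loops_at faces_union x"
  shows "set (cocycle.hol p) \<subseteq> B" "wprod (cocycle.hol p) = id"
proof -
  have p: "path p" "path_image p \<subseteq> faces_union" "pathstart p = x" "pathfinish p = x"
    using assms by (auto simp: loops_at_def)
  show "set (cocycle.hol p) \<subseteq> B" using homotopic_normal_path[OF p(1,2)] by blast
  have "chamber_of x \<circ> wprod (cocycle.hol p) = chamber_of x \<circ> id"
    using homotopic_normal_path[OF p(1,2)] p by (simp add: fun_eq_iff)
  then show "wprod (cocycle.hol p) = id" using weyl_comp_cancel[OF chamber_of(1)] by blast
qed

text \<open>The gallery of \<open>u\<close> is conjugated by the segment from \<open>x\<close> to
  the centre of its chamber; that segment stays in one star and contributes a trivial word.\<close>

lemma hol_surj: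
  assumes "x \<in> faces_union" "set u \<subseteq> B" "wprod u = id"
  shows "\<exists>p\<in>loops_at faces_union x. weq (cocycle.hol p) u"
proof -
  let ?w = "chamber_of x" and ?c = "chamber_of x rho"
  let ?p = "linepath x ?c +++ (gallery_path ?w u +++ linepath ?c x)"
  have ims: "path_image (linepath x ?c) \<subseteq> faces_union" "path_image (linepath ?c x) \<subseteq> faces_union"
    "path_image (gallery_path ?w u) \<subseteq> faces_union"
    using to_center[OF assms(1)] gallery_path_in_faces_union[OF chamber_of(1) assms(2)] by simp_all
  have p: "?p \<in> loops_at faces_union x"
    using ims assms(3) by (simp add: loops_at_def path_image_join)
  have star: "star x \<in> star_cover" using assms(1) by (simp add: star_cover_def)
  have trivial: "weq (word_between ?w ?w) []"
    using word_between_weq[OF chamber_of(1), of "[]" x] type_empty by simp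
  have "weq (cocycle.hol (linepath x ?c)) (word_between ?w ?w)"
    using cocycle.hol_local[OF star, of "linepath x ?c"] to_center_in_star[OF center_in_star]
      chamber_of_center[OF chamber_of(1)] by simp
  then have l: "weq (cocycle.hol (linepath x ?c)) []" using trivial weq_trans by blast
  have "weq (cocycle.hol (linepath ?c x)) (word_between ?w ?w)"
    using cocycle.hol_local[OF star, of "linepath ?c x"] to_center_in_star[OF center_in_star]
      chamber_of_center[OF chamber_of(1)] by simp
  then have r: "weq (cocycle.hol (linepath ?c x)) []" using trivial weq_trans by blast
  have "weq (cocycle.hol (gallery_path ?w u +++ linepath ?c x))
    (cocycle.hol (gallery_path ?w u) @ cocycle.hol (linepath ?c x))"
    by (rule cocycle.hol_join) (use ims assms(3) in \<open>simp_all add: Union_star_cover\<close>)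
  also have "weq (cocycle.hol (gallery_path ?w u) @ cocycle.hol (linepath ?c x)) (u @ [])"
    using hol_gallery_path[OF chamber_of(1) assms(2)] r by (rule weq_append)
  finally have gr: "weq (cocycle.hol (gallery_path ?w u +++ linepath ?c x)) (u @ [])" .
  have "weq (cocycle.hol ?p)
    (cocycle.hol (linepath x ?c) @ cocycle.hol (gallery_path ?w u +++ linepath ?c x))"
    by (rule cocycle.hol_join) (use ims assms(3) in \<open>simp_all add: Union_star_cover path_image_join\<close>)
  also have "weq (cocycle.hol (linepath x ?c) @ cocycle.hol (gallery_path ?w u +++ linepath ?c x))
    ([] @ (u @ []))"
    using l gr by (rule weq_append)
  finally show ?thesis using p by auto
qed

end

section \<open>Isomorphisms between groups of equivalence classes\<close>

text \<open>Both quotients are embedded in words modulo \<open>E\<close> by maps with the same image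
  up to \<open>E\<close>. The products are written as in the definitions of the two groups; a
  constant \<open>E\<close> covers the case in which both groups are trivial.\<close>

lemma class_group_iso:
  fixes f :: "'a \<Rightarrow> 'w list" and g :: "'b \<Rightarrow> 'w list"
  assumes E: "\<And>u. E u u" "\<And>u v. E u v \<Longrightarrow> E v u" "\<And>u v w. E u v \<Longrightarrow> E v w \<Longrightarrow> E u w"
      "\<And>u u' v v'. E u u' \<Longrightarrow> E v v' \<Longrightarrow> E (u @ v) (u' @ v')"
    and r: "r = {(a, b). a \<in> A \<and> b \<in> A \<and> E (f a) (f b)}"
    and s: "s = {(a, b). a \<in> C \<and> b \<in> C \<and> E (g a) (g b)}"
    and m: "\<And>a b. a \<in> A \<Longrightarrow> b \<in> A \<Longrightarrow> m a b \<in> A \<and> E (f (m a b)) (f a @ f b)"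
    and n: "\<And>a b. a \<in> C \<Longrightarrow> b \<in> C \<Longrightarrow> n a b \<in> C \<and> E (g (n a b)) (g a @ g b)"
    and fg: "\<And>a. a \<in> A \<Longrightarrow> \<exists>c\<in>C. E (f a) (g c)" and gf: "\<And>c. c \<in> C \<Longrightarrow> \<exists>a\<in>A. E (f a) (g c)"
  shows "\<lparr>carrier = A // r, mult = (\<lambda>X Y. \<Union>a\<in>X. \<Union>b\<in>Y. r `` {m a b}), one = e1\<rparr> \<cong>
    \<lparr>carrier = C // s, mult = (\<lambda>X Y. \<Union>a\<in>X. \<Union>b\<in>Y. s `` {n a b}), one = e2\<rparr>"
proof -
  \<comment> \<open>Quantified over type, carrier and relation, to serve both quotients.\<close>
  have class_eq: "r `` {a} = r `` {b}"
    if "a \<in> A" "b \<in> A" "E (f a) (f b)" "r = {(a, b). a \<in> A \<and> b \<in> A \<and> E (f a) (f b)}"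
    for a b :: 'c and A r and f :: "'c \<Rightarrow> 'w list"
  proof -
    have "E (f a) (f c) \<longleftrightarrow> E (f b) (f c)" for c using E(2,3) that(3) by metis
    then show ?thesis unfolding that(4) using that(1,2) by auto
  qed
  have mult_class: "(\<Union>a\<in>r `` {a0}. \<Union>b\<in>r `` {b0}. r `` {m a b}) = r `` {m a0 b0}"
    if "a0 \<in> A" "b0 \<in> A" "r = {(a, b). a \<in> A \<and> b \<in> A \<and> E (f a) (f b)}"
      "\<And>a b. a \<in> A \<Longrightarrow> b \<in> A \<Longrightarrow> m a b \<in> A \<and> E (f (m a b)) (f a @ f b)"
    for a0 b0 :: 'c and A r m and f :: "'c \<Rightarrow> 'w list"
  proof -
    have same: "r `` {m a b} = r `` {m a0 b0}" if "a \<in> r `` {a0}" "b \<in> r `` {b0}" for a b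
    proof -
      have ab: "a \<in> A" "b \<in> A" "E (f a0) (f a)" "E (f b0) (f b)"
        using that \<open>r = _\<close> by auto
      then have mm: "m a b \<in> A" "m a0 b0 \<in> A" "E (f (m a b)) (f a @ f b)" "E (f (m a0 b0)) (f a0 @ f b0)"
        using \<open>\<And>a b. a \<in> A \<Longrightarrow> b \<in> A \<Longrightarrow> _\<close> \<open>a0 \<in> A\<close> \<open>b0 \<in> A\<close> by blast+
      have "E (f (m a0 b0)) (f (m a b))"
        using E(3)[OF mm(4) E(3)[OF E(4)[OF ab(3,4)] E(2)[OF mm(3)]]] .
      then show ?thesis using class_eq[OF mm(2,1) _ \<open>r = _\<close>] by simp
    qed
    have "a0 \<in> r `` {a0}" "b0 \<in> r `` {b0}" using that E(1) by auto
    then show ?thesis using same by blast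
  qed
  \<comment> \<open>A union over all representatives, which makes the map independent of a choice by
    construction.\<close>
  define F where "F X = (\<Union>a\<in>X. {c\<in>C. E (f a) (g c)})" for X
  have F_class: "F (r `` {a}) = s `` {c}" if "a \<in> A" "c \<in> C" "E (f a) (g c)" for a c
  proof -
    have "E (f b) (g d) \<longleftrightarrow> E (g c) (g d)" if "E (f a) (f b)" for b d
      using E(2,3) that \<open>E (f a) (g c)\<close> by metis
    then show ?thesis unfolding F_def r s using that E(1) by auto
  qed
  have F_ex: "\<exists>c\<in>C. E (f a) (g c) \<and> F (r `` {a}) = s `` {c}" if "a \<in> A" for a
    using fg[OF that] F_class[OF that] by blast
  have F_img: "F X \<in> C // s" if "X \<in> A // r" for X
    using that F_ex unfolding quotient_def by blast
  have inj: "X = Y" if XY: "X \<in> A // r" "Y \<in> A // r" "F X = F Y" for X Y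
  proof -
    obtain a b where ab: "a \<in> A" "b \<in> A" "X = r `` {a}" "Y = r `` {b}" using XY
      by (auto simp: quotient_def)
    obtain c where c: "c \<in> C" "E (f a) (g c)" "F X = s `` {c}" using F_ex ab by blast
    obtain d where d: "d \<in> C" "E (f b) (g d)" "F Y = s `` {d}" using F_ex ab by blast
    have "d \<in> s `` {c}" using c d XY(3) s E(1) by auto
    then have "E (g c) (g d)" using s by auto
    then have "E (f a) (f b)" using E(3)[OF c(2) E(3)[OF _ E(2)[OF d(2)]]] by blast
    then show ?thesis unfolding ab(3,4) using class_eq[OF ab(1,2) _ r] by simp
  qed
  have surj: "Z \<in> F ` (A // r)" if Z: "Z \<in> C // s" for Z
  proof -
    obtain c where c: "c \<in> C" "Z = s `` {c}" using Z by (auto simp: quotient_def)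
    obtain a where "a \<in> A" "E (f a) (g c)" using gf c by blast
    then show ?thesis using F_class c by (auto simp: quotient_def)
  qed
  have hom: "F (\<Union>a\<in>X. \<Union>b\<in>Y. r `` {m a b}) = (\<Union>a\<in>F X. \<Union>b\<in>F Y. s `` {n a b})"
    if XY: "X \<in> A // r" "Y \<in> A // r" for X Y
  proof -
    obtain a b where ab: "a \<in> A" "b \<in> A" "X = r `` {a}" "Y = r `` {b}" using XY
      by (auto simp: quotient_def)
    obtain c where c: "c \<in> C" "E (f a) (g c)" "F X = s `` {c}" using F_ex ab by blast
    obtain d where d: "d \<in> C" "E (f b) (g d)" "F Y = s `` {d}" using F_ex ab by blast
    have mab: "m a b \<in> A" "E (f (m a b)) (f a @ f b)" using m ab by auto
    have ncd: "n c d \<in> C" "E (g (n c d)) (g c @ g d)" using n c d by auto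
    have "E (f (m a b)) (g (n c d))"
      using E(3)[OF mab(2) E(3)[OF E(4)[OF c(2) d(2)] E(2)[OF ncd(2)]]] .
    then have "F (r `` {m a b}) = s `` {n c d}" using F_class mab ncd by blast
    then show ?thesis
      unfolding ab(3,4) c(3)[unfolded ab(3)] d(3)[unfolded ab(4)]
      using mult_class[OF ab(1,2) r m] mult_class[OF c(1) d(1) s n] by simp
  qed
  have bij: "bij_betw F (A // r) (C // s)"
  proof (rule bij_betw_imageI)
    show "inj_on F (A // r)" by (rule inj_onI) (rule inj)
    show "F ` (A // r) = C // s"
    proof
      show "F ` (A // r) \<subseteq> C // s" by (rule image_subsetI) (rule F_img)
      show "C // s \<subseteq> F ` (A // r)" by (rule subsetI) (rule surj)
    qed
  qed
  show ?thesis
    unfolding is_iso_def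
  proof (rule ex_in_conv[THEN iffD1, OF exI[of _ F]])
    show "F \<in> iso \<lparr>carrier = A // r, mult = (\<lambda>X Y. \<Union>a\<in>X. \<Union>b\<in>Y. r `` {m a b}), one = e1\<rparr>
      \<lparr>carrier = C // s, mult = (\<lambda>X Y. \<Union>a\<in>X. \<Union>b\<in>Y. s `` {n a b}), one = e2\<rparr>"
      by (rule isoI) (use bij in \<open>simp_all add: hom_def Pi_def F_img hom\<close>)
  qed
qed

section \<open>Local moves in discrete homotopy\<close>

lemma q_near_sym: "q_near q \<sigma> \<tau> \<Longrightarrow> q_near q \<tau> \<sigma>"
  by (simp add: q_near_def Int_commute)

locale finite_complex =
  fixes q :: nat and \<Delta> :: "'v set set" and \<sigma>\<^sub>0 :: "'v set"
  assumes finite_simplex: "\<sigma> \<in> \<Delta> \<Longrightarrow> finite \<sigma>"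
begin

abbreviation "loops \<equiv> q_loops q \<Delta> \<sigma>\<^sub>0"
abbreviation "dhr \<equiv> discrete_homotopy_rel q \<Delta> \<sigma>\<^sub>0"

text \<open>Finiteness enters because \<open>card\<close> of an infinite set is 0, which would make
  an infinite simplex far from itself.\<close>

lemma q_near_refl: "q_near q \<sigma> \<tau> \<Longrightarrow> \<sigma> \<in> \<Delta> \<Longrightarrow> q_near q \<sigma> \<sigma>"
  unfolding q_near_def using finite_simplex card_mono[of \<sigma> "\<sigma> \<inter> \<tau>"] by fastforce

lemma dhr_refl: "l \<in> loops \<Longrightarrow> (l, l) \<in> dhr"
  by (simp add: discrete_homotopy_rel_def)

lemma dhr_sym: "(l, l') \<in> dhr \<Longrightarrow> (l', l) \<in> dhr"
  by (auto simp: discrete_homotopy_rel_def intro: equivclp_sym)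

lemma dhr_trans: "(l, l') \<in> dhr \<Longrightarrow> (l', l'') \<in> dhr \<Longrightarrow> (l, l'') \<in> dhr"
  by (auto simp: discrete_homotopy_rel_def intro: equivclp_trans)

lemma dhr_loops: "(l, l') \<in> dhr \<Longrightarrow> l \<in> loops \<and> l' \<in> loops"
  by (simp add: discrete_homotopy_rel_def)

text \<open>A grid with many rows is reduced to pairs of consecutive rows, so invariants are checked
  on a single strip.\<close>

lemma dhr_induct [consumes 1, case_names refl sym trans stretch grid]:
  assumes "(l, l') \<in> dhr"
    and refl: "\<And>l. P l l" and sym: "\<And>l l'. P l l' \<Longrightarrow> P l' l" and trans:
      "\<And>l l' l''. P l l' \<Longrightarrow> P l' l'' \<Longrightarrow> P l l''"
    and stretch: "\<And>l l'. l \<in> loops \<Longrightarrow> l' \<in> loops \<Longrightarrow> stretching l l' \<Longrightarrow> P l l'"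
    and grid: "\<And>l l'. l \<in> loops \<Longrightarrow> l' \<in> loops \<Longrightarrow> list_all2 (q_near q) l l' \<Longrightarrow> P l l'"
  shows "P l l'"
proof -
  have rows: "P (hd rows) (last rows)"
    if "rows \<noteq> []" "set rows \<subseteq> loops" "successively (list_all2 (q_near q)) rows" for rows
    using that
  proof (induction rows rule: induct_list012)
    case (3 x y zs)
    then have "P x y" using grid by auto
    moreover have "P (hd (y # zs)) (last (y # zs))" using 3 by auto
    ultimately show ?case using trans[of x y] by simp
  qed (auto intro: refl)
  let ?R = "\<lambda>a b. a \<in> loops \<and> b \<in> loops \<and> (stretching a b \<or> homotopy_grid q \<Delta> \<sigma>\<^sub>0 a b)"
  have step: "P a b" if "?R a b" for a b
    using that stretch rows unfolding homotopy_grid_def by blast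
  have "equivclp ?R l l'" using assms(1) by (simp add: discrete_homotopy_rel_def)
  then show ?thesis
  proof (induction rule: equivclp_induct)
    case base
    then show ?case by (rule refl)
  next
    case (step y z)
    then have "P y z" using \<open>\<And>a b. ?R a b \<Longrightarrow> P a b\<close> sym by blast
    with step.IH show ?case by (rule trans)
  qed
qed

lemma dhr_stretch: "l \<in> loops \<Longrightarrow> l' \<in> loops \<Longrightarrow> stretching l l' \<Longrightarrow> (l, l') \<in> dhr"
  by (auto simp: discrete_homotopy_rel_def)

lemma dhr_grid:
  assumes "l \<in> loops" "l' \<in> loops" "list_all2 (q_near q) l l'"
  shows "(l, l') \<in> dhr"
proof -
  have "homotopy_grid q \<Delta> \<sigma>\<^sub>0 l l'"
    unfolding homotopy_grid_def using assms list_all2_lengthD[OF assms(3)]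
    by (intro exI[of _ "[l, l']"]) auto
  then show ?thesis using assms by (auto simp: discrete_homotopy_rel_def)
qed

text \<open>Nearness to a neighbour forces self-nearness. A loop of length one has no neighbour,
  whence the length condition.\<close>

lemma loop_q_near_refl:
  assumes "l \<in> loops" "2 \<le> length l" "\<sigma> \<in> set l"
  shows "q_near q \<sigma> \<sigma>"
proof -
  obtain xs ys where l: "l = xs @ \<sigma> # ys" using assms(3) by (metis split_list)
  have s: "successively (q_near q) (xs @ \<sigma> # ys)" "\<sigma> \<in> \<Delta>" using assms l by (auto simp: q_loops_def)
  have "\<exists>\<tau>. q_near q \<sigma> \<tau>"
  proof (cases ys)
    case Nil
    then have "xs \<noteq> []" using assms(2) l by auto
    then have "q_near q (last xs) \<sigma>" using s by (simp add: successively_append_iff)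
    then show ?thesis using q_near_sym by blast
  next
    case (Cons \<tau> zs)
    then show ?thesis using s by (auto simp: successively_append_iff)
  qed
  then show ?thesis using q_near_refl s(2) by blast
qed

section \<open>Exchanging subchains inside loops\<close>

definition chain :: "'v set list \<Rightarrow> bool" where
  "chain l \<longleftrightarrow> l \<noteq> [] \<and> set l \<subseteq> \<Delta> \<and> successively (q_near q) l"

lemma loops_replace:
  assumes "chain l" "chain l'" "hd l = hd l'" "last l = last l'" "xs @ l @ ys \<in> loops"
  shows "xs @ l' @ ys \<in> loops"
  using assms unfolding q_loops_def chain_def
  by (auto simp: successively_append_iff hd_append last_append split: if_splits)

text \<open>\<open>lh\<close> is local homotopy: the two chains may be exchanged inside every loop.\<close>

definition lh :: "'v set list \<Rightarrow> 'v set list \<Rightarrow> bool" where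
  "lh l l' \<longleftrightarrow> chain l \<and> chain l' \<and> hd l = hd l' \<and> last l = last l' \<and>
     (\<forall>xs ys. xs @ l @ ys \<in> loops \<longrightarrow> (xs @ l @ ys, xs @ l' @ ys) \<in> dhr)"

lemma lh_refl: "chain l \<Longrightarrow> lh l l"
  by (auto simp: lh_def dhr_refl)

lemma lh_sym: assumes "lh l l'" shows "lh l' l"
  unfolding lh_def
proof (intro conjI allI impI)
  fix xs ys assume "xs @ l' @ ys \<in> loops"
  then have "xs @ l @ ys \<in> loops" using loops_replace[of l' l] assms by (simp add: lh_def)
  then show "(xs @ l' @ ys, xs @ l @ ys) \<in> dhr" using assms dhr_sym by (simp add: lh_def)
qed (use assms in \<open>auto simp: lh_def\<close>)

lemma lh_trans [trans]: assumes "lh l l'" "lh l' l''" shows "lh l l''"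
  unfolding lh_def
proof (intro conjI allI impI)
  fix xs ys assume "xs @ l @ ys \<in> loops"
  then have 1: "(xs @ l @ ys, xs @ l' @ ys) \<in> dhr" using assms(1) by (simp add: lh_def)
  then have "xs @ l' @ ys \<in> loops" using dhr_loops by blast
  then have "(xs @ l' @ ys, xs @ l'' @ ys) \<in> dhr" using assms(2) by (simp add: lh_def)
  then show "(xs @ l @ ys, xs @ l'' @ ys) \<in> dhr" using 1 dhr_trans by blast
qed (use assms in \<open>auto simp: lh_def\<close>)

lemma lh_context:
  assumes "lh l l'" "chain (a @ l @ b)"
  shows "lh (a @ l @ b) (a @ l' @ b)"
  unfolding lh_def
proof (intro conjI allI impI)
  have c: "chain l" "chain l'" "hd l = hd l'" "last l = last l'" using assms(1) by (auto simp: lh_def)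
  then have ne: "l \<noteq> []" "l' \<noteq> []" by (auto simp: chain_def)
  show "chain (a @ l' @ b)"
    using assms(2) c ne unfolding chain_def by (auto simp: successively_append_iff)
  show "hd (a @ l @ b) = hd (a @ l' @ b)" "last (a @ l @ b) = last (a @ l' @ b)"
    using c ne by (auto simp: hd_append last_append)
  fix xs ys assume "xs @ (a @ l @ b) @ ys \<in> loops"
  then have "(xs @ a) @ l @ (b @ ys) \<in> loops" by simp
  then have "((xs @ a) @ l @ (b @ ys), (xs @ a) @ l' @ (b @ ys)) \<in> dhr" using assms(1) unfolding lh_def
    by blast
  then show "(xs @ (a @ l @ b) @ ys, xs @ (a @ l' @ b) @ ys) \<in> dhr" by simp
qed (use assms in auto)

lemma lh_grid:
  assumes "chain l" "chain l'" "hd l = hd l'" "last l = last l'" "list_all2 (q_near q) l l'"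
  shows "lh l l'"
  unfolding lh_def
proof (intro conjI allI impI)
  fix xs ys assume L: "xs @ l @ ys \<in> loops"
  then have L': "xs @ l' @ ys \<in> loops" using loops_replace assms by blast
  have len: "length l = length l'" using assms(5) list_all2_lengthD by blast
  show "(xs @ l @ ys, xs @ l' @ ys) \<in> dhr"
  \<comment> \<open>The context is carried along by identity columns, which need self-nearness; a
    loop of length one has empty context and is unchanged.\<close>
  proof (cases "2 \<le> length (xs @ l @ ys)")
    case True
    then have "list_all2 (q_near q) xs xs" "list_all2 (q_near q) ys ys"
      using loop_q_near_refl[OF L True] by (auto intro!: list.rel_refl_strong)
    then show ?thesis using L L' assms(5) by (intro dhr_grid list_all2_appendI)
  next
    case False
    moreover have "0 < length l" using assms(1) by (simp add: chain_def)
    ultimately have "length xs = 0" "length ys = 0" "length l = 1" unfolding length_append by linarith+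
    then obtain a b where "xs = []" "ys = []" "l = [a]" "l' = [b]"
      using len by (metis One_nat_def length_0_conv length_Suc_conv)
    then show ?thesis using assms(3) L dhr_refl by simp
  qed
qed (use assms in auto)

lemma lh_stretch:
  assumes "a \<in> \<Delta>" "q_near q a a"
  shows "lh [a] [a, a]"
  unfolding lh_def
proof (intro conjI allI impI)
  show c: "chain [a]" "chain [a, a]" using assms by (auto simp: chain_def)
  fix xs ys assume "xs @ [a] @ ys \<in> loops"
  then show "(xs @ [a] @ ys, xs @ [a, a] @ ys) \<in> dhr"
    using loops_replace[OF c] by (intro dhr_stretch) (auto simp: stretching_def)
qed auto

text \<open>Repeating \<open>c\<close> gives equal lengths, and the columns of
  \<open>[a, b, c]\<close> over \<open>[a, c, c]\<close> are near.\<close>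

lemma lh_triangle:
  assumes "{a, b, c} \<subseteq> \<Delta>" "q_near q a b" "q_near q b c" "q_near q a c"
  shows "lh [a, b, c] [a, c]"
proof -
  have near: "q_near q a a" "q_near q c c" using q_near_refl q_near_sym assms by blast+
  have "lh [a, b, c] [a, c, c]"
    by (rule lh_grid) (use assms near in \<open>auto simp: chain_def\<close>)
  also have "lh [a, c, c] [a, c]"
    using lh_context[OF lh_sym[OF lh_stretch[of c]], of "[a]" "[]"] assms near by (auto simp: chain_def)
  finally show ?thesis .
qed

lemma lh_backtrack:
  assumes "{a, b} \<subseteq> \<Delta>" "q_near q a b"
  shows "lh [a, b, a] [a]"
proof -
  have near: "q_near q a a" "q_near q b a" using q_near_refl q_near_sym assms by blast+
  then have "lh [a, b, a] [a, a]" using lh_triangle[of a b a] assms by auto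
  also have "lh [a, a] [a]" using lh_sym[OF lh_stretch] near assms by auto
  finally show ?thesis .
qed

lemma lh_square:
  assumes "{a, b, c, d} \<subseteq> \<Delta>" "q_near q a b" "q_near q b c" "q_near q a d" "q_near q d c"
  shows "lh [a, b, c] [a, d, c]"
proof -
  have near: "q_near q a a" "q_near q c c" "q_near q b a" "q_near q c d"
    using q_near_refl q_near_sym assms by blast+
  have "lh [a, b, c] [a, b, c, c]"
    using lh_context[OF lh_stretch[of c], of "[a, b]" "[]"] assms near by (auto simp: chain_def)
  \<comment> \<open>Stretching at opposite ends shifts the rows, so the columns are sides of the
    square or repetitions and its diagonals never occur.\<close>
  also have "lh [a, b, c, c] [a, a, d, c]"
    by (rule lh_grid) (use assms near in \<open>auto simp: chain_def\<close>)
  also have "lh [a, a, d, c] [a, d, c]"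
    using lh_context[OF lh_sym[OF lh_stretch[of a]], of "[]" "[d, c]"] assms near
      by (auto simp: chain_def)
  finally show ?thesis .
qed

text \<open>A clique is contracted by a fan of triangles at its first vertex.\<close>

lemma lh_clique:
  assumes "l \<noteq> []" "set l \<subseteq> \<Delta>" "\<And>a b. a \<in> set l \<Longrightarrow> b \<in> set l \<Longrightarrow> q_near q a b"
  shows "chain l \<and> lh l [hd l, last l]"
  using assms
proof (induction l rule: induct_list012)
  case (2 a)
  then show ?case using lh_stretch by (auto simp: chain_def)
next
  case (3 a b l)
  then have IH: "chain (b # l)" "lh (b # l) [b, last (b # l)]" by auto
  let ?c = "last (b # l)"
  have c: "?c \<in> set (b # l)" by (rule last_in_set) simp
  have ch: "chain (a # b # l)" using IH(1) 3 by (auto simp: chain_def)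
  have "lh ([a] @ (b # l) @ []) ([a] @ [b, ?c] @ [])" by (rule lh_context[OF IH(2)]) (use ch in simp)
  also have "lh ([a] @ [b, ?c] @ []) [a, ?c]"
    using lh_triangle[of a b ?c] 3 c by auto
  finally show ?case using ch by simp
qed simp

end

lemma q_loops_append:
  assumes "a \<in> q_loops q \<Delta> \<sigma>" "b \<in> q_loops q \<Delta> \<sigma>" "q_near q \<sigma> \<sigma>"
  shows "a @ b \<in> q_loops q \<Delta> \<sigma>"
  using assms by (auto simp: q_loops_def successively_append_iff)

section \<open>Galleries in the Coxeter complex\<close>

context finite_simple_roots
begin

section \<open>Vertices and chambers of the Coxeter complex\<close>

abbreviation "complex \<equiv> coxeter_complex weyl (reflection ` B)"

definition vertex :: "('a \<Rightarrow> 'a) \<Rightarrow> 'a \<Rightarrow> ('a \<Rightarrow> 'a) set" where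
  "vertex w \<alpha> = w <#\<^bsub>orthogonal_group\<^esub> generate orthogonal_group (reflection ` B - {reflection \<alpha>})"

lemma vertex_eq:
  assumes "\<alpha> \<in> B"
  shows "vertex w \<alpha> = {w \<circ> wprod u | u. set u \<subseteq> B - {\<alpha>}}"
proof -
  have eq: "reflection ` B - {reflection \<alpha>} = reflection ` (B - {\<alpha>})"
    using inj_on_image_set_diff[OF reflection_inj_on_independent[OF independent_B], of B "{\<alpha>}"] assms
      by auto
  have mult: "x \<otimes>\<^bsub>orthogonal_group\<^esub> y = x \<circ> y" for x y :: "'a \<Rightarrow> 'a"
    by (simp add: orthogonal_group_def)
  show ?thesis unfolding vertex_def eq generate_reflections l_coset_def mult by blast
qed

lemma wprod_coweight: "set u \<subseteq> B - {\<alpha>} \<Longrightarrow> wprod u (coweight \<alpha>) = coweight \<alpha>"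
  by (rule wprod_fixes) (auto simp: coweight_inner subset_iff)

lemma reflection_coweight:
  assumes "\<alpha> \<in> B" shows "reflection \<alpha> (coweight \<alpha>) \<noteq> coweight \<alpha>"
  using assms coweight_inner[OF assms, of \<alpha>] root_nonzero B_subset by (subst reflection_fixes_iff) auto

text \<open>A vertex is the coset of the stabilizer of a coweight, so it is encoded by its type and
  the image of that coweight.\<close>

lemma vertex_eq_iff:
  assumes "w \<in> weyl" "v \<in> weyl" "\<alpha> \<in> B" "\<beta> \<in> B"
  shows "vertex w \<alpha> = vertex v \<beta> \<longleftrightarrow> \<alpha> = \<beta> \<and> w (coweight \<alpha>) = v (coweight \<alpha>)"
proof
  assume eq: "vertex w \<alpha> = vertex v \<beta>"
  have mem: "\<exists>u'. set u' \<subseteq> B - {\<alpha>} \<and> v \<circ> wprod u = w \<circ> wprod u'" if u: "set u \<subseteq> B - {\<beta>}" for u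
  proof -
    have "v \<circ> wprod u \<in> vertex w \<alpha>" unfolding eq vertex_eq[OF assms(4)] using u by blast
    then show ?thesis unfolding vertex_eq[OF assms(3)] by blast
  qed
  have fix1: "v (wprod u (coweight \<alpha>)) = w (coweight \<alpha>)" if u: "set u \<subseteq> B - {\<beta>}" for u
  proof -
    obtain u' where u': "set u' \<subseteq> B - {\<alpha>}" "v \<circ> wprod u = w \<circ> wprod u'" using mem[OF u] by blast
    have "(v \<circ> wprod u) (coweight \<alpha>) = (w \<circ> wprod u') (coweight \<alpha>)" using u'(2) by simp
    then show ?thesis using wprod_coweight[OF u'(1)] by simp
  qed
  have wv: "v (coweight \<alpha>) = w (coweight \<alpha>)" using fix1[of "[]"] by simp
  \<comment> \<open>If the types differed, the coset of type \<beta> would also contain v followed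
    on the right by the reflection in \<alpha>, which moves the coweight of \<alpha>.\<close>
  have "\<alpha> = \<beta>"
  proof (rule ccontr)
    assume "\<alpha> \<noteq> \<beta>"
    then have "v (reflection \<alpha> (coweight \<alpha>)) = v (coweight \<alpha>)" using fix1[of "[\<alpha>]"] assms wv by simp
    then have "reflection \<alpha> (coweight \<alpha>) = coweight \<alpha>"
      using orthogonal_transformation_inj[OF orthogonal_weyl[OF assms(2)]] by (simp add: inj_eq)
    then show False using reflection_coweight assms by blast
  qed
  then show "\<alpha> = \<beta> \<and> w (coweight \<alpha>) = v (coweight \<alpha>)" using wv by simp
next
  assume "\<alpha> = \<beta> \<and> w (coweight \<alpha>) = v (coweight \<alpha>)"
  then have eq: "\<alpha> = \<beta>" "w (coweight \<alpha>) = v (coweight \<alpha>)" by auto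
  have sub: "vertex v \<alpha> \<subseteq> vertex w \<alpha>" if vw: "w \<in> weyl" "v \<in> weyl" "w (coweight \<alpha>) = v (coweight \<alpha>)"
    for v w
  proof -
    \<comment> \<open>The image of the coweight is a point common to both chambers whose face has
      type \<open>B - {\<alpha>}\<close>, so the chambers differ by a word avoiding
      \<alpha>.\<close>
    have walls: "walls w (w (coweight \<alpha>)) = B - {\<alpha>}"
      using weyl_inner[OF vw(1)] coweight_inner by (auto simp: walls_def split: if_splits)
    have "in_chamber w (w (coweight \<alpha>))" "in_chamber v (w (coweight \<alpha>))"
      using weyl_inner[OF vw(1)] weyl_inner[OF vw(2)] coweight_inner
      by (auto simp: in_chamber_def) (simp add: vw(3) coweight_inner)
    then obtain u where u: "set u \<subseteq> B - {\<alpha>}" "v = w \<circ> wprod u"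
      using chambers_through_point[OF vw(1,2)] walls by metis
    show ?thesis
    proof
      fix g assume "g \<in> vertex v \<alpha>"
      then obtain u' where u': "set u' \<subseteq> B - {\<alpha>}" "g = v \<circ> wprod u'" unfolding vertex_eq[OF assms(3)]
        by blast
      then have "g = w \<circ> wprod (u @ u')" "set (u @ u') \<subseteq> B - {\<alpha>}"
        using u by (auto simp: wprod_append comp_assoc)
      then show "g \<in> vertex w \<alpha>" unfolding vertex_eq[OF assms(3)] by blast
    qed
  qed
  show "vertex w \<alpha> = vertex v \<beta>"
    using sub[OF assms(1,2) eq(2)] sub[OF assms(2,1) eq(2)[symmetric]] eq(1) by blast
qed

definition cham :: "('a \<Rightarrow> 'a) \<Rightarrow> ('a \<Rightarrow> 'a) set set" where
  "cham w = vertex w ` B"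

lemma complex_eq: "complex = {vertex w ` J | w J. w \<in> weyl \<and> J \<subseteq> B}"
proof (intro equalityI subsetI)
  fix \<sigma> assume "\<sigma> \<in> complex"
  then obtain w J where wJ: "w \<in> weyl" "J \<subseteq> reflection ` B"
    "\<sigma> = (\<lambda>s. w <#\<^bsub>orthogonal_group\<^esub> generate orthogonal_group (reflection ` B - {s})) ` J"
    unfolding coxeter_complex_def by blast
  then obtain K where "K \<subseteq> B" "J = reflection ` K" by (meson subset_imageE)
  then have "\<sigma> = vertex w ` K" using wJ by (auto simp: vertex_def)
  then show "\<sigma> \<in> {vertex w ` J | w J. w \<in> weyl \<and> J \<subseteq> B}" using wJ \<open>K \<subseteq> B\<close> by blast
next
  fix \<sigma> assume "\<sigma> \<in> {vertex w ` J | w J. w \<in> weyl \<and> J \<subseteq> B}"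
  then obtain w J where wJ: "w \<in> weyl" "J \<subseteq> B" "\<sigma> = vertex w ` J" by blast
  then have "\<sigma> = (\<lambda>s. w <#\<^bsub>orthogonal_group\<^esub> generate orthogonal_group (reflection ` B - {s})) `
    (reflection ` J)"
    by (auto simp: vertex_def)
  moreover have "reflection ` J \<subseteq> reflection ` B" using wJ by blast
  ultimately show "\<sigma> \<in> complex" unfolding coxeter_complex_def using wJ by blast
qed

lemma cham_in_complex: "w \<in> weyl \<Longrightarrow> cham w \<in> complex"
  unfolding complex_eq cham_def by blast

lemma complex_subset_cham: "\<sigma> \<in> complex \<Longrightarrow> \<exists>w\<in>weyl. \<sigma> \<subseteq> cham w"
  unfolding complex_eq cham_def by blast

lemma finite_complex_simplex: "\<sigma> \<in> complex \<Longrightarrow> finite \<sigma>"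
  unfolding complex_eq using finite_B finite_subset by blast

lemma maximal_simplex_cham: assumes "maximal_simplex complex \<sigma>" shows "\<exists>w\<in>weyl. \<sigma> = cham w"
proof -
  have "\<sigma> \<in> complex" "\<And>\<tau>. \<tau> \<in> complex \<Longrightarrow> \<sigma> \<subseteq> \<tau> \<Longrightarrow> \<tau> = \<sigma>" using assms by (auto simp: maximal_simplex_def)
  then show ?thesis using complex_subset_cham cham_in_complex by metis
qed

lemma card_cham_Int:
  assumes "w \<in> weyl" "v \<in> weyl"
  shows "card (cham w \<inter> cham v) = card {\<alpha>\<in>B. w (coweight \<alpha>) = v (coweight \<alpha>)}"
proof -
  have "cham w \<inter> cham v = vertex w ` {\<alpha>\<in>B. w (coweight \<alpha>) = v (coweight \<alpha>)}"
    unfolding cham_def using vertex_eq_iff[OF assms] by (auto simp: image_iff)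
  moreover have "inj_on (vertex w) B" using vertex_eq_iff[OF assms(1,1)] by (auto intro!: inj_onI)
  ultimately show ?thesis by (metis (no_types, lifting) card_image inj_on_subset mem_Collect_eq subsetI)
qed

lemma cham_inj: assumes "w \<in> weyl" "v \<in> weyl" "cham w \<subseteq> cham v" shows "w = v"
proof (rule weyl_eqI[OF assms(1,2)])
  fix \<alpha> assume "\<alpha> \<in> B"
  then obtain \<beta> where "\<beta> \<in> B" "vertex w \<alpha> = vertex v \<beta>" using assms(3) unfolding cham_def by blast
  then show "w (coweight \<alpha>) = v (coweight \<alpha>)" using vertex_eq_iff[OF assms(1,2)] \<open>\<alpha> \<in> B\<close> by blast
qed

definition near :: "nat \<Rightarrow> ('a \<Rightarrow> 'a) \<Rightarrow> ('a \<Rightarrow> 'a) \<Rightarrow> bool" where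
  "near m w v \<longleftrightarrow> (\<exists>u. set u \<subseteq> B \<and> card (set u) \<le> m \<and> v = w \<circ> wprod u)"

text \<open>Shared vertices are coweights with equal images. At least q + 1 of them remain common
  exactly when at most m types change.\<close>

lemma q_near_cham:
  assumes "w \<in> weyl" "v \<in> weyl" "q + 1 + m = card B"
  shows "q_near q (cham w) (cham v) \<longleftrightarrow> near m w v"
proof -
  let ?K = "{\<alpha>\<in>B. w (coweight \<alpha>) = v (coweight \<alpha>)}"
  have K: "finite ?K" "card ?K \<le> card B" "card (B - ?K) = card B - card ?K"
    using finite_B by (auto intro: card_mono simp: card_Diff_subset)
  have "q_near q (cham w) (cham v) \<longleftrightarrow> card (B - ?K) \<le> m"
    unfolding q_near_def card_cham_Int[OF assms(1,2)] using K assms(3) by linarith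
  also have "\<dots> \<longleftrightarrow> near m w v"
  proof
    assume c: "card (B - ?K) \<le> m"
    \<comment> \<open>A point in the open common face: its walls are precisely the types of the
      vertices not shared.\<close>
    let ?x = "\<Sum>\<alpha>\<in>?K. coweight \<alpha>"
    have "w ?x = v ?x"
      using linear_sum[OF linear_weyl[OF assms(1)], of coweight ?K] linear_sum[OF linear_weyl[OF assms(2)], of coweight ?K]
      by simp
    moreover have ch: "in_chamber u (u ?x)" "walls u (u ?x) = B - ?K" if "u \<in> weyl" for u
      using weyl_inner[OF that] sum_coweight_inner[of ?K]
        by (auto simp: in_chamber_def walls_def split: if_splits)
    ultimately have "in_chamber v (w ?x)" using assms(2) by simp
    from chambers_through_point[OF assms(1,2) ch(1)[OF assms(1)] this]
    obtain u where "set u \<subseteq> B - ?K" "v = w \<circ> wprod u" unfolding ch(2)[OF assms(1)] by blast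
    moreover have "card (set u) \<le> card (B - ?K)"
      using \<open>set u \<subseteq> B - ?K\<close> finite_B by (intro card_mono) auto
    ultimately show "near m w v" unfolding near_def using c by (intro exI[of _ u]) auto
  next
    assume "near m w v"
    then obtain u where u: "set u \<subseteq> B" "card (set u) \<le> m" "v = w \<circ> wprod u" by (auto simp: near_def)
    have "B - ?K \<subseteq> set u"
    proof
      fix \<alpha> assume "\<alpha> \<in> B - ?K"
      then have "wprod u (coweight \<alpha>) \<noteq> coweight \<alpha>" "\<alpha> \<in> B" using u(3) by auto
      then show "\<alpha> \<in> set u" using wprod_coweight[of u \<alpha>] u(1) by blast
    qed
    then have "card (B - ?K) \<le> card (set u)" by (intro card_mono) auto
    then show "card (B - ?K) \<le> m" using u(2) by simp
  qed
  finally show ?thesis .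
qed

lemma near_refl: "near m w w"
  unfolding near_def by (intro exI[of _ "[]"]) auto

text \<open>The list contains both end chambers, so it is one longer than the word; concatenation
  must drop one copy of the chamber at the junction.\<close>

fun gal :: "('a \<Rightarrow> 'a) \<Rightarrow> 'a list \<Rightarrow> ('a \<Rightarrow> 'a) list" where
  "gal w [] = [w]"
| "gal w (\<alpha> # u) = w # gal (w \<circ> reflection \<alpha>) u"

lemma gal_not_Nil [simp]: "gal w u \<noteq> []"
  by (cases u) auto

lemma hd_gal [simp]: "hd (gal w u) = w"
  by (cases u) auto

lemma last_gal: "last (gal w u) = w \<circ> wprod u"
  by (induction u arbitrary: w) (auto simp: comp_assoc simp del: o_apply)

lemma gal_append: "gal w (a @ b) = gal w a @ tl (gal (w \<circ> wprod a) b)"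
proof (induction a arbitrary: w)
  case Nil
  show ?case by (cases b) auto
next
  case (Cons \<alpha> a)
  show ?case using Cons[of "w \<circ> reflection \<alpha>"]
    by (simp only: gal.simps append_Cons wprod.simps comp_assoc)
qed

lemma gal_append': "gal w (a @ b) = butlast (gal w a) @ gal (w \<circ> wprod a) b"
proof -
  have "gal w a = butlast (gal w a) @ [w \<circ> wprod a]"
    using append_butlast_last_id[OF gal_not_Nil, of w a] last_gal by simp
  moreover have "gal (w \<circ> wprod a) b = (w \<circ> wprod a) # tl (gal (w \<circ> wprod a) b)"
    using list.collapse[OF gal_not_Nil, of "w \<circ> wprod a" b] by simp
  ultimately show ?thesis unfolding gal_append by (metis append.assoc append_Cons append_Nil)
qed

lemma set_gal: "g \<in> set (gal w u) \<Longrightarrow> \<exists>v. set v \<subseteq> set u \<and> g = w \<circ> wprod v"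
proof (induction u arbitrary: w)
  case Nil
  then show ?case by (auto intro!: exI[of _ "[]"])
next
  case (Cons \<alpha> u)
  show ?case
  proof (cases "g = w")
    case True
    then show ?thesis by (intro exI[of _ "[]"]) auto
  next
    case False
    then have "g \<in> set (gal (w \<circ> reflection \<alpha>) u)" using Cons.prems by simp
    from Cons.IH[OF this] obtain v where "set v \<subseteq> set u" "g = w \<circ> reflection \<alpha> \<circ> wprod v" by blast
    then show ?thesis by (intro exI[of _ "\<alpha> # v"]) (auto simp: comp_assoc)
  qed
qed

lemma gal_in_weyl: assumes "w \<in> weyl" "set u \<subseteq> B" shows "set (gal w u) \<subseteq> weyl"
proof
  fix g assume "g \<in> set (gal w u)"
  then obtain v where "set v \<subseteq> set u" "g = w \<circ> wprod v" using set_gal by blast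
  then show "g \<in> weyl" using assms weyl_comp wprod_in_weyl[of v] by simp
qed

lemma successively_gal:
  assumes "1 \<le> m" "set u \<subseteq> B" shows "successively (near m) (gal w u)"
  using assms(2)
proof (induction u arbitrary: w)
  case (Cons \<alpha> u)
  have "near m w (w \<circ> reflection \<alpha>)"
    unfolding near_def using Cons.prems assms(1) by (intro exI[of _ "[\<alpha>]"]) auto
  moreover have "successively (near m) (gal (w \<circ> reflection \<alpha>) u)" using Cons.prems
    by (intro Cons.IH) simp
  moreover have "gal (w \<circ> reflection \<alpha>) u = (w \<circ> reflection \<alpha>) # tl (gal (w \<circ> reflection \<alpha>) u)"
    using list.collapse[OF gal_not_Nil, of "w \<circ> reflection \<alpha>" u] by simp
  ultimately show ?case by (metis gal.simps(2) successively.simps(3))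
qed simp

definition near_word :: "nat \<Rightarrow> ('a \<Rightarrow> 'a) \<Rightarrow> ('a \<Rightarrow> 'a) \<Rightarrow> 'a list" where
  "near_word m w v = (SOME u. set u \<subseteq> B \<and> card (set u) \<le> m \<and> v = w \<circ> wprod u)"

lemma near_word:
  assumes "near m w v"
  shows "set (near_word m w v) \<subseteq> B" "card (set (near_word m w v)) \<le> m" "v = w \<circ> wprod (near_word m w v)"
  using someI_ex[OF assms[unfolded near_def]] unfolding near_word_def by blast+

text \<open>Each near step may jump through a residue of rank up to \<open>m\<close>; the word fills
  the jump with a chosen gallery of simple crossings.\<close>

fun chain_word :: "nat \<Rightarrow> ('a \<Rightarrow> 'a) list \<Rightarrow> 'a list" where
  "chain_word m (w # v # ws) = near_word m w v @ chain_word m (v # ws)"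
| "chain_word m _ = []"

lemma chain_word:
  assumes "ws \<noteq> []" "successively (near m) ws"
  shows "set (chain_word m ws) \<subseteq> B" "last ws = hd ws \<circ> wprod (chain_word m ws)"
  using assms
proof (induction ws rule: induct_list012)
  case (3 w v ws)
  {
    case 1
    then have "near m w v" "set (chain_word m (v # ws)) \<subseteq> B" using "3.IH"(3) by auto
    then show ?case using near_word(1)[of m w v] by simp
  next
    case 2
    then have "near m w v" "last (v # ws) = v \<circ> wprod (chain_word m (v # ws))" using "3.IH"(4) by auto
    moreover have "v \<circ> wprod (chain_word m (v # ws)) = w \<circ>
      (wprod (near_word m w v) \<circ> wprod (chain_word m (v # ws)))"
      using near_word(3)[OF \<open>near m w v\<close>] by (metis comp_assoc)
    ultimately show ?case
      by (simp only: chain_word.simps wprod_append list.sel last.simps list.distinct if_False)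
  }
qed auto

end

locale galleries = finite_simple_roots +
  fixes m q :: nat and w\<^sub>0 :: "'a \<Rightarrow> 'a"
  assumes m_pos: "1 \<le> m" and q_m: "q + 1 + m = card B" and w0: "w\<^sub>0 \<in> weyl"
begin

sublocale finite_complex q complex "cham w\<^sub>0"
  by standard (rule finite_complex_simplex)

lemma q_near_cham_iff: "w \<in> weyl \<Longrightarrow> v \<in> weyl \<Longrightarrow> q_near q (cham w) (cham v) \<longleftrightarrow> near m w v"
  using q_near_cham[OF _ _ q_m] by blast

abbreviation "cgal w u \<equiv> map cham (gal w u)"

lemma successively_map_cham:
  assumes "set ws \<subseteq> weyl" "successively (near m) ws"
  shows "successively (q_near q) (map cham ws)"
  using assms by (induction ws rule: induct_list012) (auto simp: q_near_cham_iff)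

lemma chain_map_cham:
  assumes "ws \<noteq> []" "set ws \<subseteq> weyl" "successively (near m) ws"
  shows "chain (map cham ws)"
  unfolding chain_def using assms successively_map_cham cham_in_complex by auto

lemma chain_cgal: "w \<in> weyl \<Longrightarrow> set u \<subseteq> B \<Longrightarrow> chain (cgal w u)"
  by (intro chain_map_cham gal_in_weyl successively_gal m_pos gal_not_Nil)

text \<open>Any two chambers of the gallery differ by a word in the same at most \<open>m\<close>
  letters and are therefore near.\<close>

lemma cgal_clique:
  assumes "w \<in> weyl" "set u \<subseteq> B" "card (set u) \<le> m"
  shows "lh (cgal w u) [cham w, cham (w \<circ> wprod u)]"
proof -
  have near: "q_near q a b" if ab: "a \<in> set (cgal w u)" "b \<in> set (cgal w u)" for a b
  proof -
    obtain g h where gh: "g \<in> set (gal w u)" "h \<in> set (gal w u)" "a = cham g" "b = cham h" using ab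
      by auto
    obtain x where x: "set x \<subseteq> set u" "g = w \<circ> wprod x" using set_gal[OF gh(1)] by blast
    obtain y where y: "set y \<subseteq> set u" "h = w \<circ> wprod y" using set_gal[OF gh(2)] by blast
    have "h = g \<circ> wprod (rev x @ y)" using x y by (auto simp: wprod_append fun_eq_iff)
    moreover have "set (rev x @ y) \<subseteq> set u" using x y by auto
    ultimately have "near m g h"
      unfolding near_def using assms(2,3) card_mono[OF finite_set, of "set (rev x @ y)" u]
      by (intro exI[of _ "rev x @ y"]) auto
    then show ?thesis unfolding gh(3,4) using gh(1,2) gal_in_weyl[OF assms(1,2)]
      by (subst q_near_cham_iff) auto
  qed
  have "lh (cgal w u) [hd (cgal w u), last (cgal w u)]"
    using lh_clique[of "cgal w u"] near gal_in_weyl[OF assms(1,2)] cham_in_complex by auto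
  then show ?thesis by (simp add: hd_map last_map last_gal)
qed

lemma lh_chain_word:
  assumes "ws \<noteq> []" "set ws \<subseteq> weyl" "successively (near m) ws"
  shows "lh (map cham ws) (cgal (hd ws) (chain_word m ws))"
  using assms
proof (induction ws rule: induct_list012)
  case (2 w)
  then show ?case using lh_refl chain_map_cham[of "[w]"] by simp
next
  case (3 w v ws)
  let ?u = "chain_word m (v # ws)" and ?a = "near_word m w v"
  have IH: "lh (map cham (v # ws)) (cgal v ?u)" using 3 by simp
  have n: "near m w v" using 3 by simp
  note nw = near_word[OF n]
  have w: "w \<in> weyl" "v \<in> weyl" using 3 by auto
  have uB: "set ?u \<subseteq> B" using 3 chain_word(1)[of "v # ws" m] by simp
  have vgal: "cgal v ?u = [cham v] @ map cham (tl (gal v ?u))"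
    using list.collapse[OF gal_not_Nil, of v ?u] by (metis append_Cons append_Nil hd_gal list.simps(9))
  have ch: "chain (map cham (w # v # ws))" using 3 by (intro chain_map_cham) auto
  have 1: "lh ([cham w] @ map cham (v # ws) @ []) ([cham w] @ cgal v ?u @ [])"
    by (rule lh_context[OF IH]) (use ch in simp)
  have cl: "lh [cham w, cham v] (cgal w ?a)" using lh_sym[OF cgal_clique[OF w(1) nw(1,2)]] nw(3) by simp
  have "chain ([] @ [cham w, cham v] @ map cham (tl (gal v ?u)))"
    using 1 vgal by (auto simp: lh_def)
  then have 2: "lh ([] @ [cham w, cham v] @ map cham (tl (gal v ?u)))
    ([] @ cgal w ?a @ map cham (tl (gal v ?u)))"
    by (rule lh_context[OF cl])
  have "gal w (?a @ ?u) = gal w ?a @ tl (gal v ?u)" using gal_append[of w ?a ?u] nw(3) by simp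
  then show ?case using lh_trans[OF 1, of "cgal w (?a @ ?u)"] 2 vgal by simp
qed simp

text \<open>\<open>gq\<close> is equivalence of words as galleries, uniformly in the starting chamber.\<close>

definition gq :: "'a list \<Rightarrow> 'a list \<Rightarrow> bool" where
  "gq a b \<longleftrightarrow> set a \<subseteq> B \<and> set b \<subseteq> B \<and> wprod a = wprod b \<and> (\<forall>w\<in>weyl. lh (cgal w a) (cgal w b))"

lemma gq_refl: "set a \<subseteq> B \<Longrightarrow> gq a a"
  by (auto simp: gq_def intro: lh_refl chain_cgal)

lemma gq_sym: "gq a b \<Longrightarrow> gq b a"
  by (auto simp: gq_def intro: lh_sym)

lemma gq_trans [trans]: "gq a b \<Longrightarrow> gq b c \<Longrightarrow> gq a c"
  unfolding gq_def using lh_trans by metis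

lemma gq_context:
  assumes "gq a b" "set x \<subseteq> B" "set y \<subseteq> B"
  shows "gq (x @ a @ y) (x @ b @ y)"
  unfolding gq_def
proof (intro conjI ballI)
  have ab: "set a \<subseteq> B" "set b \<subseteq> B" "wprod a = wprod b" using assms(1) by (auto simp: gq_def)
  show "set (x @ a @ y) \<subseteq> B" "set (x @ b @ y) \<subseteq> B" using ab assms by auto
  show "wprod (x @ a @ y) = wprod (x @ b @ y)" using ab by (simp add: wprod_append)
  fix w assume w: "w \<in> weyl"
  let ?w = "w \<circ> wprod x"
  have w': "?w \<in> weyl" using w assms(2) weyl_comp wprod_in_weyl by blast
  have ex: "cgal w (x @ c @ y) = map cham (butlast (gal w x)) @ cgal ?w c @ map cham
    (tl (gal (?w \<circ> wprod c) y))" for c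
    unfolding gal_append'[of w x "c @ y"] gal_append[of ?w c y] map_append ..
  have "chain (cgal w (x @ a @ y))" using w ab assms by (intro chain_cgal) auto
  then show "lh (cgal w (x @ a @ y)) (cgal w (x @ b @ y))"
    unfolding ex ab(3) using assms(1) w' by (intro lh_context) (auto simp: gq_def)
qed

text \<open>Both galleries contract to the same two-term chain, their endpoints depending only on
  the product.\<close>

lemma gq_same_small_support:
  assumes "set a \<subseteq> B" "card (set a) \<le> m" "set b \<subseteq> B" "card (set b) \<le> m" "wprod a = wprod b"
  shows "gq a b"
proof -
  have "lh (cgal w a) (cgal w b)" if "w \<in> weyl" for w
    using lh_trans[OF cgal_clique[OF that assms(1,2)] lh_sym[OF cgal_clique[OF that assms(3,4)], folded assms(5)]] .
  then show ?thesis using assms by (simp add: gq_def)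
qed

lemma dhr_gal:
  assumes "gq a b" "wprod a = id"
  shows "(cgal w\<^sub>0 a, cgal w\<^sub>0 b) \<in> dhr"
proof -
  have "chain (cgal w\<^sub>0 a)" using assms w0 chain_cgal by (auto simp: gq_def)
  then have "cgal w\<^sub>0 a \<in> loops"
    using assms(2) by (auto simp: chain_def q_loops_def hd_map last_map last_gal)
  moreover have "lh (cgal w\<^sub>0 a) (cgal w\<^sub>0 b)" using assms w0 by (auto simp: gq_def)
  ultimately show ?thesis unfolding lh_def by (metis append_Nil append_Nil2)
qed

section \<open>Reading words off discrete loops\<close>

definition cham_of :: "('a \<Rightarrow> 'a) set set \<Rightarrow> 'a \<Rightarrow> 'a" where
  "cham_of \<sigma> = (SOME w. w \<in> weyl \<and> \<sigma> \<subseteq> cham w)"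

lemma cham_of: assumes "\<sigma> \<in> complex" shows "cham_of \<sigma> \<in> weyl" "\<sigma> \<subseteq> cham (cham_of \<sigma>)"
  using someI_ex[of "\<lambda>w. w \<in> weyl \<and> \<sigma> \<subseteq> cham w"] complex_subset_cham[OF assms] unfolding cham_of_def
    by blast+

lemma cham_of_cham: "w \<in> weyl \<Longrightarrow> cham_of (cham w) = w"
  using cham_of[OF cham_in_complex, of w] cham_inj[of w "cham_of (cham w)"] by simp

text \<open>Enlarging two simplices to chambers can only enlarge their intersection.\<close>

lemma near_cham_of:
  assumes "\<sigma> \<in> complex" "\<tau> \<in> complex" "q_near q \<sigma> \<tau>"
  shows "near m (cham_of \<sigma>) (cham_of \<tau>)"
proof -
  note c = cham_of[OF assms(1)] cham_of[OF assms(2)]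
  have "finite (cham (cham_of \<sigma>) \<inter> cham (cham_of \<tau>))" using finite_complex_simplex cham_in_complex c
    by blast
  then have "card (\<sigma> \<inter> \<tau>) \<le> card (cham (cham_of \<sigma>) \<inter> cham (cham_of \<tau>))"
    using c by (intro card_mono) auto
  then have "q_near q (cham (cham_of \<sigma>)) (cham (cham_of \<tau>))"
    using assms(3) by (simp add: q_near_def)
  then show ?thesis using q_near_cham_iff[OF c(1,3)] by simp
qed

lemma successively_cham_of:
  assumes "set l \<subseteq> complex" "successively (q_near q) l"
  shows "successively (near m) (map cham_of l)"
  using assms by (induction l rule: induct_list012) (auto simp: near_cham_of)

definition loop_word :: "('a \<Rightarrow> 'a) set set list \<Rightarrow> 'a list" where
  "loop_word l = chain_word m (map cham_of l)"

lemma loop_chambers: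
  assumes "l \<in> loops"
  shows "map cham_of l \<noteq> []" "set (map cham_of l) \<subseteq> weyl" "successively (near m) (map cham_of l)"
    "hd (map cham_of l) = w\<^sub>0" "last (map cham_of l) = w\<^sub>0"
proof -
  have l: "l \<noteq> []" "set l \<subseteq> complex" "successively (q_near q) l" "hd l = cham w\<^sub>0" "last l = cham w\<^sub>0"
    using assms by (auto simp: q_loops_def)
  show "map cham_of l \<noteq> []" using l by simp
  show "set (map cham_of l) \<subseteq> weyl" using l(2) cham_of(1) by auto
  show "successively (near m) (map cham_of l)" using successively_cham_of l by blast
  show "hd (map cham_of l) = w\<^sub>0" "last (map cham_of l) = w\<^sub>0"
    using l cham_of_cham[OF w0] by (simp_all add: hd_map last_map)
qed

lemma loop_word:
  assumes "l \<in> loops"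
  shows "set (loop_word l) \<subseteq> B" "wprod (loop_word l) = id"
proof -
  note c = loop_chambers[OF assms]
  show "set (loop_word l) \<subseteq> B" unfolding loop_word_def using chain_word(1)[OF c(1,3)] .
  have eq: "w\<^sub>0 \<circ> wprod (loop_word l) = w\<^sub>0" unfolding loop_word_def using chain_word(2)[OF c(1,3)] c
    by simp
  obtain w' where "w' \<circ> w\<^sub>0 = id" using weyl_inverse[OF w0] by metis
  then show "wprod (loop_word l) = id" using eq by (metis comp_assoc id_comp)
qed

text \<open>One grid step replaces every simplex by a chamber containing it: the column is near
  because the simplex is near itself. The jumps between chambers are then filled by
  galleries.\<close>

lemma dhr_loop_word:
  assumes "l \<in> loops"
  shows "(l, cgal w\<^sub>0 (loop_word l)) \<in> dhr"
proof -
  note c = loop_chambers[OF assms]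
  let ?l = "map cham (map cham_of l)"
  have l: "set l \<subseteq> complex" "l \<noteq> []" using assms by (auto simp: q_loops_def)
  have lh: "lh ?l (cgal w\<^sub>0 (loop_word l))"
    unfolding loop_word_def using lh_chain_word[OF c(1-3)] c(4) by simp
  have L: "?l \<in> loops"
    using chain_map_cham[OF c(1-3)] c hd_map[OF c(1), of cham] last_map[OF c(1), of cham]
    by (simp only: chain_def q_loops_def mem_Collect_eq) simp
  have "(l, ?l) \<in> dhr"
  proof (cases "2 \<le> length l")
    case True
    have "q_near q \<sigma> (cham (cham_of \<sigma>))" if "\<sigma> \<in> set l" for \<sigma>
    proof -
      have "q_near q \<sigma> \<sigma>" using loop_q_near_refl[OF assms True that] .
      moreover have "\<sigma> \<inter> cham (cham_of \<sigma>) = \<sigma>" using cham_of(2) that l by blast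
      ultimately show ?thesis by (simp add: q_near_def)
    qed
    then have "list_all2 (q_near q) l ?l"
      by (simp add: list_all2_conv_all_nth)
    then show ?thesis using dhr_grid[OF assms L] by blast
  next
    case False
    then have "length l
      = 1" using l(2) by
      (metis One_nat_def Suc_leI length_greater_0_conv less_Suc_eq_le not_less numeral_2_eq_2 le_antisym)
    then have "l = [cham w\<^sub>0]" using assms by (cases l) (auto simp: q_loops_def)
    then have "?l = l" using cham_of_cham[OF w0] by simp
    then show ?thesis using dhr_refl[OF assms] by simp
  qed
  moreover have "(?l, cgal w\<^sub>0 (loop_word l)) \<in> dhr" using lh L unfolding lh_def
    by (metis append_Nil append_Nil2)
  ultimately show ?thesis using dhr_trans by blast
qed

end

section \<open>Discrete homotopy classes as words\<close>

context finite_simple_roots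
begin

definition orth_types :: "'a set set" where
  "orth_types = {I. I \<subseteq> B \<and> (\<forall>\<alpha>\<in>I. \<forall>\<beta>\<in>I. \<alpha> \<noteq> \<beta> \<longrightarrow> \<alpha> \<bullet> \<beta> = 0)}"

lemma face_types_orth: "face_types \<Phi> B orth_types"
  by unfold_locales (auto simp: orth_types_def)

text \<open>The types of faces of codimension at most two.\<close>

definition small_types :: "'a set set" where
  "small_types = {I. I \<subseteq> B \<and> card I \<le> 2}"

lemma face_types_small: "face_types \<Phi> B small_types"
proof unfold_locales
  show "J \<in> small_types" if "I \<in> small_types" "J \<subseteq> I" for I J
  proof -
    have "card J \<le> card I" using that finite_B finite_subset
      by (intro card_mono) (auto simp: small_types_def)
    then show ?thesis using that by (auto simp: small_types_def)
  qed
qed (auto simp: small_types_def)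

lemma orthogonal_reflections_commute:
  assumes "\<alpha> \<bullet> \<beta> = 0"
  shows "reflection \<alpha> \<circ> reflection \<beta> = reflection \<beta> \<circ> reflection \<alpha>"
proof
  fix x
  have "\<beta> \<bullet> \<alpha> = 0" using assms by (simp add: inner_commute)
  then show "(reflection \<alpha> \<circ> reflection \<beta>) x = (reflection \<beta> \<circ> reflection \<alpha>) x"
    using assms by (simp add: reflection_def inner_diff_left)
qed

text \<open>Commutation makes the reflection in \<alpha> negate
  \<open>reflection \<beta> \<alpha>\<close>, so that vector is a multiple of \<alpha>. Unless the
  inner product vanishes, this makes \<beta> a multiple of \<alpha> as well.\<close>

lemma commuting_reflections_orthogonal:
  assumes "\<alpha> \<in> B" "\<beta> \<in> B" "\<alpha> \<noteq> \<beta>" "reflection \<alpha> \<circ> reflection \<beta> = reflection \<beta> \<circ> reflection \<alpha>"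
  shows "\<alpha> \<bullet> \<beta> = 0"
proof (rule ccontr)
  assume ne: "\<alpha> \<bullet> \<beta> \<noteq> 0"
  let ?y = "reflection \<beta> \<alpha>" and ?c = "2 * (\<alpha> \<bullet> \<beta>) / (\<beta> \<bullet> \<beta>)"
  have "reflection \<alpha> ?y = reflection \<beta> (reflection \<alpha> \<alpha>)" using assms(4) by (metis o_apply)
  also have "\<dots> = - ?y" using linear_neg[OF linear_reflection] by simp
  finally have "?y - (2 * (?y \<bullet> \<alpha>) / (\<alpha> \<bullet> \<alpha>)) *\<^sub>R \<alpha> = - ?y" by (simp add: reflection_def[of \<alpha>])
  then have "2 *\<^sub>R ?y \<in> span {\<alpha>}"
    by (metis add.commute diff_add_cancel diff_minus_eq_add insertI1 scaleR_2 span_base span_scale)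
  then have "(1/2) *\<^sub>R 2 *\<^sub>R ?y \<in> span {\<alpha>}" by (rule span_scale)
  then have "?y \<in> span {\<alpha>}" by simp
  then have "\<alpha> - ?y \<in> span {\<alpha>}" by (intro span_diff) (auto intro: span_base)
  then have "?c *\<^sub>R \<beta> \<in> span {\<alpha>}" by (simp add: reflection_def)
  then have "(1 / ?c) *\<^sub>R ?c *\<^sub>R \<beta> \<in> span {\<alpha>}" by (rule span_scale)
  moreover have "?c \<noteq> 0" using ne root_nonzero assms B_subset by auto
  ultimately have "\<beta> \<in> span {\<alpha>}" by simp
  then have "\<beta> \<in> span (B - {\<beta>})" using span_mono[of "{\<alpha>}" "B - {\<beta>}"] assms by blast
  then show False using independent_B assms(2) dependent_def by blast
qed

lemma wprod_singleton_support:
  assumes "set u \<subseteq> {\<alpha>}" shows "wprod u = id \<or> wprod u = reflection \<alpha>"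
  using assms
proof (induction u)
  case (Cons \<beta> u)
  have "reflection \<alpha> \<circ> reflection \<alpha> = id" by (simp add: fun_eq_iff)
  then show ?case using Cons by auto
qed simp

lemma chain_word_append:
  "chain_word m (xs @ w # ys) = chain_word m (xs @ [w]) @ chain_word m (w # ys)"
  by (induction xs rule: induct_list012) auto

end

text \<open>Adjacent chambers share a panel: the graph is the Cayley graph of the group with
  respect to the simple reflections, and its squares come from commuting pairs.\<close>

locale panel_galleries = galleries +
  assumes m_one: "m = 1"
begin

sublocale F: face_types \<Phi> B orth_types
  by (rule face_types_orth)

section \<open>Cancellation and commutation as moves of galleries\<close>

lemma weyl_reflection: "w \<in> weyl \<Longrightarrow> \<alpha> \<in> B \<Longrightarrow> w \<circ> reflection \<alpha> \<in> weyl"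
  using weyl_comp wprod_in_weyl[of "[\<alpha>]"] by simp

lemma q_near_reflection:
  assumes "w \<in> weyl" "\<alpha> \<in> B" shows "q_near q (cham w) (cham (w \<circ> reflection \<alpha>))"
proof -
  have "near m w (w \<circ> reflection \<alpha>)" unfolding near_def using assms m_one by (intro exI[of _ "[\<alpha>]"]) auto
  then show ?thesis using q_near_cham_iff[OF assms(1) weyl_reflection[OF assms]] by simp
qed

lemma gq_swap:
  assumes "\<alpha> \<in> B" "\<beta> \<in> B" "\<alpha> \<bullet> \<beta> = 0"
  shows "gq [\<alpha>, \<beta>] [\<beta>, \<alpha>]"
  unfolding gq_def
proof (intro conjI ballI)
  show eq: "wprod [\<alpha>, \<beta>] = wprod [\<beta>, \<alpha>]" using orthogonal_reflections_commute[OF assms(3)] by simp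
  fix w assume w: "w \<in> weyl"
  let ?a = "w \<circ> reflection \<alpha>" and ?b = "w \<circ> reflection \<beta>"
  let ?c = "?a \<circ> reflection \<beta>"
  have c: "?c = ?b \<circ> reflection \<alpha>" using orthogonal_reflections_commute[OF assms(3)]
    by (simp only: comp_assoc)
  note ws = w weyl_reflection[OF w assms(1)] weyl_reflection[OF w assms(2)]
    weyl_reflection[OF weyl_reflection[OF w assms(1)] assms(2)]
  have "lh [cham w, cham ?a, cham ?c] [cham w, cham ?b, cham ?c]"
  proof (rule lh_square)
    show "{cham w, cham ?a, cham ?c, cham ?b} \<subseteq> complex" using ws cham_in_complex by simp
    show "q_near q (cham ?b) (cham ?c)" unfolding c by (rule q_near_reflection[OF ws(3) assms(1)])
  qed (rule q_near_reflection; fact)+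
  then show "lh (cgal w [\<alpha>, \<beta>]) (cgal w [\<beta>, \<alpha>])" using c by (simp only: gal.simps list.map)
qed (use assms in auto)

lemma gq_cancel:
  assumes "\<alpha> \<in> B" shows "gq [\<alpha>, \<alpha>] []"
  unfolding gq_def
proof (intro conjI ballI)
  show "wprod [\<alpha>, \<alpha>] = wprod []" by (simp add: fun_eq_iff)
  fix w assume w: "w \<in> weyl"
  have "w \<circ> reflection \<alpha> \<circ> reflection \<alpha> = w" by (simp add: fun_eq_iff)
  then show "lh (cgal w [\<alpha>, \<alpha>]) (cgal w [])"
    using lh_backtrack[OF _ q_near_reflection[OF w assms]] w weyl_reflection[OF w assms] cham_in_complex
    by (simp only: gal.simps list.map) simp
qed (use assms in auto)

lemma gq_move:
  assumes "set x \<subseteq> B" "\<alpha> \<in> B" "\<And>\<beta>. \<beta> \<in> set x \<Longrightarrow> \<alpha> \<bullet> \<beta> = 0"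
  shows "gq (\<alpha> # x) (x @ [\<alpha>])"
  using assms(1,3)
proof (induction x)
  case Nil
  then show ?case using gq_refl[of "[\<alpha>]"] assms(2) by simp
next
  case (Cons \<beta> x)
  have "gq ([] @ [\<alpha>, \<beta>] @ x) ([] @ [\<beta>, \<alpha>] @ x)"
    using Cons.prems assms(2) by (intro gq_context gq_swap) auto
  moreover have "gq ([\<beta>] @ (\<alpha> # x) @ []) ([\<beta>] @ (x @ [\<alpha>]) @ [])"
    using Cons by (intro gq_context Cons.IH) auto
  ultimately show ?case using gq_trans by simp
qed

text \<open>A letter that occurs again later commutes past everything up to its second copy and
  cancels.\<close>

lemma gq_normal:
  assumes "set a \<in> orth_types"
  shows "\<exists>d. distinct d \<and> set d \<subseteq> set a \<and> gq a d"
  using assms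
proof (induction a)
  case Nil
  then show ?case using gq_refl[of "[]"] by auto
next
  case (Cons \<alpha> a)
  have sets: "\<alpha> \<in> B" "set a \<subseteq> B" "set a \<in> orth_types" using Cons.prems by (auto simp: orth_types_def)
  obtain d where d: "distinct d" "set d \<subseteq> set a" "gq a d" using Cons.IH sets by blast
  have ad: "gq (\<alpha> # a) (\<alpha> # d)" using gq_context[OF d(3), of "[\<alpha>]" "[]"] sets by simp
  show ?case
  proof (cases "\<alpha> \<in> set d")
    case False
    then show ?thesis using d ad by (intro exI[of _ "\<alpha> # d"]) auto
  next
    case True
    then obtain x y where xy: "d = x @ \<alpha> # y" by (metis split_list)
    have xyB: "set x \<subseteq> B" "set y \<subseteq> B" using d(2) xy sets by auto
    have "\<alpha> \<bullet> \<beta> = 0" if "\<beta> \<in> set x" for \<beta>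
    proof -
      have "\<beta> \<noteq> \<alpha>" "\<beta> \<in> set (\<alpha> # a)" using that d xy by auto
      then show ?thesis using Cons.prems unfolding orth_types_def by auto
    qed
    then have "gq (\<alpha> # x) (x @ [\<alpha>])" using gq_move[OF xyB(1) sets(1)] by blast
    then have "gq ([] @ (\<alpha> # x) @ (\<alpha> # y)) ([] @ (x @ [\<alpha>]) @ (\<alpha> # y))"
      using sets xyB by (intro gq_context) auto
    moreover have "gq (x @ [\<alpha>, \<alpha>] @ y) (x @ [] @ y)"
      using sets xyB by (intro gq_context gq_cancel)
    ultimately have "gq (\<alpha> # a) (x @ y)" using ad xy gq_trans
      by (metis append_Cons append_Nil append.assoc)
    then show ?thesis using d xy by (intro exI[of _ "x @ y"]) auto
  qed
qed

lemma gq_permutation: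
  assumes "set d \<in> orth_types" "distinct d" "distinct d'" "set d = set d'"
  shows "gq d d'"
  using assms
proof (induction d arbitrary: d')
  case Nil
  then show ?case using gq_refl[of "[]"] by simp
next
  case (Cons \<alpha> d)
  then obtain x y where xy: "d' = x @ \<alpha> # y" by (metis list.set_intros(1) split_list)
  have B: "\<alpha> \<in> B" "set d \<subseteq> B" "set d \<in> orth_types" using Cons.prems by (auto simp: orth_types_def)
  have dxy: "set d = set (x @ y)" "distinct (x @ y)" using Cons.prems xy by auto
  have xyB: "set x \<subseteq> B" "set y \<subseteq> B" using dxy B by auto
  have "\<alpha> \<bullet> \<beta> = 0" if "\<beta> \<in> set x" for \<beta>
  proof -
    have "\<beta> \<noteq> \<alpha>" "\<beta> \<in> set (\<alpha> # d)" using that Cons.prems xy by auto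
    then show ?thesis using Cons.prems(1) unfolding orth_types_def by auto
  qed
  then have "gq ([] @ (\<alpha> # x) @ y) ([] @ (x @ [\<alpha>]) @ y)"
    using gq_move[OF xyB(1) B(1)] xyB by (intro gq_context) auto
  moreover have "gq d (x @ y)" using Cons.IH[OF B(3) _ dxy(2,1)] Cons.prems by simp
  then have "gq ([\<alpha>] @ d @ []) ([\<alpha>] @ (x @ y) @ [])" using B by (intro gq_context) auto
  ultimately show ?case using xy gq_trans by simp
qed

text \<open>After removing repetitions, equality of products forces equality of supports by linear
  independence, and orthogonal letters may be permuted freely.\<close>

lemma gq_orth:
  assumes "set a \<in> orth_types" "set b \<in> orth_types" "wprod a = wprod b"
  shows "gq a b"
proof -
  obtain d where d: "distinct d" "set d \<subseteq> set a" "gq a d" using gq_normal assms by blast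
  obtain e where e: "distinct e" "set e \<subseteq> set b" "gq b e" using gq_normal assms by blast
  have "wprod d = wprod e" using d e assms by (simp add: gq_def)
  moreover have dB: "set d \<subseteq> B" "set e \<subseteq> B" using d e by (auto simp: gq_def)
  ultimately have "set d = set e"
    using distinct_words_same_product_same_support[OF independent_B] d e by blast
  moreover have "set d \<in> orth_types" using d(2) F.type_down assms(1) by blast
  ultimately have "gq d e" using gq_permutation d e by blast
  then show ?thesis using d e gq_trans gq_sym by blast
qed

lemma weq_imp_gq:
  assumes "F.weq a b" "set a \<subseteq> B" shows "gq a b"
  using assms(1) unfolding F.weq_def
proof (induction rule: rtranclp_induct)
  case base
  then show ?case using gq_refl assms by blast
next
  case (step b c)
  obtain xs x y ys where d: "b = xs @ x @ ys" "c = xs @ y @ ys" "set x \<in> orth_types"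
    "set y \<in> orth_types" "wprod x = wprod y"
    using step(2) by (auto simp: F.wstep_def)
  have "set b \<subseteq> B" using step by (auto simp: gq_def)
  then have "gq b c" unfolding d using gq_orth[OF d(3-5)] d(1) by (intro gq_context) auto
  then show ?case using step gq_trans by blast
qed

text \<open>Every equality of two-letter products is accounted for. Repeated letters cancel;
  otherwise the supports agree, so the words are equal or transposed, and a transposition makes the
  roots orthogonal.\<close>

lemma weq_short:
  assumes "set u \<subseteq> B" "length u \<le> 2" "set v \<subseteq> B" "length v \<le> 2" "wprod u = wprod v"
  shows "F.weq u v"
proof -
  have red: "\<exists>d. distinct d \<and> set d \<subseteq> B \<and> length d \<le> 2 \<and> wprod u = wprod d \<and> F.weq u d"
    if u: "set u \<subseteq> B" "length u \<le> 2" for u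
  proof (cases "distinct u")
    case True
    then show ?thesis using u F.weq_refl by blast
  next
    case False
    then obtain \<alpha> where \<alpha>: "u = [\<alpha>, \<alpha>]" using u by (cases u; cases "tl u"; auto)
    have "wprod u = wprod []" unfolding \<alpha> by (simp add: fun_eq_iff)
    moreover have "set u \<in> orth_types" using \<alpha> u by (auto simp: orth_types_def)
    ultimately show ?thesis using F.weqI[of u "[]"] F.type_empty by (intro exI[of _ "[]"]) auto
  qed
  obtain d where d: "distinct d" "set d \<subseteq> B" "length d \<le> 2" "wprod u = wprod d" "F.weq u d"
    using red assms(1,2) by blast
  obtain e where e: "distinct e" "set e \<subseteq> B" "length e \<le> 2" "wprod v = wprod e" "F.weq v e"
    using red assms(3,4) by blast
  have de: "set d = set e" "wprod d = wprod e"
    using distinct_words_same_product_same_support[OF independent_B d(1,2) e(1,2)] d e assms by auto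
  have "F.weq d e"
  proof (cases "length d \<le> 1")
    case True
    then have "set d \<in> orth_types" using d(2) by (cases d) (auto simp: orth_types_def)
    then show ?thesis using F.weqI de by metis
  next
    case False
    then obtain \<alpha> \<beta> where ab: "d = [\<alpha>, \<beta>]" using d(3) by (cases d; cases "tl d"; auto)
    have "length e = 2" using de(1) distinct_card[OF d(1)] distinct_card[OF e(1)] ab by simp
    then have "e = [\<alpha>, \<beta>] \<or> e = [\<beta>, \<alpha>]"
      using de(1) d(1) ab by (cases e; cases "tl e"; auto simp: doubleton_eq_iff)
    then show ?thesis
    proof
      assume "e = [\<beta>, \<alpha>]"
      then have "reflection \<alpha> \<circ> reflection \<beta> = reflection \<beta> \<circ> reflection \<alpha>" using de(2) ab by simp
      then have "\<alpha> \<bullet> \<beta> = 0" using commuting_reflections_orthogonal d ab by auto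
      then have "set d \<in> orth_types" using d ab by (auto simp: orth_types_def inner_commute)
      then show ?thesis using F.weqI de by metis
    qed (use ab F.weq_refl in simp)
  qed
  then show ?thesis using d(5) e(5) F.weq_trans F.weq_sym by blast
qed

section \<open>Words of single steps and of grid cells\<close>

lemma near_word_letters_equal:
  assumes "near m w v" "\<alpha> \<in> set (near_word m w v)" "\<beta> \<in> set (near_word m w v)"
  shows "\<alpha> = \<beta>"
proof -
  have "card (set (near_word m w v)) \<le> Suc 0" using near_word(2)[OF assms(1)] m_one by simp
  then show ?thesis using card_le_Suc0_iff_eq[OF finite_set, of "near_word m w v"] assms(2,3) by simp
qed

lemma near_word_type: assumes "near m w v" shows "set (near_word m w v) \<in> orth_types"
  unfolding orth_types_def using near_word(1)[OF assms] near_word_letters_equal[OF assms] by blast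

text \<open>The chosen word of a near step may be a long power of one letter; it reduces to that
  letter or to the empty word.\<close>

lemma near_word_letter:
  assumes "near m w v"
  shows "\<exists>x. set x \<subseteq> B \<and> length x \<le> 1 \<and> wprod x = wprod (near_word m w v) \<and> F.weq (near_word m w v) x"
proof -
  note nw = near_word[OF assms]
  have "\<exists>x. set x \<subseteq> B \<and> length x \<le> 1 \<and> wprod x = wprod (near_word m w v)"
  proof (cases "near_word m w v")
    case Nil
    then show ?thesis by (intro exI[of _ "[]"]) auto
  next
    case (Cons \<alpha> u)
    then have "set (near_word m w v) \<subseteq> {\<alpha>}" using near_word_letters_equal[OF assms]
      by (metis insertCI list.set_intros(1) subsetI)
    then have "wprod (near_word m w v) = wprod [] \<or> wprod (near_word m w v) = wprod [\<alpha>]"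
      using wprod_singleton_support by simp
    moreover have "\<alpha> \<in> B" using nw(1) Cons by simp
    ultimately show ?thesis
      by (metis One_nat_def empty_set empty_subsetI insert_subset le_numeral_extra(4) length_Cons list.simps(15) list.size(3) zero_le)
  qed
  then obtain x where x: "set x \<subseteq> B" "length x \<le> 1" "wprod x = wprod (near_word m w v)" by blast
  moreover have "set x \<in> orth_types" using x by (cases x) (auto simp: orth_types_def)
  then have "F.weq (near_word m w v) x" using F.weqI[OF near_word_type[OF assms]] x(3) by simp
  ultimately show ?thesis by blast
qed

text \<open>A grid cell compares two routes of two steps each, so after reduction it becomes an
  equality of two words of length at most two.\<close>

lemma near_word_square:
  assumes "w \<in> weyl" "near m w v" "near m v v'" "near m w w'" "near m w' v'"
  shows "F.weq (near_word m w v @ near_word m v v') (near_word m w w' @ near_word m w' v')"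
proof -
  obtain a where a: "set a \<subseteq> B" "length a \<le> 1" "wprod a = wprod (near_word m w v)"
    "F.weq (near_word m w v) a"
    using near_word_letter[OF assms(2)] by blast
  obtain b where b: "set b \<subseteq> B" "length b \<le> 1" "wprod b = wprod (near_word m v v')"
    "F.weq (near_word m v v') b"
    using near_word_letter[OF assms(3)] by blast
  obtain c where c: "set c \<subseteq> B" "length c \<le> 1" "wprod c = wprod (near_word m w w')"
    "F.weq (near_word m w w') c"
    using near_word_letter[OF assms(4)] by blast
  obtain d where d: "set d \<subseteq> B" "length d \<le> 1" "wprod d = wprod (near_word m w' v')"
    "F.weq (near_word m w' v') d"
    using near_word_letter[OF assms(5)] by blast
  have eq: "w \<circ> (wprod a \<circ> wprod b) = v'" "w \<circ> (wprod c \<circ> wprod d) = v'"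
    using near_word(3)[OF assms(2)] near_word(3)[OF assms(3)] near_word(3)[OF assms(4)] near_word(3)[OF assms(5)]
    unfolding a(3) b(3) c(3) d(3) by (metis comp_assoc)+
  have "wprod (a @ b) = wprod (c @ d)"
    unfolding wprod_append using F.weyl_comp_cancel[OF assms(1) trans[OF eq(1) eq(2)[symmetric]]]
      by blast
  then have "F.weq (a @ b) (c @ d)"
    using a(1,2) b(1,2) c(1,2) d(1,2) by (intro weq_short) simp_all
  then show ?thesis
    using F.weq_trans[OF F.weq_append[OF a(4) b(4)] F.weq_trans[OF _ F.weq_sym[OF F.weq_append[OF c(4) d(4)]]]] by blast
qed

lemma near_word_refl: assumes "w \<in> weyl" shows "F.weq (near_word m w w) []"
proof -
  have "w \<circ> wprod (near_word m w w) = w \<circ> wprod []" using near_word(3)[OF near_refl[of m w]] by simp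
  then have "wprod (near_word m w w) = wprod []" using F.weyl_comp_cancel[OF assms] by blast
  then show ?thesis using F.weqI[OF near_word_type[OF near_refl]] F.type_empty by simp
qed

lemma chain_word_stretch:
  assumes "w \<in> weyl"
  shows "F.weq (chain_word m (xs @ w # ys)) (chain_word m (xs @ w # w # ys))"
proof -
  have "F.weq (chain_word m (xs @ [w]) @ [] @ chain_word m (w # ys))
    (chain_word m (xs @ [w]) @ near_word m w w @ chain_word m (w # ys))"
    using F.weq_sym[OF near_word_refl[OF assms]] by (rule F.weq_context)
  then show ?thesis using chain_word_append[of m xs w ys] chain_word_append[of m xs w "w # ys"] by simp
qed

text \<open>The discrete counterpart of \<open>chain_ladder\<close>, with grid cells in place of
  members of the cover.\<close>

lemma chain_word_ladder:
  assumes "length ws = length vs" "ws \<noteq> []" "set ws \<subseteq> weyl" "successively (near m) ws"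
    "successively (near m) vs"
    "list_all2 (near m) ws vs"
  shows "F.weq (chain_word m ws @ near_word m (last ws) (last vs))
    (near_word m (hd ws) (hd vs) @ chain_word m vs)"
  using assms
proof (induction ws arbitrary: vs rule: induct_list012)
  case (2 w)
  then obtain v where "vs = [v]" by (metis length_0_conv length_Suc_conv list.size(3) list.size(4))
  then show ?case using F.weq_refl by simp
next
  case (3 w w' ws)
  then obtain v v' us where vs: "vs = v # v' # us" by (metis list_all2_Cons1)
  let ?W = "w' # ws" and ?V = "v' # us"
  have IH: "F.weq (chain_word m ?W @ near_word m (last ?W) (last ?V))
    (near_word m w' v' @ chain_word m ?V)"
    using "3.IH"(2)[of ?V] 3 vs by simp
  have sq: "F.weq (near_word m w w' @ near_word m w' v') (near_word m w v @ near_word m v v')"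
    using 3 vs by (intro near_word_square) auto
  have 1: "F.weq (near_word m w w' @ (chain_word m ?W @ near_word m (last ?W) (last ?V)))
      (near_word m w w' @ (near_word m w' v' @ chain_word m ?V))"
    by (rule F.weq_append[OF F.weq_refl IH])
  have 2: "F.weq ((near_word m w w' @ near_word m w' v') @ chain_word m ?V)
      ((near_word m w v @ near_word m v v') @ chain_word m ?V)"
    by (rule F.weq_append[OF sq F.weq_refl])
  show ?case using F.weq_trans[OF 1 2[unfolded append_assoc]] vs by simp
qed simp

lemma chain_word_gal:
  assumes "w \<in> weyl" "set u \<subseteq> B"
  shows "F.weq (chain_word m (gal w u)) u"
  using assms
proof (induction u arbitrary: w)
  case Nil
  then show ?case using F.weq_refl by simp
next
  case (Cons \<alpha> u)
  let ?w = "w \<circ> reflection \<alpha>"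
  have n: "near m w ?w" unfolding near_def using Cons.prems m_one by (intro exI[of _ "[\<alpha>]"]) auto
  have "w \<circ> wprod (near_word m w ?w) = w \<circ> wprod [\<alpha>]" using near_word(3)[OF n] by simp
  then have "wprod (near_word m w ?w) = wprod [\<alpha>]" using F.weyl_comp_cancel Cons.prems(1) by blast
  then have 1: "F.weq (near_word m w ?w) [\<alpha>]"
    using Cons.prems F.type_singleton by (intro F.weqI near_word_type[OF n]) auto
  have "?w \<in> weyl" using weyl_reflection Cons.prems by simp
  then have 2: "F.weq (chain_word m (gal ?w u)) u" by (rule Cons.IH) (use Cons.prems(2) in simp)
  have "gal ?w u = ?w # tl (gal ?w u)" using list.collapse[OF gal_not_Nil, of ?w u] by simp
  then have "chain_word m (gal w (\<alpha> # u)) = near_word m w ?w @ chain_word m (gal ?w u)"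
    by (metis chain_word.simps(1) gal.simps(2))
  then show ?case using F.weq_append[OF 1 2] by simp
qed

text \<open>A stretching inserts the word of a stationary step. In a grid strip the two end rungs
  join the base chamber to itself, so the ladder compares the two loop words.\<close>

lemma dhr_imp_weq:
  assumes "(l, l') \<in> dhr" shows "F.weq (loop_word l) (loop_word l')"
  using assms
proof (induction rule: dhr_induct)
  case (stretch l l')
  then obtain xs a ys where d: "l = xs @ [a] @ ys" "l' = xs @ [a, a] @ ys" by (auto simp: stretching_def)
  have "a \<in> complex" using stretch d by (auto simp: q_loops_def)
  then show ?case using chain_word_stretch[OF cham_of(1)] d by (simp add: loop_word_def)
next
  case (grid l l')
  note c = loop_chambers[OF grid(1)] and c' = loop_chambers[OF grid(2)]
  have cx: "set l \<subseteq> complex" "set l' \<subseteq> complex" using grid by (auto simp: q_loops_def)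
  have "list_all2 (near m) (map cham_of l) (map cham_of l')"
    using grid(3) cx near_cham_of by (auto simp: list_all2_conv_all_nth subset_iff)
  then have "F.weq (loop_word l @ near_word m w\<^sub>0 w\<^sub>0) (near_word m w\<^sub>0 w\<^sub>0 @ loop_word l')"
    using chain_word_ladder[of "map cham_of l" "map cham_of l'"] c c' list_all2_lengthD[OF grid(3)]
    unfolding loop_word_def by simp
  moreover have "F.weq (loop_word l @ near_word m w\<^sub>0 w\<^sub>0) (loop_word l @ [])"
    "F.weq (near_word m w\<^sub>0 w\<^sub>0 @ loop_word l') ([] @ loop_word l')"
    by (rule F.weq_append[OF F.weq_refl near_word_refl[OF w0]], rule F.weq_append[OF near_word_refl[OF w0] F.weq_refl])
  ultimately show ?case using F.weq_trans F.weq_sym by (metis append_Nil append_Nil2)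
qed (auto intro: F.weq_refl F.weq_sym F.weq_trans)

lemma dhr_iff_weq:
  assumes "l \<in> loops" "l' \<in> loops"
  shows "(l, l') \<in> dhr \<longleftrightarrow> F.weq (loop_word l) (loop_word l')"
proof
  assume "F.weq (loop_word l) (loop_word l')"
  then have "gq (loop_word l) (loop_word l')" using weq_imp_gq[OF _ loop_word(1)[OF assms(1)]] by blast
  then have 1: "(cgal w\<^sub>0 (loop_word l), cgal w\<^sub>0 (loop_word l')) \<in> dhr"
    using dhr_gal[OF _ loop_word(2)[OF assms(1)]] by blast
  show "(l, l') \<in> dhr"
    by (rule dhr_trans[OF dhr_loop_word[OF assms(1)] dhr_trans[OF 1 dhr_sym[OF dhr_loop_word[OF assms(2)]]]])
qed (rule dhr_imp_weq)

lemma loop_word_surj: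
  assumes "set u \<subseteq> B" "wprod u = id"
  shows "\<exists>l\<in>loops. F.weq (loop_word l) u"
proof
  have "map cham_of (cgal w\<^sub>0 u) = gal w\<^sub>0 u"
    using gal_in_weyl[OF w0 assms(1)] cham_of_cham by (auto intro!: map_idI)
  then show "F.weq (loop_word (cgal w\<^sub>0 u)) u" unfolding loop_word_def
    using chain_word_gal[OF w0 assms(1)] by metis
  show "cgal w\<^sub>0 u \<in> loops" using dhr_gal[OF gq_refl[OF assms(1)] assms(2)] dhr_loops by blast
qed

text \<open>The doubled base simplex contributes the word of a stationary step, which is
  trivial.\<close>

lemma loop_word_append:
  assumes "l \<in> loops" "l' \<in> loops"
  shows "F.weq (loop_word (l @ l')) (loop_word l @ loop_word l')"
proof -
  note c = loop_chambers[OF assms(1)] and c' = loop_chambers[OF assms(2)]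
  obtain xs where xs: "map cham_of l = xs @ [w\<^sub>0]" using c(1,5) append_butlast_last_id by metis
  obtain ys where ys: "map cham_of l' = w\<^sub>0 # ys" using c'(1,4) list.collapse by metis
  have "loop_word (l @ l') = loop_word l @ near_word m w\<^sub>0 w\<^sub>0 @ loop_word l'"
    unfolding loop_word_def map_append xs ys using chain_word_append[of m xs w\<^sub>0 "w\<^sub>0 # ys"] by simp
  then show ?thesis using F.weq_context[OF near_word_refl[OF w0], of "loop_word l" "loop_word l'"]
    by simp
qed

end

section \<open>The parabolic arrangement\<close>

lemma (in group) ord_mult_involutions:
  assumes "s \<in> carrier G" "t \<in> carrier G" "s \<otimes> s = \<one>" "t \<otimes> t = \<one>" "s \<noteq> t"
  shows "ord (s \<otimes> t) = 2 \<longleftrightarrow> s \<otimes> t = t \<otimes> s"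
proof -
  have inv: "inv s = s" "inv t = t" using assms inv_equality by auto
  have sq: "(s \<otimes> t) [^] (2::nat) = \<one> \<longleftrightarrow> s \<otimes> t = t \<otimes> s"
  proof -
    have "(s \<otimes> t) [^] (2::nat) = (s \<otimes> t) \<otimes> (s \<otimes> t)"
      using assms by (simp add: numeral_2_eq_2 m_assoc)
    moreover have "inv (s \<otimes> t) = t \<otimes> s" using assms inv by (simp add: inv_mult_group)
    ultimately show ?thesis using assms by (metis inv_equality m_closed r_inv)
  qed
  have "s \<otimes> t \<noteq> \<one>" using assms inv by (metis inv_equality)
  then have "ord (s \<otimes> t) \<noteq> 1" using ord_eq_1[of "s \<otimes> t"] assms(1,2) by blast
  \<comment> \<open>Order 1 has been excluded and 2 is prime; infinite order, encoded as 0, does not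
    divide 2.\<close>
  then have "ord (s \<otimes> t) = 2 \<longleftrightarrow> ord (s \<otimes> t) dvd 2"
    using prime_nat_iff two_is_prime_nat by (metis dvd_refl)
  also have "\<dots> \<longleftrightarrow> (s \<otimes> t) [^] (2::nat) = \<one>" using pow_eq_id[of "s \<otimes> t" 2] assms by simp
  finally show ?thesis using sq by simp
qed

lemma irreducible_system_pair:
  assumes "group G" "s \<in> carrier G" "t \<in> carrier G" "s \<otimes>\<^bsub>G\<^esub> s = \<one>\<^bsub>G\<^esub>" "t \<otimes>\<^bsub>G\<^esub> t = \<one>\<^bsub>G\<^esub>" "s \<noteq> t"
  shows "irreducible_system G {s, t} \<longleftrightarrow> s \<otimes>\<^bsub>G\<^esub> t \<noteq> t \<otimes>\<^bsub>G\<^esub> s"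
proof -
  interpret group G by fact
  let ?R = "{(a, b). a \<in> {s, t} \<and> b \<in> {s, t} \<and> coxeter_edge G a b}"
  have edge: "coxeter_edge G s t \<longleftrightarrow> s \<otimes>\<^bsub>G\<^esub> t \<noteq> t \<otimes>\<^bsub>G\<^esub> s" "coxeter_edge G t s \<longleftrightarrow> s \<otimes>\<^bsub>G\<^esub> t \<noteq> t \<otimes>\<^bsub>G\<^esub> s"
    using ord_mult_involutions[of s t] ord_mult_involutions[of t s] assms
      by (auto simp: coxeter_edge_def)
  show ?thesis
  proof
    assume irr: "irreducible_system G {s, t}"
    show "s \<otimes>\<^bsub>G\<^esub> t \<noteq> t \<otimes>\<^bsub>G\<^esub> s"
    proof
      assume "s \<otimes>\<^bsub>G\<^esub> t = t \<otimes>\<^bsub>G\<^esub> s"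
      then have R: "?R = {}" using edge by (auto simp: coxeter_edge_def)
      have "(s, t) \<in> ?R\<^sup>*" using irr unfolding irreducible_system_def by blast
      then show False unfolding R using assms(6) by simp
    qed
  next
    assume "s \<otimes>\<^bsub>G\<^esub> t \<noteq> t \<otimes>\<^bsub>G\<^esub> s"
    then have "(s, t) \<in> ?R" "(t, s) \<in> ?R" using edge by auto
    then show "irreducible_system G {s, t}" unfolding irreducible_system_def by blast
  qed
qed

context finite_simple_roots
begin

section \<open>The subspaces of the arrangement\<close>

definition perp :: "('a \<Rightarrow> 'a) \<Rightarrow> 'a set \<Rightarrow> 'a set" where
  "perp w K = {x. \<forall>\<alpha>\<in>K. x \<bullet> w \<alpha> = 0}"

lemma conjugate_reflections:
  assumes "w \<in> weyl"
  shows "conjugate_set orthogonal_group w (reflection ` K) = reflection ` (w ` K)"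
proof -
  interpret group "orthogonal_group :: ('a \<Rightarrow> 'a) monoid" by (rule group_orthogonal_group)
  obtain w' where w': "w' \<in> weyl" "w' \<circ> w = id" "w \<circ> w' = id" "\<And>x y. w x \<bullet> y = x \<bullet> w' y"
    using weyl_inverse[OF assms] by metis
  have "inv\<^bsub>orthogonal_group\<^esub> w = w'"
    using w' orthogonal_weyl assms by (intro inv_equality) (auto simp: orthogonal_group_def)
  moreover have "w \<circ> reflection \<alpha> \<circ> w' = reflection (w \<alpha>)" for \<alpha>
  proof
    fix x
    have "w (w' x) = x" using w'(3) by (metis comp_apply id_apply)
    then show "(w \<circ> reflection \<alpha> \<circ> w') x = reflection (w \<alpha>) x"
      using reflection_conjugate[OF orthogonal_weyl[OF assms], of \<alpha> "w' x"] by simp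
  qed
  moreover have "x \<otimes>\<^bsub>orthogonal_group\<^esub> y = x \<circ> y" for x y :: "'a \<Rightarrow> 'a"
    by (simp add: orthogonal_group_def)
  ultimately show ?thesis unfolding conjugate_set_def image_image by simp
qed

lemma Fix_conjugate:
  assumes "w \<in> weyl" "K \<subseteq> B"
  shows "Fix (generate orthogonal_group (reflection ` (w ` K))) = perp w K"
proof (intro equalityI subsetI)
  fix x assume x: "x \<in> Fix (generate orthogonal_group (reflection ` (w ` K)))"
  have "x \<bullet> w \<alpha> = 0" if "\<alpha> \<in> K" for \<alpha>
  proof -
    have "reflection (w \<alpha>) x = x" using x that unfolding Fix_def by (auto intro: generate.incl)
    moreover have "w \<alpha> \<noteq> 0" using that assms weyl_root root_nonzero B_subset by blast
    ultimately show ?thesis using reflection_fixes_iff by blast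
  qed
  then show "x \<in> perp w K" by (simp add: perp_def)
next
  fix x assume "x \<in> perp w K"
  then have "wprod u x = x" if "set u \<subseteq> w ` K" for u
    using that by (intro wprod_fixes) (auto simp: perp_def)
  then show "x \<in> Fix (generate orthogonal_group (reflection ` (w ` K)))"
    unfolding Fix_def generate_reflections by blast
qed

lemma parabolic_arrangement_eq:
  "parabolic_arrangement weyl (reflection ` B) k =
     {perp w K | w K. w \<in> weyl \<and> K \<subseteq> B \<and> card K = k - 1 \<and>
        irreducible_system orthogonal_group (reflection ` (w ` K))}"
proof (intro equalityI subsetI)
  fix X assume "X \<in> parabolic_arrangement weyl (reflection ` B) k"
  then obtain T w where T: "T \<subseteq> reflection ` B" "w \<in> weyl"
    "X = Fix (generate orthogonal_group (conjugate_set orthogonal_group w T))" "card T = k - 1"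
    "irreducible_system orthogonal_group (conjugate_set orthogonal_group w T)"
    unfolding parabolic_arrangement_def irreducible_parabolic_def by blast
  obtain K where K: "K \<subseteq> B" "T = reflection ` K" using T(1) by (meson subset_imageE)
  have "card K = card T"
    using K card_image inj_on_subset[OF reflection_inj_on_independent[OF independent_B] K(1)] by metis
  then show "X \<in> {perp w K | w K. w \<in> weyl \<and> K \<subseteq> B \<and> card K = k - 1 \<and>
        irreducible_system orthogonal_group (reflection ` (w ` K))}"
    using T K conjugate_reflections[OF T(2), of K] Fix_conjugate[OF T(2) K(1)] by auto
next
  fix X assume "X \<in> {perp w K | w K. w \<in> weyl \<and> K \<subseteq> B \<and> card K = k - 1 \<and>
        irreducible_system orthogonal_group (reflection ` (w ` K))}"
  then obtain w K where K: "w \<in> weyl" "K \<subseteq> B" "card K = k - 1" "X = perp w K"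
    "irreducible_system orthogonal_group (reflection ` (w ` K))" by blast
  have "card (reflection ` K) = k - 1"
    using K card_image inj_on_subset[OF reflection_inj_on_independent[OF independent_B] K(2)] by metis
  then have "irreducible_parabolic weyl (reflection ` B) (k - 1)
    (generate orthogonal_group (reflection ` (w ` K)))"
    unfolding irreducible_parabolic_def
    using K conjugate_reflections[OF K(1), of K] by (intro exI[of _ "reflection ` K"] exI[of _ w]) auto
  then show "X \<in> parabolic_arrangement weyl (reflection ` B) k"
    unfolding parabolic_arrangement_def using Fix_conjugate[OF K(1,2)] K(4) by blast
qed

lemma irreducible_pair:
  assumes "w \<in> weyl" "\<alpha> \<in> B" "\<beta> \<in> B" "\<alpha> \<noteq> \<beta>"
  shows "irreducible_system orthogonal_group (reflection ` (w ` {\<alpha>, \<beta>})) \<longleftrightarrow> \<alpha> \<bullet> \<beta> \<noteq> 0"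
proof -
  let ?s = "reflection (w \<alpha>)" and ?t = "reflection (w \<beta>)"
  have conj: "reflection (w \<gamma>) (w x) = w (reflection \<gamma> x)" for \<gamma> x
    using reflection_conjugate[OF orthogonal_weyl[OF assms(1)]] .
  have inj: "w x = w y \<longleftrightarrow> x = y" for x y
    using orthogonal_transformation_inj[OF orthogonal_weyl[OF assms(1)]] by (simp add: inj_eq)
  have ne: "?s \<noteq> ?t"
  proof
    assume "?s = ?t"
    then have "reflection \<alpha> x = reflection \<beta> x" for x using conj[of \<alpha> x] conj[of \<beta> x] inj by metis
    then have "reflection \<alpha> = reflection \<beta>" by blast
    then show False using reflection_inj_on_independent[OF independent_B] assms by (auto dest: inj_onD)
  qed
  have comm: "?s \<circ> ?t = ?t \<circ> ?s \<longleftrightarrow> \<alpha> \<bullet> \<beta> = 0"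
  proof
    assume "?s \<circ> ?t = ?t \<circ> ?s"
    then have "?s (?t (w x)) = ?t (?s (w x))" for x by (metis comp_apply)
    then have "reflection \<alpha> (reflection \<beta> x) = reflection \<beta> (reflection \<alpha> x)" for x
      by (simp add: conj inj)
    then have "reflection \<alpha> \<circ> reflection \<beta> = reflection \<beta> \<circ> reflection \<alpha>" by (simp add: fun_eq_iff)
    then show "\<alpha> \<bullet> \<beta> = 0" using commuting_reflections_orthogonal assms by blast
  next
    assume "\<alpha> \<bullet> \<beta> = 0"
    then show "?s \<circ> ?t = ?t \<circ> ?s" 
      by (intro orthogonal_reflections_commute) (simp add: weyl_inner[OF assms(1)])
  qed
  have "irreducible_system orthogonal_group {?s, ?t}
    \<longleftrightarrow> ?s \<otimes>\<^bsub>orthogonal_group\<^esub> ?t \<noteq> ?t \<otimes>\<^bsub>orthogonal_group\<^esub> ?s"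
    by (rule irreducible_system_pair[OF group_orthogonal_group reflection_in_orthogonal_group
          reflection_in_orthogonal_group _ _ ne]) (auto simp: orthogonal_group_def fun_eq_iff)
  then show ?thesis using comm by (simp add: orthogonal_group_def)
qed

text \<open>A root subsystem spanned by pairwise orthogonal simple roots has type A1 x ... x A1, so
  it contains no root beyond these and their opposites.\<close>

lemma orthogonal_type_root:
  assumes "I \<in> orth_types" "\<gamma> \<in> \<Phi>" "\<gamma> \<in> span I"
  shows "\<exists>\<alpha>\<in>I. \<gamma> = \<alpha> \<or> \<gamma> = - \<alpha>"
proof -
  have I: "I \<subseteq> B" "finite I" using assms(1) finite_B finite_subset by (auto simp: orth_types_def)
  have orth: "\<alpha> \<bullet> \<beta> = 0" if "\<alpha> \<in> I" "\<beta> \<in> I" "\<alpha> \<noteq> \<beta>" for \<alpha> \<beta>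
    using assms(1) that by (auto simp: orth_types_def)
  obtain c where c: "\<gamma> = (\<Sum>\<alpha>\<in>I. c \<alpha> *\<^sub>R \<alpha>)" using assms(3) span_finite[OF I(2)] by auto
  have coeff: "coweight \<alpha> \<bullet> \<gamma> = c \<alpha>" if "\<alpha> \<in> I" for \<alpha>
  proof -
    have "coweight \<alpha> \<bullet> \<gamma> = (\<Sum>\<beta>\<in>I. c \<beta> * (coweight \<alpha> \<bullet> \<beta>))" unfolding c by (simp add: inner_sum_right)
    also have "\<dots> = (\<Sum>\<beta>\<in>I. if \<beta> = \<alpha> then c \<beta> else 0)"
      using I(1) by (intro sum.cong) (auto simp: coweight_inner)
    finally show ?thesis using that I(2) by simp
  qed
  have inner: "\<gamma> \<bullet> \<alpha> = c \<alpha> * (\<alpha> \<bullet> \<alpha>)" if "\<alpha> \<in> I" for \<alpha>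
  proof -
    have "\<gamma> \<bullet> \<alpha> = (\<Sum>\<beta>\<in>I. c \<beta> * (\<beta> \<bullet> \<alpha>))" unfolding c by (simp add: inner_sum_left)
    also have "\<dots> = (\<Sum>\<beta>\<in>I. if \<beta> = \<alpha> then c \<alpha> * (\<alpha> \<bullet> \<alpha>) else 0)"
      using orth that by (intro sum.cong) auto
    finally show ?thesis using that I(2) by simp
  qed
  have "\<exists>\<alpha>\<in>I. c \<alpha> \<noteq> 0"
  proof (rule ccontr)
    assume "\<not> (\<exists>\<alpha>\<in>I. c \<alpha> \<noteq> 0)"
    then have "\<gamma> = 0" using c by simp
    then show False using root_nonzero assms(2) by blast
  qed
  then obtain \<alpha> where \<alpha>: "\<alpha> \<in> I" "c \<alpha> \<noteq> 0" by blast
  \<comment> \<open>Reflecting in \<open>\<alpha>\<close> flips only the coefficient of \<open>\<alpha>\<close>, so a second nonzero coefficient would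
    produce a root with coefficients of both signs.\<close>
  have zero: "c \<beta> = 0" if \<beta>: "\<beta> \<in> I" "\<beta> \<noteq> \<alpha>" for \<beta>
  proof (rule ccontr)
    assume "c \<beta> \<noteq> 0"
    have r: "reflection \<alpha> \<gamma> = \<gamma> - (2 * c \<alpha>) *\<^sub>R \<alpha>"
    proof -
      have "\<alpha> \<bullet> \<alpha> \<noteq> 0" using \<alpha>(1) I(1) root_nonzero B_subset by auto
      then show ?thesis using inner[OF \<alpha>(1)] by (simp add: reflection_def)
    qed
    have root: "reflection \<alpha> \<gamma> \<in> \<Phi>" using root_reflection assms(2) \<alpha>(1) I(1) B_subset by blast
    have ab: "\<alpha> \<in> B" "\<beta> \<in> B" using \<alpha> \<beta> I by auto
    have "coweight \<alpha> \<bullet> reflection \<alpha> \<gamma> = - c \<alpha>" "coweight \<beta> \<bullet> reflection \<alpha> \<gamma> = c \<beta>"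
      unfolding r using coeff[OF \<alpha>(1)] coeff[OF \<beta>(1)] ab \<beta>(2)
        by (simp_all add: inner_diff_right coweight_inner)
    then show False
      using root_signs[OF root] root_signs[OF assms(2)] coeff[OF \<alpha>(1)] coeff[OF \<beta>(1)] ab \<alpha>(2) \<open>c \<beta> \<noteq> 0\<close>
      by (metis neg_0_le_iff_le neg_le_0_iff_le order_antisym)
  qed
  have "\<gamma> = (\<Sum>\<beta>\<in>I. if \<beta> = \<alpha> then c \<alpha> *\<^sub>R \<alpha> else 0)"
    unfolding c using zero by (intro sum.cong) auto
  then have "\<gamma> = c \<alpha> *\<^sub>R \<alpha>" using \<alpha>(1) I(2) by simp
  then show ?thesis using root_multiple[of \<alpha> "c \<alpha>"] assms(2) \<alpha>(1) I(1) B_subset by auto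
qed

text \<open>The chamber \<open>v\<close> indexing a subspace need not contain \<open>x\<close>;
  pulling back by a chamber \<open>w\<close> that does puts the root into the span of the walls at
  \<open>x\<close>.\<close>

lemma roots_vanishing_at_point:
  assumes "w \<in> weyl" "in_chamber w x" "v \<in> weyl" "\<beta> \<in> B" "x \<bullet> v \<beta> = 0" "w' \<in> weyl" "w' \<circ> w = id"
    "w \<circ> w' = id"
    "\<And>x y. w x \<bullet> y = x \<bullet> w' y"
  shows "w' (v \<beta>) \<in> \<Phi>" "w' (v \<beta>) \<in> span (walls w x)"
proof -
  have dom: "dominant (w' x)" using assms(2,9) by (simp add: dominant_def in_chamber_def inner_commute)
  show r: "w' (v \<beta>) \<in> \<Phi>" using weyl_root assms B_subset by blast
  have "{\<alpha>\<in>B. w' x \<bullet> \<alpha> = 0} = walls w x" using assms(9) by (auto simp: walls_def inner_commute)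
  moreover have "w' x \<bullet> w' (v \<beta>) = 0" using weyl_inner[OF assms(6)] assms(5) by simp
  ultimately show "w' (v \<beta>) \<in> span (walls w x)" using root_vanishing_in_span[OF dom r] by simp
qed

text \<open>Irreducible rank-two types are non-orthogonal pairs. If \<open>x\<close> lies in a
  retained face, two roots vanishing at \<open>x\<close> are, after pullback, walls up to sign; a
  nonzero inner product makes these walls coincide, contradicting independence of the pair.\<close>

lemma complement_rank_two:
  "- \<Union> (parabolic_arrangement weyl (reflection ` B) 3) = face_types.faces_union B orth_types"
proof -
  interpret F: face_types \<Phi> B orth_types by (rule face_types_orth)
  have arr: "x \<in> \<Union> (parabolic_arrangement weyl (reflection ` B) 3) \<longleftrightarrow>
    (\<exists>w\<in>weyl. \<exists>\<alpha>\<in>B. \<exists>\<beta>\<in>B. \<alpha> \<noteq> \<beta> \<and> \<alpha> \<bullet> \<beta> \<noteq> 0 \<and> x \<bullet> w \<alpha> = 0 \<and> x \<bullet> w \<beta> = 0)" for x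
  proof
    assume "x \<in> \<Union> (parabolic_arrangement weyl (reflection ` B) 3)"
    then obtain w K where K: "w \<in> weyl" "K \<subseteq> B" "card K = 2" "x \<in> perp w K"
      "irreducible_system orthogonal_group (reflection ` (w ` K))"
      unfolding parabolic_arrangement_eq by auto
    then obtain \<alpha> \<beta> where ab: "K = {\<alpha>, \<beta>}" "\<alpha> \<noteq> \<beta>" by (auto simp: card_2_iff)
    then have "\<alpha> \<bullet> \<beta> \<noteq> 0" using irreducible_pair[of w \<alpha> \<beta>] K by auto
    then show "\<exists>w\<in>weyl. \<exists>\<alpha>\<in>B. \<exists>\<beta>\<in>B. \<alpha> \<noteq> \<beta> \<and> \<alpha> \<bullet> \<beta> \<noteq> 0 \<and> x \<bullet> w \<alpha> = 0 \<and> x \<bullet> w \<beta> = 0"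
      using K ab by (auto simp: perp_def)
  next
    assume "\<exists>w\<in>weyl. \<exists>\<alpha>\<in>B. \<exists>\<beta>\<in>B. \<alpha> \<noteq> \<beta> \<and> \<alpha> \<bullet> \<beta> \<noteq> 0 \<and> x \<bullet> w \<alpha> = 0 \<and> x \<bullet> w \<beta> = 0"
    then obtain w \<alpha> \<beta> where d: "w \<in> weyl" "\<alpha> \<in> B" "\<beta> \<in> B" "\<alpha> \<noteq> \<beta>" "\<alpha> \<bullet> \<beta> \<noteq> 0" "x \<bullet> w \<alpha> = 0" "x \<bullet> w \<beta> = 0"
      by blast
    then have "perp w {\<alpha>, \<beta>} \<in> parabolic_arrangement weyl (reflection ` B) 3"
      unfolding parabolic_arrangement_eq using irreducible_pair[OF d(1-4)]
      by (intro CollectI exI[of _ w] exI[of _ "{\<alpha>, \<beta>}"]) auto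
    moreover have "x \<in> perp w {\<alpha>, \<beta>}" using d by (simp add: perp_def)
    ultimately show "x \<in> \<Union> (parabolic_arrangement weyl (reflection ` B) 3)" by blast
  qed
  have "x \<in> F.faces_union \<longleftrightarrow> x \<notin> \<Union> (parabolic_arrangement weyl (reflection ` B) 3)" for x
  proof
    assume "x \<in> F.faces_union"
    then obtain w where w: "w \<in> weyl" "in_chamber w x" "walls w x \<in> orth_types"
      by (auto simp: F.faces_union_def)
    obtain w' where w': "w' \<in> weyl" "w' \<circ> w = id" "w \<circ> w' = id" "\<And>x y. w x \<bullet> y = x \<bullet> w' y"
      using weyl_inverse[OF w(1)] by metis
    show "x \<notin> \<Union> (parabolic_arrangement weyl (reflection ` B) 3)"
      unfolding arr
    proof
      assume "\<exists>v\<in>weyl. \<exists>\<alpha>\<in>B. \<exists>\<beta>\<in>B. \<alpha> \<noteq> \<beta> \<and> \<alpha> \<bullet> \<beta> \<noteq> 0 \<and> x \<bullet> v \<alpha> = 0 \<and> x \<bullet> v \<beta> = 0"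
      then obtain v \<alpha> \<beta> where d: "v \<in> weyl" "\<alpha> \<in> B" "\<beta> \<in> B" "\<alpha> \<noteq> \<beta>" "\<alpha> \<bullet> \<beta> \<noteq> 0" "x \<bullet> v \<alpha> = 0"
        "x \<bullet> v \<beta> = 0"
        by blast
      have vanish: "\<exists>\<delta>\<in>walls w x. w' (v \<gamma>) = \<delta> \<or> w' (v \<gamma>) = - \<delta>" if "\<gamma> \<in> B" "x \<bullet> v \<gamma> = 0" for \<gamma>
        using orthogonal_type_root[OF w(3)] roots_vanishing_at_point[OF w(1,2) d(1) that w'] by blast
      obtain \<delta> where \<delta>: "\<delta> \<in> walls w x" "w' (v \<alpha>) = \<delta> \<or> w' (v \<alpha>) = - \<delta>" using vanish d by blast
      obtain \<epsilon> where \<epsilon>: "\<epsilon> \<in> walls w x" "w' (v \<beta>) = \<epsilon> \<or> w' (v \<beta>) = - \<epsilon>" using vanish d by blast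
      have ip: "w' (v y) \<bullet> w' (v z) = y \<bullet> z" for y z using weyl_inner[OF w'(1)] weyl_inner[OF d(1)]
        by simp
      have "\<delta> \<bullet> \<epsilon> \<noteq> 0" using ip[of \<alpha> \<beta>] d(5) \<delta>(2) \<epsilon>(2) by auto
      then have "\<delta> = \<epsilon>" using w(3) \<delta>(1) \<epsilon>(1) by (auto simp: orth_types_def)
      then have pm: "w' (v \<alpha>) = w' (v \<beta>) \<or> w' (v \<alpha>) = - w' (v \<beta>)" using \<delta>(2) \<epsilon>(2) by auto
      have "coweight \<alpha> \<bullet> \<alpha> = 1" "coweight \<alpha> \<bullet> \<beta> = 0" using d coweight_inner by auto
      moreover have "w' (v \<alpha>) - w' (v \<beta>) = w' (v (\<alpha> - \<beta>))" "w' (v \<alpha>) + w' (v \<beta>) = w' (v (\<alpha> + \<beta>))"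
        using linear_weyl[OF w'(1)] linear_weyl[OF d(1)] by (simp_all add: linear_diff linear_add)
      then have "w' (v (\<alpha> - \<beta>)) = 0 \<or> w' (v (\<alpha> + \<beta>)) = 0" using pm by auto
      then have "\<alpha> - \<beta> = 0 \<or> \<alpha> + \<beta> = 0"
        using ip[of "\<alpha> - \<beta>" "\<alpha> - \<beta>"] ip[of "\<alpha> + \<beta>" "\<alpha> + \<beta>"] by (metis inner_eq_zero_iff)
      then have "\<alpha> = \<beta> \<or> \<alpha> = - \<beta>" by (auto simp: eq_neg_iff_add_eq_0)
      ultimately show False using d(4) by auto
    qed
  next
    \<comment> \<open>Here the walls at \<open>x\<close> themselves would supply a forbidden pair,
      with the chamber containing \<open>x\<close> as index.\<close>
    assume nx: "x \<notin> \<Union> (parabolic_arrangement weyl (reflection ` B) 3)"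
    obtain w where w: "w \<in> weyl" "in_chamber w x" using ex_chamber by blast
    have "walls w x \<in> orth_types"
      using nx w(1) unfolding arr orth_types_def by (auto simp: walls_def)
    then show "x \<in> F.faces_union" using w by (auto simp: F.faces_union_def)
  qed
  then show ?thesis by blast
qed

section \<open>Codimension three and triviality on both sides\<close>

lemma perp_subspace: "subspace (perp w K)"
  by (auto simp: perp_def subspace_def inner_left_distrib)

lemma independent_weyl_image:
  assumes "w \<in> weyl" "K \<subseteq> B"
  shows "independent (w ` K)" "card (w ` K) = card K"
proof -
  have inj: "inj w" using orthogonal_transformation_inj[OF orthogonal_weyl[OF assms(1)]] .
  then show "independent (w ` K)"
    using linear_independent_injective_image[OF linear_weyl[OF assms(1)] independent_mono[OF independent_B assms(2)]]
    by (meson inj_on_subset subset_UNIV)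
  show "card (w ` K) = card K" using inj card_image inj_on_subset by (metis subset_UNIV)
qed

lemma dim_perp:
  assumes "w \<in> weyl" "K \<subseteq> B" shows "dim (perp w K) + card K = DIM('a)"
proof -
  have eq: "{y \<in> UNIV. \<forall>x\<in>span (w ` K). orthogonal x y} = perp w K"
  proof (intro equalityI subsetI)
    fix y assume "y \<in> {y \<in> UNIV. \<forall>x\<in>span (w ` K). orthogonal x y}"
    then show "y \<in> perp w K" by (auto simp: perp_def orthogonal_def inner_commute span_base)
  next
    fix y assume y: "y \<in> perp w K"
    have "orthogonal y x" if "x \<in> span (w ` K)" for x
      using that by (rule orthogonal_to_span) (use y in \<open>auto simp: perp_def orthogonal_def\<close>)
    then show "y \<in> {y \<in> UNIV. \<forall>x\<in>span (w ` K). orthogonal x y}" by (simp add: orthogonal_commute)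
  qed
  have "dim (perp w K) + dim (span (w ` K)) = dim (UNIV :: 'a set)"
    using dim_subspace_orthogonal_to_vectors[of "span (w ` K)" UNIV] unfolding eq by simp
  moreover have "dim (span (w ` K)) = card K"
    using dim_eq_card_independent[OF independent_weyl_image(1)[OF assms]] independent_weyl_image(2)[OF assms] by simp
  ultimately show ?thesis by simp
qed

lemma finite_perps: "finite {perp w K | w K. w \<in> weyl \<and> K \<subseteq> B \<and> P w K}"
proof (rule finite_subset)
  show "{perp w K | w K. w \<in> weyl \<and> K \<subseteq> B \<and> P w K} \<subseteq> (\<lambda>(w, K). perp w K) ` (weyl \<times> Pow B)" by auto
  show "finite ((\<lambda>(w, K). perp w K) ` (weyl \<times> Pow B))" using finite_weyl finite_B by simp
qed

text \<open>The predicate \<open>P\<close> allows two uses: the irreducible parabolics of rank k - 1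
  for k > 3, and all parabolics of rank three.\<close>

lemma perps_simply_connected:
  assumes "\<And>w K. P w K \<Longrightarrow> 3 \<le> card K"
    and "path p" "path_image p \<subseteq> - \<Union>{perp w K | w K. w \<in> weyl \<and> K \<subseteq> B \<and> P w K}"
      "pathfinish p = pathstart p"
  shows "homotopic_paths (- \<Union>{perp w K | w K. w \<in> weyl \<and> K \<subseteq> B \<and> P w K}) p
    (linepath (pathstart p) (pathstart p))"
proof (rule simply_connected_codim_three_complement[OF finite_perps _ _ assms(2-4)])
  fix L assume "L \<in> {perp w K | w K. w \<in> weyl \<and> K \<subseteq> B \<and> P w K}"
  then obtain w K where d: "L = perp w K" "w \<in> weyl" "K \<subseteq> B" "P w K" by blast
  show "subspace L" using d perp_subspace by blast
  show "dim L + 3 \<le> DIM('a)" unfolding d(1) using dim_perp[OF d(2,3)] assms(1)[OF d(4)] by linarith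
qed

text \<open>A dimension count: three independent vanishing roots pull back into the span of the
  walls at the point, which therefore number at least three.\<close>

lemma small_faces_union:
  "face_types.faces_union B small_types = - \<Union>{perp w K | w K. w \<in> weyl \<and> K \<subseteq> B \<and> card K = 3}"
proof -
  interpret F: face_types \<Phi> B small_types by (rule face_types_small)
  have "x \<in> F.faces_union \<longleftrightarrow> x \<notin> \<Union>{perp w K | w K. w \<in> weyl \<and> K \<subseteq> B \<and> card K = 3}" for x
  proof
    assume "x \<in> F.faces_union"
    then obtain w where w: "w \<in> weyl" "in_chamber w x" "walls w x \<in> small_types"
      by (auto simp: F.faces_union_def)
    obtain w' where w': "w' \<in> weyl" "w' \<circ> w = id" "w \<circ> w' = id" "\<And>x y. w x \<bullet> y = x \<bullet> w' y"
      using weyl_inverse[OF w(1)] by metis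
    show "x \<notin> \<Union>{perp w K | w K. w \<in> weyl \<and> K \<subseteq> B \<and> card K = 3}"
    proof
      assume "x \<in> \<Union>{perp w K | w K. w \<in> weyl \<and> K \<subseteq> B \<and> card K = 3}"
      then obtain v K where d: "v \<in> weyl" "K \<subseteq> B" "card K = 3" "x \<in> perp v K" by blast
      have "(w' \<circ> v) ` K \<subseteq> span (walls w x)"
      proof
        fix y assume "y \<in> (w' \<circ> v) ` K"
        then obtain \<beta> where b: "\<beta> \<in> K" "y = w' (v \<beta>)" by auto
        then have "\<beta> \<in> B" "x \<bullet> v \<beta> = 0" using d by (auto simp: perp_def)
        then show "y \<in> span (walls w x)" using roots_vanishing_at_point(2)[OF w(1,2) d(1) _ _ w'] b
          by blast
      qed
      moreover have "finite (walls w x)" using finite_B walls_subset finite_subset by blast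
      ultimately have "card ((w' \<circ> v) ` K) \<le> card (walls w x)"
        using independent_span_bound independent_weyl_image(1)[OF weyl_comp[OF w'(1) d(1)] d(2)] by blast
      then show False using independent_weyl_image(2)[OF weyl_comp[OF w'(1) d(1)] d(2)] d(3) w(3)
        by (simp add: small_types_def)
    qed
  next
    assume nx: "x \<notin> \<Union>{perp w K | w K. w \<in> weyl \<and> K \<subseteq> B \<and> card K = 3}"
    obtain w where w: "w \<in> weyl" "in_chamber w x" using ex_chamber by blast
    have "card (walls w x) \<le> 2"
    proof (rule ccontr)
      assume "\<not> card (walls w x) \<le> 2"
      then have "3 \<le> card (walls w x)" by simp
      then obtain K where K: "K \<subseteq> walls w x" "card K = 3" using obtain_subset_with_card_n by metis
      then have "x \<in> perp w K" "K \<subseteq> B" by (auto simp: perp_def walls_def)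
      then show False using nx w(1) K(2) by blast
    qed
    then have "walls w x \<in> small_types" using walls_subset by (simp add: small_types_def)
    then show "x \<in> F.faces_union" using w by (auto simp: F.faces_union_def)
  qed
  then show ?thesis by blast
qed

text \<open>A presentation of the group by its rank-two relations, obtained topologically: the
  gallery of a relator is a loop in a simply connected union of faces, and holonomy returns its
  word.\<close>

lemma relators_trivial_small:
  assumes "set u \<subseteq> B" "wprod u = id"
  shows "face_types.weq small_types u []"
proof -
  interpret F: face_types \<Phi> B small_types by (rule face_types_small)
  let ?p = "F.gallery_path id u"
  have im: "path_image ?p \<subseteq> F.faces_union" using F.gallery_path_in_faces_union[OF weyl_id assms(1)] .
  have "homotopic_paths F.faces_union ?p (linepath (pathstart ?p) (pathstart ?p))"
    unfolding small_faces_union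
    by (rule perps_simply_connected) (use im assms in \<open>auto simp: small_faces_union\<close>)
  then have h: "homotopic_paths F.faces_union (F.gallery_path id u) (F.gallery_path id [])"
    by (simp only: F.gallery_path_ends F.gallery_path.simps)
  have "F.weq (F.cocycle.hol (F.gallery_path id u)) (F.cocycle.hol (F.gallery_path id []))"
    using F.cocycle.hol_homotopic h F.Union_star_cover by simp
  moreover have "F.weq (F.cocycle.hol (F.gallery_path id u)) u"
    "F.weq (F.cocycle.hol (F.gallery_path id [])) []"
    by (rule F.hol_gallery_path[OF weyl_id assms(1)], rule F.hol_gallery_path[OF weyl_id]) simp
  ultimately show ?thesis using F.weq_trans F.weq_sym by blast
qed

end

context galleries
begin

text \<open>For \<open>m \<ge> 2\<close> every rank-two relation takes place inside a clique, so all
  rank-two moves, and with them all relators, are discrete homotopies.\<close>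

lemma dhr_trivial:
  assumes "2 \<le> m" "l \<in> loops"
  shows "(l, [cham w\<^sub>0]) \<in> dhr"
proof -
  interpret F: face_types \<Phi> B small_types by (rule face_types_small)
  have weq_gq: "gq a b" if "F.weq a b" "set a \<subseteq> B" for a b
    using that(1) unfolding F.weq_def
  proof (induction rule: rtranclp_induct)
    case base
    then show ?case using gq_refl that by blast
  next
    case (step b c)
    obtain xs x y ys where d: "b = xs @ x @ ys" "c = xs @ y @ ys" "set x \<in> small_types"
      "set y \<in> small_types" "wprod x = wprod y"
      using step(2) by (auto simp: F.wstep_def)
    have "gq x y" using d(3-5) assms(1) by (intro gq_same_small_support) (auto simp: small_types_def)
    moreover have "set b \<subseteq> B" using step by (auto simp: gq_def)
    ultimately have "gq b c" unfolding d using d(1) by (intro gq_context) auto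
    then show ?case using step gq_trans by blast
  qed
  have "gq (loop_word l) []"
    using weq_gq relators_trivial_small[OF loop_word[OF assms(2)]] loop_word(1)[OF assms(2)] by blast
  then have "(cgal w\<^sub>0 (loop_word l), cgal w\<^sub>0 []) \<in> dhr" using dhr_gal loop_word(2)[OF assms(2)]
    by blast
  then have "(cgal w\<^sub>0 (loop_word l), [cham w\<^sub>0]) \<in> dhr" by simp
  then show ?thesis using dhr_trans[OF dhr_loop_word[OF assms(2)]] by blast
qed

lemma q_near_base: "q_near q (cham w\<^sub>0) (cham w\<^sub>0)"
  using q_near_cham_iff[OF w0 w0] near_refl by blast

end

lemma loops_at_join:
  assumes "p \<in> loops_at M x" "q \<in> loops_at M x" shows "p +++ q \<in> loops_at M x"
  using assms by (auto simp: loops_at_def path_image_join)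

theorem theorem3p4:
  fixes W S :: "(real ^ 'n \<Rightarrow> real ^ 'n) set"
    and \<Phi> B M :: "(real ^ 'n) set"
    and k :: nat
    and x\<^sub>0 :: "real ^ 'n"
    and \<sigma>\<^sub>0 :: "(real ^ 'n \<Rightarrow> real ^ 'n) set set"
  assumes "root_system \<Phi>" and "simple_system \<Phi> B" and "span B = UNIV"
    and "W = reflection_group \<Phi>" and "finite W"
    and "S = reflection ` B"
    and "3 \<le> k" and "k \<le> CARD('n) + 1"
    and "M = UNIV - \<Union> (parabolic_arrangement W S k)"
    and "x\<^sub>0 \<in> M"
    and "maximal_simplex (coxeter_complex W S) \<sigma>\<^sub>0"
  shows "fundamental_group M x\<^sub>0 \<cong>
    discrete_homotopy_group (CARD('n) + 1 - k) (coxeter_complex W S) \<sigma>\<^sub>0"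
proof -
  interpret simple_roots \<Phi> B by standard fact+
  have W: "W = weyl" using assms(4) reflection_group_eq_weyl by simp
  interpret finite_simple_roots \<Phi> B by standard (use assms(5) W in simp)
  define q where "q = CARD('n) + 1 - k"
  obtain w\<^sub>0 where base: "w\<^sub>0 \<in> weyl" "\<sigma>\<^sub>0 = cham w\<^sub>0" using maximal_simplex_cham assms(11) W assms(6)
    by blast
  \<comment> \<open>Sharing n - k + 2 vertices leaves k - 2 types free; the bounds on
    \<open>k\<close> keep the subtractions of natural numbers exact.\<close>
  have qm: "q + 1 + (k - 2) = card B" using assms(7,8) card_B by (simp add: q_def)
  interpret galleries \<Phi> B "k - 2" q w\<^sub>0 by standard (use base qm assms(7) in auto)
  have M: "M = - \<Union> (parabolic_arrangement weyl (reflection ` B) k)" using assms(6,9) W by auto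
  have join: "a @ b \<in> loops" if "a \<in> loops" "b \<in> loops" for a b
    using q_loops_append[OF that q_near_base] .
  have "fundamental_group M x\<^sub>0 \<cong> discrete_homotopy_group q complex (cham w\<^sub>0)"
  proof (cases "k = 3")
    case True
    interpret panel_galleries \<Phi> B "k - 2" q w\<^sub>0 by standard (simp add: True)
    have MF: "M = F.faces_union" using M True complement_rank_two by simp
    show ?thesis
      unfolding fundamental_group_def discrete_homotopy_group_def
    proof (rule class_group_iso[where E = F.weq and f = F.cocycle.hol and g = loop_word])
      show "loop_homotopy_rel M x\<^sub>0
        = {(a, b). a \<in> loops_at M x\<^sub>0 \<and> b \<in> loops_at M x\<^sub>0 \<and> F.weq (F.cocycle.hol a) (F.cocycle.hol b)}"
        unfolding loop_homotopy_rel_def MF using F.loops_homotopic_iff by blast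
      show "dhr = {(a, b). a \<in> loops \<and> b \<in> loops \<and> F.weq (loop_word a) (loop_word b)}"
        unfolding set_eq_iff split_paired_All using dhr_iff_weq dhr_loops by blast
      show "a +++ b \<in> loops_at M x\<^sub>0 \<and> F.weq (F.cocycle.hol (a +++ b))
        (F.cocycle.hol a @ F.cocycle.hol b)"
        if "a \<in> loops_at M x\<^sub>0" "b \<in> loops_at M x\<^sub>0" for a b
        using that loops_at_join[OF that] F.cocycle.hol_join[of a b] F.Union_star_cover MF
          by (auto simp: loops_at_def)
      show "a @ b \<in> loops \<and> F.weq (loop_word (a @ b)) (loop_word a @ loop_word b)"
        if "a \<in> loops" "b \<in> loops" for a b
        using that join loop_word_append by blast
      show "\<exists>c\<in>loops. F.weq (F.cocycle.hol a) (loop_word c)" if "a \<in> loops_at M x\<^sub>0" for a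
        using loop_word_surj[of "F.cocycle.hol a"] F.hol_loop[of a x\<^sub>0] that MF F.weq_sym by blast
      show "\<exists>a\<in>loops_at M x\<^sub>0. F.weq (F.cocycle.hol a) (loop_word c)" if "c \<in> loops" for c
        using F.hol_surj[of x\<^sub>0 "loop_word c"] loop_word[OF that] assms(10) MF by blast
    qed (fact F.weq_refl F.weq_sym F.weq_trans F.weq_append)+
  next
    case False
    then have k: "2 \<le> k - 2" using assms(7) by simp
    \<comment> \<open>Here k - 1 is at least three, so all subspaces of the arrangement have
      codimension at least three.\<close>
    have null: "homotopic_paths M a (linepath x\<^sub>0 x\<^sub>0)" if "a \<in> loops_at M x\<^sub>0" for a
    proof -
      have a: "path a" "path_image a \<subseteq> M" "pathfinish a = pathstart a" "pathstart a = x\<^sub>0"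
        using that by (auto simp: loops_at_def)
      let ?P = "\<lambda>w K. card K = k - 1 \<and> irreducible_system orthogonal_group (reflection ` (w ` K))"
      have "homotopic_paths (- \<Union>{perp w K | w K. w \<in> weyl \<and> K \<subseteq> B \<and> ?P w K}) a
        (linepath (pathstart a) (pathstart a))"
        by (rule perps_simply_connected) (use a k in \<open>auto simp: M parabolic_arrangement_eq\<close>)
      then show ?thesis unfolding M parabolic_arrangement_eq a(4) .
    qed
    show ?thesis
      unfolding fundamental_group_def discrete_homotopy_group_def
    \<comment> \<open>All loops on each side are equivalent, so both quotients have one class and
      only the existence of a loop on each side must be supplied.\<close>
    proof (rule class_group_iso[where E = "\<lambda>_ _. True" and f = "\<lambda>_. []" and g = "\<lambda>_. []"])
      show "loop_homotopy_rel M x\<^sub>0 = {(a, b). a \<in> loops_at M x\<^sub>0 \<and> b \<in> loops_at M x\<^sub>0 \<and> True}"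
        unfolding loop_homotopy_rel_def
          using homotopic_paths_trans[OF null homotopic_paths_sym[OF null]] by blast
      show "dhr = {(a, b). a \<in> loops \<and> b \<in> loops \<and> True}"
        using dhr_trans[OF dhr_trivial[OF k] dhr_sym[OF dhr_trivial[OF k]]] dhr_loops by blast
      show "a +++ b \<in> loops_at M x\<^sub>0 \<and> True" if "a \<in> loops_at M x\<^sub>0" "b \<in> loops_at M x\<^sub>0" for a b
        using loops_at_join[OF that] by simp
      show "a @ b \<in> loops \<and> True" if "a \<in> loops" "b \<in> loops" for a b using join[OF that] by simp
      show "\<exists>c\<in>loops. True" if "a \<in> loops_at M x\<^sub>0" for a
      proof -
        have "[cham w\<^sub>0] \<in> loops" using cham_in_complex[OF base(1)] by (simp add: q_loops_def)
        then show ?thesis by blast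
      qed
      show "\<exists>a\<in>loops_at M x\<^sub>0. True" if "c \<in> loops" for c
      proof -
        have "linepath x\<^sub>0 x\<^sub>0 \<in> loops_at M x\<^sub>0" using assms(10) by (simp add: loops_at_def)
        then show ?thesis by blast
      qed
    qed auto
  qed
  then show ?thesis using W assms(6) base(2) by (simp add: q_def)
qed

end
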